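(* Let $X$ be a proper geodesic metric space with a convergence boundary $\partial X$ and let $\Gamma<\mathrm{Isom}(X)$ be a non-elementary discrete subgroup. Assume that the proper action $\Gamma\curvearrowright X$ has purely exponential growth with a (non-pinched) contracting element. If $H<\mathrm{Isom}(X)$ is a discrete subgroup confined by $\Gamma$ with a finite confining subset that intersects $E(\Gamma)$ trivially, then $\omega_H>\omega_\Gamma/2$.
   Context: Fix $o\in X$. Contracting: a closed $Z\subseteq X$ is $C$-contracting if $\mathrm{diam}(\pi_Z(x)\cup\pi_Z(y))\le C$ whenever $d(x,y)\le d(x,Z)$, where $\pi_Z$ is the nearest-point projection (set). An isometry $g$ is contracting if $n\mapsto g^no$ is a quasi-isometric embedding of $\mathbb Z$ with contracting image. A group is elementary if finite or virtually $\mathbb Z$. $N_H(o,n)=\{ho:h\in H,d(o,ho)\le n\}$, $\omega_H=\limsup_n\frac1n\log\sharp N_H(o,n)$. Purely exponential growth: $\sharp N_\Gamma(o,n)\asymp e^{n\omega_\Gamma}$ for all $n\ge0$ (equality up to a bounded multiplicative constant). Confined with finite confining subset $P$: $P\subseteq\mathrm{Isom}(X)$ is finite and $g^{-1}Hg\cap(P\setminus\{1\})\ne\emptyset$ for all $g\in\Gamma$. "Intersects $E(\Gamma)$ trivially" means $P\cap E(\Gamma)\subseteq\{1\}$. Convergence boundary: a metrizable compactification $\overline X=X\cup\partial X$ with $X$ open and dense, to which the action of $\mathrm{Isom}(X)$ extends by homeomorphisms, with an $\mathrm{Isom}(X)$-invariant partition $[\cdot]$ of $\partial X$ ($[\xi]$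 is the class of $\xi$; $[A]=\bigcup_{\xi\in A}[\xi]$). A sequence tends (accumulates) to $[\xi]$ if its limit (all its accumulation points) lie in $[\xi]$; subsets or points $A_n$ are escaping if $d(o,A_n)\to\infty$. Required: (A) any contracting geodesic ray $\gamma$ accumulates into a closed class $[\xi]$, and any $y_n\in X$ with $\pi_\gamma(y_n)$ escaping tends to $[\xi]$. (B) for any escaping sequence of $C$-contracting quasi-geodesics $X_n$ ($C$ fixed), and any $o$, some subsequence of the cones $\Omega_o(X_n)=\{y\in X:\text{some geodesic }[o,y]\text{ meets }X_n\}$ accumulates to a class $[\xi]$, i.e. any convergent sequence $y_n\in\Omega_o(X_n)$ tends to a point of $[\xi]$. (C) the set $\mathcal C$ of non-pinched points is nonempty, where $\xi$ is non-pinched if for all sequences $x_n,y_n\in X$ converging to $[\xi]$ the segments $[x_n,y_n]$ are escaping; and for $\xi\in\mathcal C$, $[\cdot]$ is closed on $U=\Gamma[\xi]$: if $x_n,y_n\in U$, $[x_n]=[y_n]$, $x_n\to\xi'$, $y_n\to\eta'$, then $[\xi']=[\eta']$. By (A) the rays $n\mapsto f^{\pm n}o$, $n\geq 0$, of a contracting element $f$ determine classes $[f^+],[f^-]$; $f$ is non-pinched if $[f^+]\cup[f^-]\subseteq\mathcal C$. $E(\Gamma)=\{g\in\mathrm{Isom}(X): g[\xi]=[\xi]\text{ for every class }[\xi]\subseteq[\Lambda(\Gamma o)]\}$, where $\Lambda(\Gamma o)$ is the set of accumulation points of $\Gamma o$ in $\partial X$. *)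

theory Defs
  imports "HOL-Analysis.Analysis" "HOL-Algebra.Algebra"
begin

section \<open>The isometry group and its subgroups\<close>

definition isom_group :: "('a::metric_space \<Rightarrow> 'a) monoid" where
  "isom_group =
     \<lparr>carrier = {g. surj g \<and> (\<forall>x y. dist (g x) (g y) = dist x y)}, mult = (\<circ>), one = id\<rparr>"

lemma group_isom_group: "group (isom_group :: ('a::metric_space \<Rightarrow> 'a) monoid)"
proof (rule groupI)
  fix g :: "'a \<Rightarrow> 'a"
  assume "g \<in> carrier isom_group"
  then have s: "surj g" and d: "\<And>x y. dist (g x) (g y) = dist x y"
    by (auto simp: isom_group_def)
  have i: "inj g"
    by (rule injI) (metis d dist_eq_0_iff)
  have dg: "dist (inv_into UNIV g x) (inv_into UNIV g y) = dist x y" for x y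
    using d[of "inv_into UNIV g x" "inv_into UNIV g y"] s by (simp add: surj_f_inv_f)
  show "\<exists>h\<in>carrier isom_group. h \<otimes>\<^bsub>isom_group\<^esub> g = \<one>\<^bsub>isom_group\<^esub>"
  proof
    show "inv_into UNIV g \<in> carrier isom_group"
      using dg inj_imp_surj_inv[OF i] by (simp add: isom_group_def)
    show "inv_into UNIV g \<otimes>\<^bsub>isom_group\<^esub> g = \<one>\<^bsub>isom_group\<^esub>"
      using i by (simp add: isom_group_def)
  qed
next
  fix g h :: "'a \<Rightarrow> 'a"
  assume "g \<in> carrier isom_group" "h \<in> carrier isom_group"
  then show "g \<otimes>\<^bsub>isom_group\<^esub> h \<in> carrier isom_group"
    using comp_surj[of h g] by (simp add: isom_group_def)
qed (simp_all add: isom_group_def o_assoc)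

definition virtually_infinite_cyclic :: "('g, 'm) monoid_scheme \<Rightarrow> bool" where
  "virtually_infinite_cyclic G \<longleftrightarrow>
     (\<exists>K. subgroup K G \<and> finite (rcosets\<^bsub>G\<^esub> K) \<and> G\<lparr>carrier := K\<rparr> \<cong> integer_group)"

definition elementary :: "('g, 'm) monoid_scheme \<Rightarrow> bool" where
  "elementary G \<longleftrightarrow> finite (carrier G) \<or> virtually_infinite_cyclic G"

text \<open>Discreteness refers to the library topology on functions, that is, pointwise convergence.
  On the isometry group of a metric space it coincides with the compact-open topology.\<close>

definition discrete_isom_subgroup :: "('a::metric_space \<Rightarrow> 'a) set \<Rightarrow> bool" where
  "discrete_isom_subgroup G \<longleftrightarrow> subgroup G isom_group \<and> discrete G"

section \<open>Geodesics and contracting sets\<close>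

definition geodesic_segment :: "'a::metric_space set \<Rightarrow> 'a \<Rightarrow> 'a \<Rightarrow> bool" where
  "geodesic_segment S x y \<longleftrightarrow>
     (\<exists>\<gamma>. \<gamma> 0 = x \<and> \<gamma> (dist x y) = y \<and> S = \<gamma> ` {0..dist x y} \<and>
        (\<forall>s\<in>{0..dist x y}. \<forall>t\<in>{0..dist x y}. dist (\<gamma> s) (\<gamma> t) = \<bar>s - t\<bar>))"

definition geodesic_ray :: "(real \<Rightarrow> 'a::metric_space) \<Rightarrow> bool" where
  "geodesic_ray \<gamma> \<longleftrightarrow> (\<forall>s\<ge>0. \<forall>t\<ge>0. dist (\<gamma> s) (\<gamma> t) = \<bar>s - t\<bar>)"

definition proper_geodesic_space :: "'a::metric_space itself \<Rightarrow> bool" where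
  "proper_geodesic_space _ \<longleftrightarrow>
     (\<forall>(x::'a) r. compact (cball x r)) \<and> (\<forall>x y::'a. \<exists>S. geodesic_segment S x y)"

text \<open>The domain is given by a set \<open>I\<close> with an explicit distance function \<open>\<delta>\<close>, because \<^typ>\<open>int\<close> is
  not an instance of the class of metric spaces.\<close>

definition quasi_isometric_embedding_on ::
    "'c set \<Rightarrow> ('c \<Rightarrow> 'c \<Rightarrow> real) \<Rightarrow> ('c \<Rightarrow> 'a::metric_space) \<Rightarrow> bool" where
  "quasi_isometric_embedding_on I \<delta> q \<longleftrightarrow>
     (\<exists>k\<ge>1. \<exists>c\<ge>0. \<forall>s\<in>I. \<forall>t\<in>I.
        \<delta> s t / k - c \<le> dist (q s) (q t) \<and> dist (q s) (q t) \<le> k * \<delta> s t + c)"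

text \<open>Quasi-geodesics are sets, need not be continuous, and may be finite, half-infinite or
  bi-infinite.\<close>

definition quasi_geodesic :: "'a::metric_space set \<Rightarrow> bool" where
  "quasi_geodesic Z \<longleftrightarrow>
     (\<exists>I q. is_interval (I :: real set) \<and> I \<noteq> {} \<and> quasi_isometric_embedding_on I dist q \<and> Z = q ` I)"

definition nearest_proj :: "'a::metric_space set \<Rightarrow> 'a \<Rightarrow> 'a set" where
  "nearest_proj Z x = {z \<in> Z. dist x z = infdist x Z}"

definition contracting_set :: "real \<Rightarrow> 'a::metric_space set \<Rightarrow> bool" where
  "contracting_set C Z \<longleftrightarrow> closed Z \<and> Z \<noteq> {} \<and>
     (\<forall>x y. dist x y \<le> infdist x Z \<longrightarrow> diameter (nearest_proj Z x \<union> nearest_proj Z y) \<le> C)"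

definition contracting_isometry :: "'a::metric_space \<Rightarrow> ('a \<Rightarrow> 'a) \<Rightarrow> bool" where
  "contracting_isometry x\<^sub>0 g \<longleftrightarrow> g \<in> carrier isom_group \<and>
     quasi_isometric_embedding_on UNIV (\<lambda>m n::int. real_of_int \<bar>m - n\<bar>)
       (\<lambda>n::int. (g [^]\<^bsub>isom_group\<^esub> n) x\<^sub>0) \<and>
     (\<exists>C. contracting_set C (range (\<lambda>n::int. (g [^]\<^bsub>isom_group\<^esub> n) x\<^sub>0)))"

definition escaping :: "'a::metric_space \<Rightarrow> (nat \<Rightarrow> 'a set) \<Rightarrow> bool" where
  "escaping x\<^sub>0 A \<longleftrightarrow> filterlim (\<lambda>n. infdist x\<^sub>0 (A n)) at_top sequentially"

definition geodesic_cone :: "'a::metric_space \<Rightarrow> 'a set \<Rightarrow> 'a set" where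
  "geodesic_cone x\<^sub>0 Z = {y. \<exists>S. geodesic_segment S x\<^sub>0 y \<and> S \<inter> Z \<noteq> {}}"

section \<open>Orbit growth\<close>

definition orbit_ball :: "('a::metric_space \<Rightarrow> 'a) set \<Rightarrow> 'a \<Rightarrow> nat \<Rightarrow> 'a set" where
  "orbit_ball H x\<^sub>0 n = {h x\<^sub>0 |h. h \<in> H \<and> dist x\<^sub>0 (h x\<^sub>0) \<le> real n}"

definition growth_rate :: "('a::metric_space \<Rightarrow> 'a) set \<Rightarrow> 'a \<Rightarrow> ereal" where
  "growth_rate H x\<^sub>0 = limsup (\<lambda>n. ereal (ln (real (card (orbit_ball H x\<^sub>0 n))) / real n))"

definition purely_exponential_growth :: "('a::metric_space \<Rightarrow> 'a) set \<Rightarrow> 'a \<Rightarrow> bool" where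
  "purely_exponential_growth G x\<^sub>0 \<longleftrightarrow>
     (\<exists>w::real. growth_rate G x\<^sub>0 = ereal w \<and>
        (\<exists>c\<ge>1. \<forall>n. exp (real n * w) / c \<le> real (card (orbit_ball G x\<^sub>0 n)) \<and>
                   real (card (orbit_ball G x\<^sub>0 n)) \<le> c * exp (real n * w)))"

section \<open>Convergence boundaries\<close>

text \<open>A compactification of \<open>X\<close> is a compact metric type \<open>'b\<close> with an open dense topological
  embedding \<open>\<iota>\<close> of \<open>X\<close>; only the topology of \<open>'b\<close> is used.  The map \<open>E\<close> sends an isometry of \<open>X\<close>
  to its extension to \<open>'b\<close>; by density it is determined by \<open>\<iota>\<close> on isometries and automatically
  is a group action.\<close>

definition compactification :: "('a::metric_space \<Rightarrow> 'b::metric_space) \<Rightarrow> bool" where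
  "compactification \<iota> \<longleftrightarrow> compact (UNIV :: 'b set) \<and>
     (\<exists>\<kappa>. homeomorphism UNIV (range \<iota>) \<iota> \<kappa>) \<and> open (range \<iota>) \<and> closure (range \<iota>) = UNIV"

definition extends_isometries ::
    "('a::metric_space \<Rightarrow> 'b::metric_space) \<Rightarrow> (('a \<Rightarrow> 'a) \<Rightarrow> 'b \<Rightarrow> 'b) \<Rightarrow> bool" where
  "extends_isometries \<iota> E \<longleftrightarrow>
     (\<forall>g\<in>carrier isom_group. (\<exists>k. homeomorphism UNIV UNIV (E g) k) \<and> (\<forall>x. E g (\<iota> x) = \<iota> (g x)))"

definition bdry :: "('a \<Rightarrow> 'b) \<Rightarrow> 'b set" where
  "bdry \<iota> = - range \<iota>"

text \<open>The partition is given by an equivalence relation \<open>R\<close> on the boundary, so the class of \<open>\<xi>\<close> is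
  \<open>R `` {\<xi>}\<close> and \<open>[A]\<close> is \<open>R `` A\<close>.\<close>

definition invariant_partition ::
    "('a::metric_space \<Rightarrow> 'b) \<Rightarrow> (('a \<Rightarrow> 'a) \<Rightarrow> 'b \<Rightarrow> 'b) \<Rightarrow> 'b rel \<Rightarrow> bool" where
  "invariant_partition \<iota> E R \<longleftrightarrow> equiv (bdry \<iota>) R \<and>
     (\<forall>g\<in>carrier isom_group. \<forall>c\<in>bdry \<iota> // R. E g ` c \<in> bdry \<iota> // R)"

definition accum_pts :: "('a \<Rightarrow> 'b::metric_space) \<Rightarrow> 'a set \<Rightarrow> 'b set" where
  "accum_pts \<iota> A = {b \<in> bdry \<iota>. b islimpt \<iota> ` A}"

definition seq_accumulates :: "('a \<Rightarrow> 'b::metric_space) \<Rightarrow> (nat \<Rightarrow> 'a) \<Rightarrow> 'b set \<Rightarrow> bool" where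
  "seq_accumulates \<iota> y A \<longleftrightarrow>
     (\<forall>r l. strict_mono (r :: nat \<Rightarrow> nat) \<and> (\<lambda>n. \<iota> (y (r n))) \<longlonglongrightarrow> l \<longrightarrow> l \<in> A)"

definition seq_converges :: "('a \<Rightarrow> 'b::metric_space) \<Rightarrow> (nat \<Rightarrow> 'a) \<Rightarrow> 'b set \<Rightarrow> bool" where
  "seq_converges \<iota> y A \<longleftrightarrow> (\<exists>l\<in>A. (\<lambda>n. \<iota> (y n)) \<longlonglongrightarrow> l)"

definition non_pinched_pts ::
    "'a::metric_space \<Rightarrow> ('a \<Rightarrow> 'b::metric_space) \<Rightarrow> 'b rel \<Rightarrow> 'b set" where
  "non_pinched_pts x\<^sub>0 \<iota> R = {\<xi> \<in> bdry \<iota>. \<forall>x y S.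
     seq_converges \<iota> x (R `` {\<xi>}) \<and> seq_converges \<iota> y (R `` {\<xi>}) \<and>
     (\<forall>n. geodesic_segment (S n) (x n) (y n)) \<longrightarrow> escaping x\<^sub>0 S}"

definition closed_partition_on :: "'b::metric_space rel \<Rightarrow> 'b set \<Rightarrow> bool" where
  "closed_partition_on R U \<longleftrightarrow>
     (\<forall>x y \<xi> \<eta>. (\<forall>n::nat. x n \<in> U \<and> y n \<in> U \<and> R `` {x n} = R `` {y n}) \<and>
        x \<longlonglongrightarrow> \<xi> \<and> y \<longlonglongrightarrow> \<eta> \<longrightarrow> R `` {\<xi>} = R `` {\<eta>})"

definition boundary_axiom_A ::
    "'a::metric_space \<Rightarrow> ('a \<Rightarrow> 'b::metric_space) \<Rightarrow> 'b rel \<Rightarrow> bool" where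
  "boundary_axiom_A x\<^sub>0 \<iota> R \<longleftrightarrow>
     (\<forall>\<gamma>. geodesic_ray \<gamma> \<and> (\<exists>C. contracting_set C (\<gamma> ` {0..})) \<longrightarrow>
        (\<exists>\<xi>\<in>bdry \<iota>. closed (R `` {\<xi>}) \<and> accum_pts \<iota> (\<gamma> ` {0..}) \<subseteq> R `` {\<xi>} \<and>
           (\<forall>y. escaping x\<^sub>0 (\<lambda>n. nearest_proj (\<gamma> ` {0..}) (y n)) \<longrightarrow>
                seq_accumulates \<iota> y (R `` {\<xi>}))))"

definition boundary_axiom_B ::
    "'a::metric_space \<Rightarrow> ('a \<Rightarrow> 'b::metric_space) \<Rightarrow> 'b rel \<Rightarrow> bool" where
  "boundary_axiom_B x\<^sub>0 \<iota> R \<longleftrightarrow>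
     (\<forall>C Z p. (\<forall>n. quasi_geodesic (Z n) \<and> contracting_set C (Z n)) \<and> escaping x\<^sub>0 Z \<longrightarrow>
        (\<exists>r. strict_mono (r :: nat \<Rightarrow> nat) \<and>
           (\<exists>\<xi>\<in>bdry \<iota>. \<forall>y. (\<forall>n. y n \<in> geodesic_cone p (Z (r n))) \<longrightarrow>
                            seq_accumulates \<iota> y (R `` {\<xi>}))))"

definition boundary_axiom_C ::
    "'a::metric_space \<Rightarrow> ('a \<Rightarrow> 'b::metric_space) \<Rightarrow> (('a \<Rightarrow> 'a) \<Rightarrow> 'b \<Rightarrow> 'b) \<Rightarrow> 'b rel \<Rightarrow>
     ('a \<Rightarrow> 'a) set \<Rightarrow> bool" where
  "boundary_axiom_C x\<^sub>0 \<iota> E R \<Gamma> \<longleftrightarrow>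
     non_pinched_pts x\<^sub>0 \<iota> R \<noteq> {} \<and>
     (\<forall>\<xi>\<in>non_pinched_pts x\<^sub>0 \<iota> R. closed_partition_on R (\<Union>g\<in>\<Gamma>. E g ` (R `` {\<xi>})))"

definition convergence_boundary ::
    "'a::metric_space \<Rightarrow> ('a \<Rightarrow> 'b::metric_space) \<Rightarrow> (('a \<Rightarrow> 'a) \<Rightarrow> 'b \<Rightarrow> 'b) \<Rightarrow> 'b rel \<Rightarrow>
     ('a \<Rightarrow> 'a) set \<Rightarrow> bool" where
  "convergence_boundary x\<^sub>0 \<iota> E R \<Gamma> \<longleftrightarrow>
     compactification \<iota> \<and> extends_isometries \<iota> E \<and> invariant_partition \<iota> E R \<and>
     boundary_axiom_A x\<^sub>0 \<iota> R \<and> boundary_axiom_B x\<^sub>0 \<iota> R \<and> boundary_axiom_C x\<^sub>0 \<iota> E R \<Gamma>"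

text \<open>Here \<open>R `` {\<xi>}\<close> and \<open>R `` {\<eta>}\<close> are the classes of the attracting and repelling ends of \<open>f\<close>; they
  are unique since the accumulation sets are nonempty by compactness.\<close>

definition non_pinched_contracting ::
    "'a::metric_space \<Rightarrow> ('a \<Rightarrow> 'b::metric_space) \<Rightarrow> 'b rel \<Rightarrow> ('a \<Rightarrow> 'a) \<Rightarrow> bool" where
  "non_pinched_contracting x\<^sub>0 \<iota> R f \<longleftrightarrow> contracting_isometry x\<^sub>0 f \<and>
     (\<exists>\<xi>\<in>bdry \<iota>. \<exists>\<eta>\<in>bdry \<iota>.
        accum_pts \<iota> (range (\<lambda>n::nat. (f [^]\<^bsub>isom_group\<^esub> int n) x\<^sub>0)) \<subseteq> R `` {\<xi>} \<and>
        accum_pts \<iota> (range (\<lambda>n::nat. (f [^]\<^bsub>isom_group\<^esub> (- int n)) x\<^sub>0)) \<subseteq> R `` {\<eta>} \<and>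
        R `` {\<xi>} \<union> R `` {\<eta>} \<subseteq> non_pinched_pts x\<^sub>0 \<iota> R)"

definition elliptic_radical ::
    "'a::metric_space \<Rightarrow> ('a \<Rightarrow> 'b::metric_space) \<Rightarrow> (('a \<Rightarrow> 'a) \<Rightarrow> 'b \<Rightarrow> 'b) \<Rightarrow> 'b rel \<Rightarrow>
     ('a \<Rightarrow> 'a) set \<Rightarrow> ('a \<Rightarrow> 'a) set" where
  "elliptic_radical x\<^sub>0 \<iota> E R \<Gamma> =
     {g \<in> carrier isom_group. \<forall>\<xi>\<in>bdry \<iota>.
        R `` {\<xi>} \<subseteq> R `` accum_pts \<iota> {h x\<^sub>0 |h. h \<in> \<Gamma>} \<longrightarrow> E g ` (R `` {\<xi>}) = R `` {\<xi>}}"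

section \<open>Confined subgroups\<close>

definition confining_subset ::
    "('a::metric_space \<Rightarrow> 'a) set \<Rightarrow> ('a \<Rightarrow> 'a) set \<Rightarrow> ('a \<Rightarrow> 'a) set \<Rightarrow> bool" where
  "confining_subset \<Gamma> H P \<longleftrightarrow> P \<subseteq> carrier isom_group \<and> finite P \<and>
     (\<forall>g\<in>\<Gamma>. {inv\<^bsub>isom_group\<^esub> g \<otimes>\<^bsub>isom_group\<^esub> h \<otimes>\<^bsub>isom_group\<^esub> g |h. h \<in> H} \<inter> (P - {\<one>\<^bsub>isom_group\<^esub>}) \<noteq> {})"

end

theory Submission
  imports Defs
begin

text \<open>The axiom (B), applied to the pairs \<open>{u\<^sub>n x\<^sub>0, p (u\<^sub>n x\<^sub>0)}\<close>, shows that an isometry \<open>p\<close> with bounded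
  displacement on the orbit \<open>\<Gamma> x\<^sub>0\<close> fixes all limit classes.  So every nontrivial element of the confining set has
  unbounded displacement, and this is all that is needed of the boundary.

  For \<open>g \<in> \<Gamma>\<close> one wants an element \<open>g s g\<^sup>-\<^sup>1\<close> of \<open>H\<close>, with \<open>s\<close> from a finite set, such that geodesics from
  \<open>g\<^sup>-\<^sup>1 x\<^sub>0\<close> to \<open>s g\<^sup>-\<^sup>1 x\<^sub>0\<close> pass near \<open>x\<^sub>0\<close>.  Confinement provides \<open>s = t\<^sup>-\<^sup>1 p t\<close> for every \<open>t \<in> \<Gamma>\<close>, but \<open>p\<close>
  depends on \<open>t\<close>.  There is a half-space \<open>W\<close>, bounded by a translate of the axis of the contracting element,
  that each \<open>p\<close> either moves across this axis or displaces by a bounded amount.  If \<open>t\<close> maps the relevant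
  points into \<open>W\<close>, then \<open>p\<close> of the first kind is as desired; the second kind is
  excluded for one of many \<open>t\<close> by the discreteness of \<open>H\<close> and Neumann's lemma on coverings by cosets, because
  the centralizer of \<open>p\<close> has infinite index in \<open>\<Gamma>\<close>.

  Taking \<open>g\<close> of length about \<open>n\<close> gives the lower bound \<open>\<omega>\<^sub>\<Gamma> / 2\<close>.  For the strict inequality, the products
  \<open>g s g\<^sup>-\<^sup>1 \<tau> \<eta>\<close> with \<open>\<eta> \<in> H\<close> and connectors \<open>\<tau> \<in> H\<close> from a finite set are counted for \<open>g\<close> in several annuli
  simultaneously.  The multiplicity does not depend on the number of annuli, so that the ball sizes of \<open>H\<close>
  satisfy a renewal inequality which forces growth faster than \<open>\<omega>\<^sub>\<Gamma> / 2\<close>.\<close>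

section \<open>Contracting sets\<close>

text \<open>The elements of the confining set need not lie in \<Gamma>, so nothing is known about
  their dynamics; all that can be used is how far they displace points of the orbit of
  \<open>x\<^sub>0\<close>. Moreover, confinement does not tell which of them it returns. This is
  why one half-space has to serve all of them at once, and why the second kind is excluded only by a
  pigeonhole argument over many \<open>t\<close>.

  The factor 1/2 in the exponent reflects that \<open>g s g\<^sup>-\<^sup>1\<close> has about twice
  the length of \<open>g\<close>. A single annulus of radius about \<open>d / 2\<close> gives
  \<open>a n \<ge> c * exp (w * d / 2) * a (n - d)\<close> for the ball sizes \<open>a\<close> of
  \<open>H\<close>, with a small constant \<open>c\<close>. This means a rate of at least
  \<open>w / 2 + ln c / d\<close>, which tends to \<open>w / 2\<close> from below but does not
  exceed it. Summing over \<open>q\<close> annuli replaces \<open>c\<close> by \<open>c * q\<close>,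
  and \<open>q\<close> can be taken with \<open>c * q \<ge> 2\<close> because \<open>c\<close> does
  not change with \<open>q\<close>.\<close>

definition geodesic_path :: "(real \<Rightarrow> 'a::metric_space) \<Rightarrow> 'a \<Rightarrow> 'a \<Rightarrow> bool" where
  "geodesic_path \<gamma> x y \<longleftrightarrow> \<gamma> 0 = x \<and> \<gamma> (dist x y) = y \<and>
     (\<forall>s\<in>{0..dist x y}. \<forall>t\<in>{0..dist x y}. dist (\<gamma> s) (\<gamma> t) = \<bar>s - t\<bar>)"

lemma geodesic_path_dist:
  assumes "geodesic_path \<gamma> x y" "0 \<le> s" "s \<le> dist x y" "0 \<le> t" "t \<le> dist x y"
  shows "dist (\<gamma> s) (\<gamma> t) = \<bar>s - t\<bar>"
  using assms by (simp add: geodesic_path_def)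

lemma geodesic_path_dist_start:
  assumes "geodesic_path \<gamma> x y" "0 \<le> t" "t \<le> dist x y"
  shows "dist x (\<gamma> t) = t"
  using geodesic_path_dist[OF assms(1), of 0 t] assms by (simp add: geodesic_path_def)

lemma geodesic_path_dist_end:
  assumes "geodesic_path \<gamma> x y" "0 \<le> t" "t \<le> dist x y"
  shows "dist (\<gamma> t) y = dist x y - t"
  using geodesic_path_dist[OF assms(1), of t "dist x y"] assms by (simp add: geodesic_path_def)

lemma geodesic_path_sub:
  assumes g: "geodesic_path \<gamma> x y" and "0 \<le> a" "a \<le> b" "b \<le> dist x y"
  shows "geodesic_path (\<lambda>t. \<gamma> (a + t)) (\<gamma> a) (\<gamma> b)"
proof -
  have d: "dist (\<gamma> a) (\<gamma> b) = b - a"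
    using geodesic_path_dist[OF g, of a b] assms by simp
  show ?thesis
    unfolding geodesic_path_def d
    using geodesic_path_dist[OF g] assms by auto
qed

lemma geodesic_path_reverse:
  assumes g: "geodesic_path \<gamma> x y"
  shows "geodesic_path (\<lambda>t. \<gamma> (dist x y - t)) y x"
  unfolding geodesic_path_def dist_commute[of y x]
  using geodesic_path_dist[OF g] g by (auto simp: geodesic_path_def)

lemma geodesic_path_isometry:
  assumes "geodesic_path \<gamma> x y" "\<And>u v. dist (g u) (g v) = dist u v"
  shows "geodesic_path (\<lambda>t. g (\<gamma> t)) (g x) (g y)"
  using assms by (auto simp: geodesic_path_def)

lemma geodesic_path_continuous:
  assumes "geodesic_path \<gamma> x y"
  shows "continuous_on {0..dist x y} \<gamma>"
  unfolding continuous_on_iff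
proof (intro ballI allI impI)
  fix s and e :: real assume "s \<in> {0..dist x y}" "0 < e"
  then show "\<exists>d>0. \<forall>t\<in>{0..dist x y}. dist t s < d \<longrightarrow> dist (\<gamma> t) (\<gamma> s) < e"
    using geodesic_path_dist[OF assms] by (intro exI[of _ e]) (auto simp: dist_real_def)
qed

text \<open>The level set is compact, hence has a last point, and a smaller value after it would
  produce another one by the intermediate value theorem. Applied to the distance from a contracting
  set, it isolates the final stretch of a geodesic outside a neighbourhood of the set.\<close>

lemma continuous_last_le:
  fixes f :: "real \<Rightarrow> real"
  assumes c: "continuous_on {a..b} f" and ab: "a \<le> b" and "f a \<le> c" "c < f b"
  obtains t where "a \<le> t" "t < b" "f t = c" "\<And>s. t \<le> s \<Longrightarrow> s \<le> b \<Longrightarrow> c \<le> f s"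
proof -
  define Z where "Z = {t\<in>{a..b}. f t = c}"
  have "closed Z"
    unfolding Z_def by (rule continuous_closed_preimage_constant[OF c]) simp
  moreover have "bounded Z"
    unfolding Z_def by (rule bounded_subset[of "{a..b}"]) auto
  ultimately have cZ: "compact Z" by (simp add: compact_eq_bounded_closed)
  have "\<exists>t\<ge>a. t \<le> b \<and> f t = c"
    by (rule IVT') (use assms in auto)
  then have "Z \<noteq> {}" by (auto simp: Z_def)
  from compact_attains_sup[OF cZ this] obtain t where t: "t \<in> Z" "\<And>s. s \<in> Z \<Longrightarrow> s \<le> t" by blast
  have "c \<le> f s" if s: "t \<le> s" "s \<le> b" for s
  proof (rule ccontr)
    assume n: "\<not> c \<le> f s"
    have "\<exists>r\<ge>s. r \<le> b \<and> f r = c"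
      by (rule IVT') (use n s t assms continuous_on_subset[OF c] in \<open>auto simp: Z_def\<close>)
    then obtain r where "s \<le> r" "r \<in> Z" using s t by (auto simp: Z_def)
    then have "s = t" using t s by force
    then show False using n t by (simp add: Z_def)
  qed
  then show ?thesis using t assms that[of t] by (force simp: Z_def)
qed

lemma proper_geodesic_space_path:
  assumes "proper_geodesic_space TYPE('a::metric_space)"
  shows "\<exists>\<gamma>. geodesic_path \<gamma> x (y::'a)"
  using assms unfolding proper_geodesic_space_def geodesic_segment_def geodesic_path_def by meson

text \<open>A contraction constant may be enlarged, so \<open>C \<ge> 1\<close> is a normalisation;
  it makes \<open>C\<close> the unit in which all later errors are measured.\<close>

locale contracting =
  fixes A :: "'a::metric_space set" and C :: real
  assumes proper_geodesic: "proper_geodesic_space TYPE('a)"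
    and contracting_A: "contracting_set C A"
    and C_ge_1: "C \<ge> 1"
begin

abbreviation "pr \<equiv> nearest_proj A"

lemma pr_in: "z \<in> pr x \<Longrightarrow> z \<in> A"
  by (simp add: nearest_proj_def)

lemma pr_dist: "z \<in> pr x \<Longrightarrow> dist x z = infdist x A"
  by (simp add: nearest_proj_def)

lemma pr_ex: "\<exists>z. z \<in> pr x"
proof -
  have A: "closed A" "A \<noteq> {}" using contracting_A by (auto simp: contracting_set_def)
  then obtain a where a: "a \<in> A" by blast
  have "compact (cball x (dist x a))"
    using proper_geodesic by (simp add: proper_geodesic_space_def)
  then have "compact (A \<inter> cball x (dist x a))"
    using A by (metis closed_Int_compact)
  moreover have "A \<inter> cball x (dist x a) \<noteq> {}" using a by auto
  ultimately obtain z where z: "z \<in> A \<inter> cball x (dist x a)" 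
      "\<forall>w \<in> A \<inter> cball x (dist x a). dist x z \<le> dist x w"
    using continuous_attains_inf[of "A \<inter> cball x (dist x a)" "dist x"]
      continuous_on_dist[OF continuous_on_const continuous_on_id] by meson
  have "dist x z \<le> dist x w" if "w \<in> A" for w
    using z that by (cases "dist x w \<le> dist x a") auto
  then have "dist x z \<le> infdist x A"
    unfolding infdist_notempty[OF A(2)] using A by (intro cINF_greatest) auto
  then have "dist x z = infdist x A" using infdist_le[of z A x] z by auto
  then show ?thesis using z by (auto simp: nearest_proj_def)
qed

lemma pr_self: assumes "x \<in> A" "z \<in> pr x" shows "z = x"
  using pr_dist[OF assms(2)] assms(1) by simp

lemma pr_contract:
  assumes "dist x y \<le> infdist x A" "a \<in> pr x" "b \<in> pr y"
  shows "dist a b \<le> C"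
proof -
  have "pr x \<union> pr y \<subseteq> cball x (infdist x A) \<union> cball y (infdist y A)"
    by (auto simp: nearest_proj_def)
  then have "bounded (pr x \<union> pr y)"
    by (metis bounded_Un bounded_cball bounded_subset)
  then have "dist a b \<le> diameter (pr x \<union> pr y)"
    using assms by (intro diameter_bounded_bound) auto
  also have "\<dots> \<le> C" using contracting_A assms by (auto simp: contracting_set_def)
  finally show ?thesis .
qed

text \<open>If y is no further from x than A is, the contraction applies. Otherwise d(x, A) < d(x,
  y), and the path through x and y costs at most 2 d(x, A) + 2 d(x, y).\<close>

lemma pr_lipschitz:
  assumes a: "a \<in> pr x" and b: "b \<in> pr y"
  shows "dist a b \<le> 4 * dist x y + C"
proof (cases "dist x y \<le> infdist x A")
  case True
  then show ?thesis using pr_contract[OF True a b] by (smt (verit) zero_le_dist)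
next
  case False
  have "infdist y A \<le> infdist x A + dist y x" by (rule infdist_triangle)
  moreover have "dist a b \<le> dist x a + dist x y + dist y b"
    by metric
  ultimately show ?thesis
    using False pr_dist[OF a] pr_dist[OF b] C_ge_1 by (simp add: dist_commute)
qed

lemma pr_between:
  assumes z: "z \<in> pr x" and v: "dist x v + dist v z = dist x z"
  shows "z \<in> pr v"
proof -
  have "infdist x A \<le> infdist v A + dist x v" by (rule infdist_triangle)
  then have "dist v z \<le> infdist v A" using pr_dist[OF z] v by simp
  moreover have "infdist v A \<le> dist v z" by (rule infdist_le[OF pr_in[OF z]])
  ultimately show ?thesis using z by (simp add: nearest_proj_def)
qed

lemma infdist_path_continuous:
  assumes "geodesic_path \<gamma> x y"
  shows "continuous_on {0..dist x y} (\<lambda>t. infdist (\<gamma> t) A)"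
  using geodesic_path_continuous[OF assms] by (intro continuous_on_infdist)

text \<open>At distance at least \<open>2 * C\<close> from A, a step of length \<open>2 * C\<close>
  moves the projection by at most \<open>C\<close>: the projection runs at half the speed of the
  geodesic.\<close>

lemma pr_steps:
  assumes g: "geodesic_path \<gamma> x y" and far: "\<And>t. 0 \<le> t \<Longrightarrow> t \<le> dist x y \<Longrightarrow> 2 * C \<le> infdist (\<gamma> t) A"
  shows "\<lbrakk>0 \<le> s; s \<le> t; t \<le> dist x y; t - s \<le> real n * (2 * C); a \<in> pr (\<gamma> s); b \<in> pr (\<gamma> t)\<rbrakk>
     \<Longrightarrow> dist a b \<le> real n * C + C"
proof (induction n arbitrary: s a)
  case 0
  then have "s = t" by simp
  then have "dist (\<gamma> s) (\<gamma> t) \<le> infdist (\<gamma> s) A" by (simp add: infdist_nonneg)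
  from pr_contract[OF this 0(5,6)] show ?case by simp
next
  case (Suc n)
  show ?case
  proof (cases "t - s \<le> 2 * C")
    case True
    have "dist (\<gamma> s) (\<gamma> t) \<le> infdist (\<gamma> s) A"
      using geodesic_path_dist[OF g, of s t] Suc(2-4) far[of s] True by simp
    from pr_contract[OF this Suc(6,7)] show ?thesis
      using C_ge_1 by (smt (verit) mult_nonneg_nonneg of_nat_0_le_iff)
  next
    case False
    define r where "r = s + 2 * C"
    obtain c where c: "c \<in> pr (\<gamma> r)" using pr_ex by blast
    have r: "0 \<le> r" "s \<le> r" "r \<le> t" using False Suc C_ge_1 by (auto simp: r_def)
    have "dist (\<gamma> s) (\<gamma> r) \<le> infdist (\<gamma> s) A"
      using geodesic_path_dist[OF g, of s r] Suc(2-4) far[of s] r by (simp add: r_def)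
    from pr_contract[OF this Suc(6) c] have "dist a c \<le> C" .
    moreover have "dist c b \<le> real n * C + C"
      using r Suc c by (intro Suc.IH[of r c]) (auto simp: r_def algebra_simps)
    ultimately show ?thesis
      using dist_triangle[of a b c] by (simp add: algebra_simps)
  qed
qed

text \<open>The first d(x, A) and the last d(y, A) of the path move the projection by at most
  \<open>C\<close> each, the rest at half speed. Since the path is geodesic, this rest is no longer
  than \<open>dist a b\<close>, by comparison with the detour through a and b. Hence
  \<open>dist a b \<le> dist a b / 2 + 4 * C\<close>.\<close>

lemma pr_far_geodesic:
  assumes g: "geodesic_path \<gamma> x y" and far: "\<And>t. 0 \<le> t \<Longrightarrow> t \<le> dist x y \<Longrightarrow> 2 * C \<le> infdist (\<gamma> t) A"
    and a: "a \<in> pr x" and b: "b \<in> pr y"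
  shows "dist a b \<le> 8 * C"
proof (cases "dist x y \<le> infdist x A + infdist y A")
  case True
  define t where "t = min (infdist x A) (dist x y)"
  have t: "0 \<le> t" "t \<le> dist x y" by (auto simp: t_def infdist_nonneg)
  obtain c where c: "c \<in> pr (\<gamma> t)" using pr_ex by blast
  have "dist x (\<gamma> t) \<le> infdist x A" using geodesic_path_dist_start[OF g t] by (simp add: t_def)
  then have "dist a c \<le> C" using pr_contract a c by blast
  moreover have "dist y (\<gamma> t) \<le> infdist y A"
    using geodesic_path_dist_end[OF g t] True by (simp add: t_def dist_commute min_def infdist_nonneg)
  then have "dist b c \<le> C" using pr_contract b c by blast
  ultimately show ?thesis using dist_triangle2[of a b c] C_ge_1 by simp
next
  case False
  define s t where "s = infdist x A" and "t = dist x y - infdist y A"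
  have st: "0 \<le> s" "s \<le> t" "t \<le> dist x y" using False by (auto simp: s_def t_def infdist_nonneg)
  obtain c where c: "c \<in> pr (\<gamma> s)" using pr_ex by blast
  obtain d where d: "d \<in> pr (\<gamma> t)" using pr_ex by blast
  have "dist x (\<gamma> s) \<le> infdist x A" using geodesic_path_dist_start[OF g, of s] st by (simp add: s_def)
  then have ac: "dist a c \<le> C" using pr_contract a c by blast
  have "dist y (\<gamma> t) \<le> infdist y A"
    using geodesic_path_dist_end[OF g, of t] st by (simp add: t_def dist_commute)
  then have bd: "dist b d \<le> C" using pr_contract b d by blast
  define n where "n = nat \<lceil>(t - s) / (2 * C)\<rceil>"
  have "(t - s) / (2 * C) \<le> real n" unfolding n_def by linarith
  then have "t - s \<le> real n * (2 * C)" using C_ge_1 by (simp add: field_simps)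
  from pr_steps[OF g far st this c d] have cd: "dist c d \<le> real n * C + C" by simp
  have "real n \<le> (t - s) / (2 * C) + 1"
    unfolding n_def using st C_ge_1 by (simp add: of_nat_nat)
  then have "real n * C \<le> ((t - s) / (2 * C) + 1) * C" 
    using C_ge_1 by (intro mult_right_mono) auto
  also have "\<dots> = (t - s) / 2 + C" using C_ge_1 by (simp add: field_simps)
  finally have "dist c d \<le> (t - s) / 2 + 2 * C" using cd by simp
  then have "dist a b \<le> (t - s) / 2 + 4 * C"
    using ac bd by metric
  moreover have "dist x y \<le> dist x a + dist a b + dist y b"
    by metric
  then have "t - s \<le> dist a b"
    using pr_dist[OF a] pr_dist[OF b] by (simp add: s_def t_def)
  ultimately have "dist a b \<le> dist a b / 2 + 4 * C" by argo
  then show ?thesis by argo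
qed

text \<open>After the last moment at distance \<open>2 * C\<close> from A the projection moves by at
  most \<open>8 * C\<close>, so at that moment the path is within \<open>2 * C + 8 * C\<close> of
  b.\<close>

lemma geodesic_hits:
  assumes g: "geodesic_path \<gamma> x y" and a: "a \<in> pr x" and b: "b \<in> pr y" and ab: "dist a b > 8 * C"
  obtains t where "0 \<le> t" "t \<le> dist x y" "dist (\<gamma> t) b \<le> 10 * C"
proof -
  define f where "f t = infdist (\<gamma> t) A" for t
  have c: "continuous_on {0..dist x y} f"
    unfolding f_def by (rule infdist_path_continuous[OF g])
  from pr_far_geodesic[OF g _ a b] ab obtain t1 where t1: "0 \<le> t1" "t1 \<le> dist x y" "f t1 < 2 * C"
    by (force simp: f_def)
  show thesis
  proof (cases "f (dist x y) \<le> 2 * C")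
    case True
    then show thesis
      using that[of "dist x y"] pr_dist[OF b] g C_ge_1 by (simp add: f_def geodesic_path_def)
  next
    case False
    obtain t where t: "t1 \<le> t" "t < dist x y" "f t = 2 * C" 
        "\<And>s. t \<le> s \<Longrightarrow> s \<le> dist x y \<Longrightarrow> 2 * C \<le> f s"
      using continuous_last_le[of t1 "dist x y" f "2 * C"] continuous_on_subset[OF c, of "{t1..dist x y}"]
        t1 False by auto
    obtain e where e: "e \<in> pr (\<gamma> t)" using pr_ex by blast
    have gy: "\<gamma> (dist x y) = y" using g by (simp add: geodesic_path_def)
    have g': "geodesic_path (\<lambda>u. \<gamma> (t + u)) (\<gamma> t) y"
      using geodesic_path_sub[OF g, of t "dist x y"] t t1 gy by simp
    have d: "dist (\<gamma> t) y = dist x y - t"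
      using geodesic_path_dist_end[OF g, of t] t t1 by simp
    have "dist e b \<le> 8 * C"
      by (rule pr_far_geodesic[OF g' _ e b]) (use t d f_def in auto)
    moreover have "dist (\<gamma> t) e \<le> 2 * C" using pr_dist[OF e] t by (simp add: f_def)
    ultimately have "dist (\<gamma> t) b \<le> 10 * C" using dist_triangle[of "\<gamma> t" b e] by simp
    then show thesis using that[of t] t t1 by simp
  qed
qed

lemma geodesic_hits_start:
  assumes g: "geodesic_path \<gamma> x y" and a: "a \<in> pr x" and b: "b \<in> pr y" and ab: "dist a b > 8 * C"
  obtains t where "0 \<le> t" "t \<le> dist x y" "dist (\<gamma> t) a \<le> 10 * C"
proof -
  obtain t where "0 \<le> t" "t \<le> dist y x" "dist (\<gamma> (dist x y - t)) a \<le> 10 * C"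
    using geodesic_hits[OF geodesic_path_reverse[OF g] b a] ab by (metis dist_commute)
  then show thesis using that[of "dist x y - t"] by (simp add: dist_commute)
qed

text \<open>An excursion outside the neighbourhood of radius \<open>2 * C\<close> has length at most
  \<open>2 * C + 8 * C + 2 * C\<close>, so it gets no further than \<open>2 * C + 12 * C\<close>
  from A.\<close>

lemma geodesic_quasiconvex:
  assumes g: "geodesic_path \<gamma> x y" and xy: "x \<in> A" "y \<in> A" and t: "0 \<le> t" "t \<le> dist x y"
  shows "infdist (\<gamma> t) A \<le> 14 * C"
proof (rule ccontr)
  define f where "f t = infdist (\<gamma> t) A" for t
  assume "\<not> ?thesis"
  then have ft: "f t > 14 * C" by (simp add: f_def)
  have c: "continuous_on {0..dist x y} f"
    unfolding f_def by (rule infdist_path_continuous[OF g])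
  have ends: "f 0 \<le> 2 * C" "f (dist x y) \<le> 2 * C"
    using g xy C_ge_1 by (auto simp: f_def geodesic_path_def)
  obtain a where a: "0 \<le> a" "a < t" "f a = 2 * C" "\<And>s. a \<le> s \<Longrightarrow> s \<le> t \<Longrightarrow> 2 * C \<le> f s"
    using continuous_last_le[of 0 t f "2 * C"] continuous_on_subset[OF c, of "{0..t}"] t ft C_ge_1 ends by auto
  \<comment> \<open>Time is reversed, so that \<open>continuous_last_le\<close> yields the first
    return to the level \<open>2 * C\<close> after t.\<close>
  have "continuous_on {-dist x y..-t} (\<lambda>s. f (-s))"
    by (rule continuous_on_compose2[OF c]) (use t in \<open>auto intro: continuous_intros\<close>)
  then obtain b' where b': "-dist x y \<le> b'" "b' < -t" "f (-b') = 2 * C" "\<And>s. b' \<le> s \<Longrightarrow> s \<le> -t \<Longrightarrow> 2 * C \<le> f (-s)"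
    using continuous_last_le[of "-dist x y" "-t" "\<lambda>s. f (-s)" "2 * C"] t ft C_ge_1 ends by auto
  define b where "b = -b'"
  have b: "t < b" "b \<le> dist x y" "f b = 2 * C" "\<And>s. t \<le> s \<Longrightarrow> s \<le> b \<Longrightarrow> 2 * C \<le> f s"
    using b' by (auto simp: b_def) (metis b'(4) minus_minus neg_le_iff_le minus_le_iff)
  obtain u where u: "u \<in> pr (\<gamma> a)" using pr_ex by blast
  obtain v where v: "v \<in> pr (\<gamma> b)" using pr_ex by blast
  have g': "geodesic_path (\<lambda>u. \<gamma> (a + u)) (\<gamma> a) (\<gamma> b)"
    using geodesic_path_sub[OF g, of a b] a b by simp
  have d: "dist (\<gamma> a) (\<gamma> b) = b - a"
    using geodesic_path_dist[OF g, of a b] a b by simp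
  have "2 * C \<le> infdist (\<gamma> (a + s)) A" if "0 \<le> s" "s \<le> dist (\<gamma> a) (\<gamma> b)" for s
    using that a(4)[of "a + s"] b(4)[of "a + s"] d by (cases "a + s \<le> t") (auto simp: f_def)
  from pr_far_geodesic[OF g' this u v] have "dist u v \<le> 8 * C" by simp
  moreover have "dist (\<gamma> a) u = 2 * C" "dist (\<gamma> b) v = 2 * C"
    using pr_dist[OF u] pr_dist[OF v] a b by (auto simp: f_def)
  moreover have "dist (\<gamma> a) (\<gamma> b) \<le> dist (\<gamma> a) u + dist u v + dist (\<gamma> b) v" by metric
  ultimately have "b - a \<le> 12 * C" using d by simp
  moreover have "f t \<le> f a + dist (\<gamma> t) (\<gamma> a)" unfolding f_def by (rule infdist_triangle)
  moreover have "dist (\<gamma> t) (\<gamma> a) = t - a" using geodesic_path_dist[OF g, of t a] a t by simp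
  ultimately show False using ft a b by simp
qed

end

section \<open>Isometries\<close>

abbreviation finv :: "('a \<Rightarrow> 'b) \<Rightarrow> 'b \<Rightarrow> 'a" where "finv \<equiv> inv_into UNIV"

lemma isom_dist: "g \<in> carrier isom_group \<Longrightarrow> dist (g x) (g y) = dist x y"
  by (simp add: isom_group_def)

lemma isom_bij: "g \<in> carrier isom_group \<Longrightarrow> bij g"
  by (auto simp: isom_group_def bij_def inj_def) (metis dist_eq_0_iff)

lemma isom_comp: "g \<in> carrier isom_group \<Longrightarrow> h \<in> carrier isom_group \<Longrightarrow> g \<circ> h \<in> carrier isom_group"
  using comp_surj[of h g] by (simp add: isom_group_def)

lemma isom_inv_apply [simp]:
  assumes "g \<in> carrier isom_group" shows "finv g (g x) = x" "g (finv g x) = x"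
  using isom_bij[OF assms] by (auto simp: bij_is_inj bij_is_surj surj_f_inv_f)

lemma isom_inv: "g \<in> carrier isom_group \<Longrightarrow> finv g \<in> carrier isom_group"
  using isom_bij[of g] bij_is_surj[OF bij_imp_bij_inv[of g]] isom_dist[of g] 
  by (simp add: isom_group_def) (metis surj_f_inv_f)

lemma isom_inv_inv: "g \<in> carrier isom_group \<Longrightarrow> finv (finv g) = g"
  by (simp add: isom_bij inv_inv_eq)

lemma isom_dist_inv: "g \<in> carrier isom_group \<Longrightarrow> dist (finv g x) y = dist x (g y)"
  by (metis isom_dist isom_inv_apply(2))

lemma isom_dist_inv': "g \<in> carrier isom_group \<Longrightarrow> dist x (finv g y) = dist (g x) y"
  by (metis isom_dist isom_inv_apply(2))

lemma isom_mult: "g \<otimes>\<^bsub>isom_group\<^esub> h = g \<circ> h"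
  by (simp add: isom_group_def)

lemma isom_one: "\<one>\<^bsub>isom_group\<^esub> = id"
  by (simp add: isom_group_def)

lemma isom_one_apply [simp]: "\<one>\<^bsub>isom_group\<^esub> x = x"
  by (simp add: isom_one)

lemma isom_m_inv:
  assumes "g \<in> carrier isom_group" shows "inv\<^bsub>isom_group\<^esub> g = finv g"
proof (rule group.inv_equality[OF group_isom_group])
  show "finv g \<otimes>\<^bsub>isom_group\<^esub> g = \<one>\<^bsub>isom_group\<^esub>"
    using assms by (auto simp: isom_mult isom_one)
qed (use assms isom_inv in auto)

lemma isom_inv_comp:
  assumes "g \<in> carrier isom_group" "h \<in> carrier isom_group"
  shows "finv (g \<circ> h) = finv h \<circ> finv g"
  by (rule o_inv_distrib) (auto simp: assms isom_bij)

lemma isom_int_pow_add: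
  assumes "f \<in> carrier isom_group"
  shows "(f [^]\<^bsub>isom_group\<^esub> (m + n :: int)) x = (f [^]\<^bsub>isom_group\<^esub> m) ((f [^]\<^bsub>isom_group\<^esub> n) x)"
  using group.int_pow_mult[OF group_isom_group assms] by (simp add: isom_mult)

locale isom_subgroup =
  fixes G :: "('a::metric_space \<Rightarrow> 'a) set"
  assumes subgroup: "subgroup G isom_group"
begin

lemma isom [simp]: "g \<in> G \<Longrightarrow> g \<in> carrier isom_group"
  using subgroup.mem_carrier[OF subgroup] .

lemma id_mem: "id \<in> G" "(\<lambda>x. x) \<in> G"
  using subgroup.one_closed[OF subgroup] by (auto simp: isom_one id_def)

lemma comp_mem: "g \<in> G \<Longrightarrow> h \<in> G \<Longrightarrow> g \<circ> h \<in> G"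
  using subgroup.m_closed[OF subgroup] by (simp add: isom_mult)

lemma inv_mem: "g \<in> G \<Longrightarrow> finv g \<in> G"
  using subgroup.m_inv_closed[OF subgroup] isom_m_inv[OF isom] by metis

end

section \<open>Contracting orbits\<close>

locale contracting_orbit =
  fixes x\<^sub>0 :: "'a::metric_space" and f :: "'a \<Rightarrow> 'a" and C :: real
  assumes proper_geodesic': "proper_geodesic_space TYPE('a)"
    and f_isom: "f \<in> carrier isom_group"
    and f_qi: "quasi_isometric_embedding_on UNIV (\<lambda>m n::int. real_of_int \<bar>m - n\<bar>)
       (\<lambda>n::int. (f [^]\<^bsub>isom_group\<^esub> n) x\<^sub>0)"
    and f_contracting: "contracting_set C (range (\<lambda>n::int. (f [^]\<^bsub>isom_group\<^esub> n) x\<^sub>0))"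
    and C_ge_1': "C \<ge> 1"
begin

abbreviation fp :: "int \<Rightarrow> 'a \<Rightarrow> 'a" where "fp n \<equiv> f [^]\<^bsub>isom_group\<^esub> n"

sublocale contracting "range (\<lambda>n::int. fp n x\<^sub>0)" C
  by standard (fact proper_geodesic' f_contracting C_ge_1')+

lemma fp_isom [simp]: "fp n \<in> carrier isom_group"
  by (rule group.int_pow_closed[OF group_isom_group f_isom])

lemma fp_add: "fp (m + n) x = fp m (fp n x)"
  by (rule isom_int_pow_add[OF f_isom])

lemma fp_0: "fp 0 x = x"
  by (simp add: isom_group_def)

lemma fp_inv: "finv (fp n) = fp (-n)"
proof
  fix x
  have "fp n (fp (-n) x) = x" using fp_add[of n "-n" x] fp_0 by (metis add.right_inverse)
  then show "finv (fp n) x = fp (-n) x" by (metis fp_isom isom_inv_apply(1))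
qed

lemma fp_cancel [simp]: "fp n (fp (-n) x) = x" "fp (-n) (fp n x) = x"
  using fp_add[of n "-n" x] fp_add[of "-n" n x] fp_0[of x] by (metis add.right_inverse add.left_inverse)+

lemma fp_unbounded:
  obtains N :: int where "N \<ge> 1" "\<And>m n. \<bar>m - n\<bar> \<ge> N \<Longrightarrow> dist (fp m x\<^sub>0) (fp n x\<^sub>0) > B"
proof -
  obtain k c where kc: "k \<ge> 1" "c \<ge> 0" 
     "\<And>m n. real_of_int \<bar>m - n\<bar> / k - c \<le> dist (fp m x\<^sub>0) (fp n x\<^sub>0)"
    using f_qi unfolding quasi_isometric_embedding_on_def by auto
  define N where "N = max 1 (\<lceil>k * (B + c)\<rceil> + 1)"
  have "dist (fp m x\<^sub>0) (fp n x\<^sub>0) > B" if "\<bar>m - n\<bar> \<ge> N" for m n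
  proof -
    have "k * (B + c) < real_of_int \<bar>m - n\<bar>" using that unfolding N_def by linarith
    then have "B + c < real_of_int \<bar>m - n\<bar> / k" using kc by (simp add: field_simps)
    then show ?thesis using kc(3)[of m n] by linarith
  qed
  then show thesis using that[of N] by (auto simp: N_def)
qed

lemma pr_fp:
  assumes "a \<in> pr x"
  shows "fp n a \<in> pr (fp n x)"
proof -
  have *: "infdist x (range (\<lambda>n. fp n x\<^sub>0)) \<le> dist (fp n x) (fp m x\<^sub>0)" for m
  proof -
    have "dist (fp n x) (fp m x\<^sub>0) = dist x (fp (m - n) x\<^sub>0)"
      using isom_dist[OF fp_isom, of n x "fp (m - n) x\<^sub>0"] fp_add[of n "m - n" x\<^sub>0] by simp
    then show ?thesis using infdist_le[of "fp (m - n) x\<^sub>0"] by auto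
  qed
  obtain m where m: "a = fp m x\<^sub>0" using assms by (auto simp: nearest_proj_def)
  have "fp n a = fp (n + m) x\<^sub>0" by (simp add: m fp_add)
  then have in_A: "fp n a \<in> range (\<lambda>n. fp n x\<^sub>0)" by auto
  have "dist (fp n x) (fp n a) = dist x a" by (simp add: isom_dist)
  also have "\<dots> = infdist x (range (\<lambda>n. fp n x\<^sub>0))" by (rule pr_dist[OF assms])
  also have "\<dots> \<le> infdist (fp n x) (range (\<lambda>n. fp n x\<^sub>0))"
    using * by (subst (2) infdist_notempty) (auto intro: cINF_greatest)
  finally show ?thesis
    using in_A infdist_le[OF in_A, of "fp n x"] by (simp add: nearest_proj_def)
qed

lemma pr_fp':
  assumes "a \<in> pr (fp n x)"
  shows "fp (-n) a \<in> pr x"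
  using pr_fp[OF assms, of "-n"] by simp

text \<open>Nearest points are not unique. Both \<open>near\<close> and \<open>far\<close> quantify
  over all of them, so neither is the negation of the other.\<close>

definition near :: "'a \<Rightarrow> real \<Rightarrow> bool" where
  "near x r \<longleftrightarrow> (\<forall>a\<in>pr x. dist a x\<^sub>0 \<le> r)"

definition far :: "'a \<Rightarrow> real \<Rightarrow> bool" where
  "far x D \<longleftrightarrow> (\<forall>a\<in>pr x. D < dist a x\<^sub>0)"

lemma x0_axis: "x\<^sub>0 \<in> range (\<lambda>n. fp n x\<^sub>0)"
  using fp_0[of x\<^sub>0] by (metis rangeI)

lemma near_x0: "near x\<^sub>0 0"
  using pr_self[OF x0_axis] by (auto simp: near_def)

lemma near_mono: "near x r \<Longrightarrow> r \<le> r' \<Longrightarrow> near x r'"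
  by (force simp: near_def)

lemma far_mono: "far x D \<Longrightarrow> D' \<le> D \<Longrightarrow> far x D'"
  by (force simp: far_def)

lemma near_move: 
  assumes "near x r" shows "near y (r + 4 * dist x y + C)"
  unfolding near_def
proof
  fix b assume b: "b \<in> pr y"
  obtain a where a: "a \<in> pr x" using pr_ex by blast
  then show "dist b x\<^sub>0 \<le> r + 4 * dist x y + C"
    using assms pr_lipschitz[OF a b] dist_triangle3[of b x\<^sub>0 a] by (force simp: near_def)
qed

text \<open>The translate \<open>\<xi>\<^sup>-\<^sup>1 A\<close> of the axis \<open>A\<close> is encoded by projecting the images under \<open>\<xi>\<close> to \<open>A\<close>
  itself.  It acts as a barrier near the point \<open>\<xi>\<^sup>-\<^sup>1 x\<^sub>0\<close>.\<close>

lemma barrier_hit: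
  assumes \<xi>: "\<xi> \<in> carrier isom_group" and n: "near (\<xi> y) r" and fr: "far (\<xi> x) D"
    and D: "D \<ge> r + 8 * C" and g: "geodesic_path \<gamma> x y"
  obtains t where "0 \<le> t" "t \<le> dist x y" "dist (\<xi> (\<gamma> t)) x\<^sub>0 \<le> r + 10 * C"
proof -
  obtain a where a: "a \<in> pr (\<xi> x)" using pr_ex by blast
  obtain b where b: "b \<in> pr (\<xi> y)" using pr_ex by blast
  have d: "dist (\<xi> x) (\<xi> y) = dist x y" by (rule isom_dist[OF \<xi>])
  have bx: "dist b x\<^sub>0 \<le> r" using n b by (simp add: near_def)
  moreover have "dist a x\<^sub>0 > D" using fr a by (simp add: far_def)
  ultimately have "dist a b > 8 * C" using D dist_triangle[of a x\<^sub>0 b] by simp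
  from geodesic_hits[OF geodesic_path_isometry[OF g isom_dist[OF \<xi>]] a b this]
  obtain t where t: "0 \<le> t" "t \<le> dist x y" "dist (\<xi> (\<gamma> t)) b \<le> 10 * C" using d by auto
  moreover have "dist (\<xi> (\<gamma> t)) x\<^sub>0 \<le> dist (\<xi> (\<gamma> t)) b + dist b x\<^sub>0" by (rule dist_triangle)
  ultimately show thesis using that[of t] bx by simp
qed

lemma barrier_hit':
  assumes \<xi>: "\<xi> \<in> carrier isom_group" and n: "near (\<xi> x) r" and fr: "far (\<xi> y) D"
    and D: "D \<ge> r + 8 * C" and g: "geodesic_path \<gamma> x y"
  obtains t where "0 \<le> t" "t \<le> dist x y" "dist (\<xi> (\<gamma> t)) x\<^sub>0 \<le> r + 10 * C"
proof -
  obtain t where "0 \<le> t" "t \<le> dist y x" "dist (\<xi> (\<gamma> (dist x y - t))) x\<^sub>0 \<le> r + 10 * C"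
    using barrier_hit[OF \<xi> n fr D geodesic_path_reverse[OF g]] .
  then show thesis using that[of "dist x y - t"] by (simp add: dist_commute)
qed

text \<open>If the projections of \<open>\<xi> (\<gamma> t)\<close> and \<open>\<xi> y\<close> were
  more than \<open>8 * C\<close> apart, the path would pass near the barrier after time t, but it
  can do so only up to about the time \<open>dist (\<xi> x) x\<^sub>0\<close>. For the same reason
  \<open>\<gamma> t\<close> is at least \<rho> away from the translated axis, so passing from it to
  w moves the projection by at most \<open>C\<close>.\<close>

lemma barrier_shadow:
  assumes \<xi>: "\<xi> \<in> carrier isom_group" and n: "near (\<xi> y) r"
    and g: "geodesic_path \<gamma> x y" and t: "t \<le> dist x y" and w: "dist (\<gamma> t) w \<le> \<rho>" "0 < \<rho>"
    and late: "t \<ge> dist (\<xi> x) x\<^sub>0 + r + 10 * C + \<rho>"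
  shows "near (\<xi> w) (r + 9 * C)"
proof -
  obtain b where b: "b \<in> pr (\<xi> y)" using pr_ex by blast
  have bx: "dist b x\<^sub>0 \<le> r" using n b by (simp add: near_def)
  then have r: "0 \<le> r" using zero_le_dist order_trans by blast
  have t0: "0 \<le> t" using late r w C_ge_1 by (smt (verit) zero_le_dist)
  obtain c where c: "c \<in> pr (\<xi> (\<gamma> t))" using pr_ex by blast
  have gy: "\<gamma> (dist x y) = y" using g by (simp add: geodesic_path_def)
  have g': "geodesic_path (\<lambda>u. \<xi> (\<gamma> (t + u))) (\<xi> (\<gamma> t)) (\<xi> y)"
    using geodesic_path_isometry[OF geodesic_path_sub[OF g, of t "dist x y"] isom_dist[OF \<xi>]] t t0 gy by simp
  have d: "dist (\<xi> (\<gamma> t)) (\<xi> y) = dist x y - t"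
    using geodesic_path_dist_end[OF g, of t] t t0 by (simp add: isom_dist[OF \<xi>])
  have cb: "dist c b \<le> 8 * C"
  proof (rule ccontr)
    assume "\<not> ?thesis"
    then have "dist c b > 8 * C" by simp
    from geodesic_hits[OF g' c b this] obtain u where u: "0 \<le> u" "u \<le> dist x y - t"
       "dist (\<xi> (\<gamma> (t + u))) b \<le> 10 * C" using d by metis
    have "t + u = dist x (\<gamma> (t + u))"
      using geodesic_path_dist_start[OF g, of "t + u"] u t0 by simp
    also have "\<dots> = dist (\<xi> x) (\<xi> (\<gamma> (t + u)))" by (simp add: isom_dist[OF \<xi>])
    also have "\<dots> \<le> dist (\<xi> x) x\<^sub>0 + dist b x\<^sub>0 + dist (\<xi> (\<gamma> (t + u))) b" by metric
    finally show False using u bx late w by linarith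
  qed
  then have cx: "dist c x\<^sub>0 \<le> r + 8 * C" using bx dist_triangle[of c x\<^sub>0 b] by simp
  have "t = dist (\<xi> x) (\<xi> (\<gamma> t))"
    using geodesic_path_dist_start[OF g, of t] t t0 by (simp add: isom_dist[OF \<xi>])
  also have "\<dots> \<le> dist (\<xi> x) x\<^sub>0 + dist c x\<^sub>0 + dist (\<xi> (\<gamma> t)) c" by metric
  finally have "\<rho> \<le> dist (\<xi> (\<gamma> t)) c" using late cx C_ge_1 by linarith
  then have *: "dist (\<xi> (\<gamma> t)) (\<xi> w) \<le> infdist (\<xi> (\<gamma> t)) (range (\<lambda>n. fp n x\<^sub>0))"
    using pr_dist[OF c] w by (simp add: isom_dist[OF \<xi>])
  show ?thesis
    unfolding near_def
  proof
    fix a assume a: "a \<in> pr (\<xi> w)"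
    from pr_contract[OF * c a] cx show "dist a x\<^sub>0 \<le> r + 9 * C"
      using dist_triangle3[of a x\<^sub>0 c] by simp
  qed
qed

text \<open>Behrstock's inequality for the axis and its translate by c. If \<alpha> is far from the
  projection of \<open>c a\<close>, the geodesic from x to \<open>c a\<close> passes within
  \<open>10 * C\<close> of \<alpha>. All its points still have \<open>c a\<close> as a nearest point
  on the translate, so the Lipschitz bound gives \<open>4 * (10 * C) + C\<close> for the projection
  of \<alpha>.\<close>

lemma behrstock:
  assumes c: "c \<in> carrier isom_group" and \<alpha>: "\<alpha> \<in> pr x" and a: "a \<in> pr (finv c x)"
    and y: "y \<in> pr (c a)" "dist \<alpha> y > 8 * C" and w: "w \<in> pr (finv c \<alpha>)"
  shows "dist a w \<le> 41 * C"
proof -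
  obtain \<gamma> where g: "geodesic_path \<gamma> x (c a)"
    using proper_geodesic_space_path[OF proper_geodesic] by blast
  obtain t where t: "0 \<le> t" "t \<le> dist x (c a)" "dist (\<gamma> t) \<alpha> \<le> 10 * C"
    using geodesic_hits_start[OF g \<alpha> y] by blast
  have i: "finv c \<in> carrier isom_group" by (rule isom_inv[OF c])
  have "dist (finv c x) (finv c (\<gamma> t)) + dist (finv c (\<gamma> t)) a = dist (finv c x) a"
    using geodesic_path_dist_start[OF g, of t] geodesic_path_dist_end[OF g, of t] t c
    by (simp add: isom_dist[OF i] isom_dist_inv)
  then have "a \<in> pr (finv c (\<gamma> t))" using pr_between[OF a] by blast
  from pr_lipschitz[OF this w] t show ?thesis by (simp add: isom_dist[OF i])
qed

end

section \<open>Bounded displacement and the elliptic radical\<close>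

text \<open>Projections to a two-point set stay in it, so its diameter is a contraction constant.
  Pairs of points at bounded distance are therefore uniformly contracting, as axiom (B)
  requires.\<close>

lemma contracting_pair:
  fixes a b :: "'a::metric_space"
  assumes "dist a b \<le> c" shows "contracting_set c {a, b}"
  unfolding contracting_set_def
proof (intro conjI allI impI)
  fix x y
  have "diameter (nearest_proj {a, b} x \<union> nearest_proj {a, b} y) \<le> diameter {a, b}"
    by (rule diameter_subset) (auto simp: nearest_proj_def)
  also have "\<dots> \<le> c"
    unfolding diameter_def using assms order_trans[OF zero_le_dist assms]
    by (auto intro!: cSup_least simp: dist_commute)
  finally show "diameter (nearest_proj {a, b} x \<union> nearest_proj {a, b} y) \<le> c" .
qed auto

lemma quasi_geodesic_pair:
  fixes a b :: "'a::metric_space"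
  shows "quasi_geodesic {a, b}"
  unfolding quasi_geodesic_def
proof (intro exI conjI)
  let ?q = "\<lambda>t::real. if t = 0 then a else b"
  show "{a, b} = ?q ` {0..1}"
    by (auto simp: image_iff) (metis zero_le_one order_refl zero_neq_one)
  have "dist s t / 1 - (dist a b + 1) \<le> dist (?q s) (?q t) \<and> dist (?q s) (?q t) \<le> 1 * dist s t + (dist a b + 1)"
    if "s \<in> {0..1}" "t \<in> {0..1}" for s t :: real
  proof -
    have "dist s t \<le> 1" using that by (auto simp: dist_real_def)
    moreover have "dist (?q s) (?q t) \<le> dist a b" by (auto simp: dist_commute)
    moreover have "0 \<le> dist s t" "0 \<le> dist (?q s) (?q t)" by (rule zero_le_dist)+
    ultimately show ?thesis by (auto simp del: zero_le_dist)
  qed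
  then show "quasi_isometric_embedding_on {0..1} dist ?q"
    unfolding quasi_isometric_embedding_on_def
    by (intro exI[of _ 1] conjI exI[of _ "dist a b + 1"] ballI) auto
qed (auto simp: is_interval_cc)

lemma mem_geodesic_cone:
  assumes "proper_geodesic_space TYPE('a::metric_space)" "y \<in> Z"
  shows "(y::'a) \<in> geodesic_cone x Z"
proof -
  obtain S where S: "geodesic_segment S x y"
    using assms(1) unfolding proper_geodesic_space_def by blast
  then have "y \<in> S" unfolding geodesic_segment_def
    by (metis atLeastAtMost_iff imageI order_refl zero_le_dist)
  then show ?thesis using S assms(2) by (auto simp: geodesic_cone_def)
qed

text \<open>Along orbit points \<open>v n\<close> tending to \<zeta> in the class of \<xi>, both
  \<open>v n\<close> and \<open>p (v n)\<close> lie in the cones over the escaping pairs, so \<zeta>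
  and \<open>E p \<zeta>\<close> belong to one class. By invariance of the partition
  \<open>E p\<close> maps the class of \<xi> onto a class, which meets it and hence equals
  it.\<close>

lemma bounded_displacement_in_radical:
  fixes x\<^sub>0 :: "'a::metric_space" and \<iota> :: "'a \<Rightarrow> 'b::metric_space"
  assumes pg: "proper_geodesic_space TYPE('a)"
    and cb: "convergence_boundary x\<^sub>0 \<iota> E R \<Gamma>"
    and p: "p \<in> carrier isom_group"
    and bd: "\<And>u. u \<in> \<Gamma> \<Longrightarrow> dist (p (u x\<^sub>0)) (u x\<^sub>0) \<le> c"
  shows "p \<in> elliptic_radical x\<^sub>0 \<iota> E R \<Gamma>"
  unfolding elliptic_radical_def
proof (intro CollectI conjI ballI impI p)
  fix \<xi> assume \<xi>: "\<xi> \<in> bdry \<iota>" and sub: "R `` {\<xi>} \<subseteq> R `` accum_pts \<iota> {h x\<^sub>0 |h. h \<in> \<Gamma>}"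
  have R: "equiv (bdry \<iota>) R" and RE: "\<And>c. c \<in> bdry \<iota> // R \<Longrightarrow> E p ` c \<in> bdry \<iota> // R"
    using cb p by (auto simp: convergence_boundary_def invariant_partition_def)
  have "\<xi> \<in> R `` {\<xi>}" using equiv_class_self[OF R \<xi>] .
  then obtain \<zeta> where \<zeta>: "\<zeta> \<in> accum_pts \<iota> {h x\<^sub>0 |h. h \<in> \<Gamma>}" "(\<zeta>, \<xi>) \<in> R" using sub by blast
  then have \<zeta>b: "\<zeta> \<in> bdry \<iota>" and lim: "\<zeta> islimpt \<iota> ` {h x\<^sub>0 |h. h \<in> \<Gamma>}" by (auto simp: accum_pts_def)
  have cls: "R `` {\<xi>} = R `` {\<zeta>}" using R \<zeta>(2) by (simp add: equiv_class_eq_iff)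
  obtain s where s: "\<And>n. s n \<in> \<iota> ` {h x\<^sub>0 |h. h \<in> \<Gamma>}" "s \<longlonglongrightarrow> \<zeta>"
    using lim by (auto simp: islimpt_sequential)
  have "\<forall>n. \<exists>u\<in>\<Gamma>. s n = \<iota> (u x\<^sub>0)" using s(1) by blast
  then obtain u where u: "\<And>n. u n \<in> \<Gamma>" "\<And>n. s n = \<iota> (u n x\<^sub>0)" by metis
  define v where "v n = u n x\<^sub>0" for n
  have v: "(\<lambda>n. \<iota> (v n)) \<longlonglongrightarrow> \<zeta>" using s(2) by (simp add: v_def flip: u(2))
  obtain \<kappa> where "homeomorphism UNIV (range \<iota>) \<iota> \<kappa>"
    using cb by (auto simp: convergence_boundary_def compactification_def)
  then have \<iota>c: "continuous_on UNIV \<iota>" by (simp add: homeomorphism_def)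
  \<comment> \<open>Otherwise a subsequence stays in a compact ball and accumulates at a point of
    the space, although its limit in the compactification is the boundary point \<zeta>.\<close>
  have esc: "filterlim (\<lambda>n. dist x\<^sub>0 (v n)) at_top sequentially"
  proof (rule ccontr)
    assume "\<not> ?thesis"
    then obtain K where "\<not> (\<forall>\<^sub>F n in sequentially. K \<le> dist x\<^sub>0 (v n))"
      unfolding filterlim_at_top by blast
    then have "\<exists>\<^sub>F n in sequentially. dist x\<^sub>0 (v n) < K"
      by (simp add: not_eventually not_le)
    then have inf: "infinite {n. dist x\<^sub>0 (v n) < K}"
      by (simp add: frequently_cofinite flip: cofinite_eq_sequentially)
    define r where "r = enumerate {n. dist x\<^sub>0 (v n) < K}"
    have r: "strict_mono r" "\<And>n. dist x\<^sub>0 (v (r n)) < K"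
      using inf enumerate_in_set[OF inf] by (auto simp: r_def strict_mono_enumerate)
    have "compact (cball x\<^sub>0 K)" using pg by (simp add: proper_geodesic_space_def)
    moreover have "v (r n) \<in> cball x\<^sub>0 K" for n using less_imp_le[OF r(2)[of n]] by simp
    ultimately have "\<exists>l\<in>cball x\<^sub>0 K. \<exists>q. strict_mono q \<and> ((\<lambda>n. v (r n)) \<circ> q) \<longlonglongrightarrow> l"
      unfolding compact_def by simp
    then obtain l q where l: "strict_mono q" "((\<lambda>n. v (r n)) \<circ> q) \<longlonglongrightarrow> l" by blast
    have "(\<lambda>n. \<iota> (v (r (q n)))) \<longlonglongrightarrow> \<iota> l"
      using continuous_on_tendsto_compose[OF \<iota>c l(2)] by (simp add: o_def)
    moreover have "(\<lambda>n. \<iota> (v (r (q n)))) \<longlonglongrightarrow> \<zeta>"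
      using LIMSEQ_subseq_LIMSEQ[OF v strict_mono_o[OF r(1) l(1)]] by (simp add: o_def)
    ultimately have "\<zeta> = \<iota> l" using LIMSEQ_unique by blast
    then show False using \<zeta>b by (simp add: bdry_def)
  qed
  have c: "dist (v n) (p (v n)) \<le> c" for n using bd[OF u(1)[of n]] by (simp add: v_def dist_commute)
  have "escaping x\<^sub>0 (\<lambda>n. {v n, p (v n)})"
    unfolding escaping_def
  proof (rule filterlim_at_top_mono)
    show "filterlim (\<lambda>n. -c + dist x\<^sub>0 (v n)) at_top sequentially"
      by (rule filterlim_tendsto_add_at_top[OF tendsto_const esc])
    have "- c + dist x\<^sub>0 (v n) \<le> infdist x\<^sub>0 {v n, p (v n)}" for n
    proof -
      have "dist x\<^sub>0 (v n) - c \<le> dist x\<^sub>0 z" if "z \<in> {v n, p (v n)}" for z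
        using that c[of n] dist_triangle2[of x\<^sub>0 "v n" "p (v n)"] order_trans[OF zero_le_dist c[of n]]
        by auto
      then show ?thesis by (subst infdist_notempty) (auto intro!: cInf_greatest)
    qed
    then show "\<forall>\<^sub>F n in sequentially. - c + dist x\<^sub>0 (v n) \<le> infdist x\<^sub>0 {v n, p (v n)}" by simp
  qed
  moreover have "boundary_axiom_B x\<^sub>0 \<iota> R" using cb by (simp add: convergence_boundary_def)
  moreover have "contracting_set c {v n, p (v n)}" for n by (rule contracting_pair[OF c])
  ultimately obtain r \<eta> where r: "strict_mono (r :: nat \<Rightarrow> nat)" "\<eta> \<in> bdry \<iota>"
     "\<And>y. (\<forall>n. y n \<in> geodesic_cone x\<^sub>0 {v (r n), p (v (r n))}) \<Longrightarrow> seq_accumulates \<iota> y (R `` {\<eta>})"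
    unfolding boundary_axiom_B_def using quasi_geodesic_pair by meson
  have acc: "seq_accumulates \<iota> (\<lambda>n. v (r n)) (R `` {\<eta>})" "seq_accumulates \<iota> (\<lambda>n. p (v (r n))) (R `` {\<eta>})"
    by (auto intro!: r(3) mem_geodesic_cone[OF pg])
  have vr: "(\<lambda>n. \<iota> (v (r n))) \<longlonglongrightarrow> \<zeta>" using LIMSEQ_subseq_LIMSEQ[OF v r(1)] by (simp add: o_def)
  then have "\<zeta> \<in> R `` {\<eta>}"
    using acc(1)[unfolded seq_accumulates_def, rule_format, of id \<zeta>] by (simp add: strict_mono_def)
  obtain k where "homeomorphism UNIV UNIV (E p) k" and Ep: "\<And>x. E p (\<iota> x) = \<iota> (p x)"
    using cb p by (auto simp: convergence_boundary_def extends_isometries_def)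
  then have "continuous_on UNIV (E p)" by (simp add: homeomorphism_def)
  from continuous_on_tendsto_compose[OF this vr] have "(\<lambda>n. \<iota> (p (v (r n)))) \<longlonglongrightarrow> E p \<zeta>" 
    by (simp add: Ep)
  then have "E p \<zeta> \<in> R `` {\<eta>}"
    using acc(2)[unfolded seq_accumulates_def, rule_format, of id "E p \<zeta>"] by (simp add: strict_mono_def)
  then have "E p \<zeta> \<in> R `` {\<xi>}" using \<open>\<zeta> \<in> R `` {\<eta>}\<close> cls R by (metis Image_singleton_iff equiv_class_eq)
  moreover have "E p \<zeta> \<in> E p ` (R `` {\<xi>})" using cls equiv_class_self[OF R \<zeta>b] by auto
  moreover have "R `` {\<xi>} \<in> bdry \<iota> // R" using \<xi> by (rule quotientI)
  ultimately show "E p ` (R `` {\<xi>}) = R `` {\<xi>}"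
    using RE quotient_disj[OF R] by blast
qed

section \<open>Neumann's lemma\<close>

lemma (in group) neumann_cosets:
  assumes "finite CC" "\<And>K. K \<in> CC \<Longrightarrow> subgroup K G" 
    "\<And>K. K \<in> CC \<Longrightarrow> finite (F K) \<and> F K \<subseteq> carrier G"
    "carrier G \<subseteq> (\<Union>K\<in>CC. \<Union>x\<in>F K. K #> x)"
  shows "\<exists>K\<in>CC. \<exists>Y. finite Y \<and> Y \<subseteq> carrier G \<and> carrier G \<subseteq> (\<Union>x\<in>Y. K #> x)"
  using assms
proof (induction CC arbitrary: F rule: finite_induct)
  case empty
  then show ?case using one_closed by auto
next
  case (insert K CC)
  have K: "subgroup K G" using insert.prems by blast
  show ?case
  proof (cases "carrier G \<subseteq> (\<Union>x\<in>F K. K #> x)")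
    case True
    then show ?thesis using insert.prems(2) by blast
  next
    case False
    then obtain g where g: "g \<in> carrier G" "g \<notin> (\<Union>x\<in>F K. K #> x)" by blast
    have Kg: "K #> g \<subseteq> (\<Union>K'\<in>CC. \<Union>x\<in>F K'. K' #> x)"
    proof
      fix y assume y: "y \<in> K #> g"
      then have yG: "y \<in> carrier G" using g K by (meson r_coset_subset_G subgroup.subset subsetD)
      have "y \<notin> K #> x" if x: "x \<in> F K" for x
      proof
        assume "y \<in> K #> x"
        then have "K #> x = K #> y" "K #> g = K #> y"
          using repr_independence[OF _ _ K] y g x insert.prems(2) by blast+
        then have "g \<in> K #> x" using rcos_self[OF g(1) K] by simp
        then show False using g x by blast
      qed
      moreover have "y \<in> (\<Union>x\<in>F K. K #> x) \<union> (\<Union>K'\<in>CC. \<Union>x\<in>F K'. K' #> x)"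
        using insert.prems(3) yG by (simp add: subset_iff)
      ultimately show "y \<in> (\<Union>K'\<in>CC. \<Union>x\<in>F K'. K' #> x)" by blast
    qed
    \<comment> \<open>\<open>K #> y\<close> is the right translate of \<open>K #> g\<close> by
      \<open>inv g \<otimes> y\<close>, which takes a covering coset \<open>K' #> x\<close> to
      \<open>K' #> (x \<otimes> inv g \<otimes> y)\<close>.\<close>
    define F' where "F' K' = F K' \<union> (\<lambda>(x, y). x \<otimes> inv g \<otimes> y) ` (F K' \<times> F K)" for K'
    have F: "F K' \<subseteq> carrier G" "F K \<subseteq> carrier G" if "K' \<in> CC" for K' using insert.prems(2) that by auto
    have "\<exists>K'\<in>CC. \<exists>Y. finite Y \<and> Y \<subseteq> carrier G \<and> carrier G \<subseteq> (\<Union>x\<in>Y. K' #> x)"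
    proof (rule insert.IH[of F'])
      show "finite (F' K') \<and> F' K' \<subseteq> carrier G" if "K' \<in> CC" for K'
        using insert.prems(2) that F[OF that] g by (auto simp: F'_def)
      show "carrier G \<subseteq> (\<Union>K'\<in>CC. \<Union>x\<in>F' K'. K' #> x)"
      proof
        fix y assume y: "y \<in> carrier G"
        consider K' x where "K' \<in> CC" "x \<in> F K'" "y \<in> K' #> x" | x where "x \<in> F K" "y \<in> K #> x"
          using insert.prems(3) y by blast
        then show "y \<in> (\<Union>K'\<in>CC. \<Union>x\<in>F' K'. K' #> x)"
        proof cases
          case 1 then show ?thesis by (auto simp: F'_def)
        next
          case 2
          then obtain k where k: "k \<in> K" "y = k \<otimes> x" by (auto simp: r_coset_def)
          have xG: "x \<in> carrier G" using insert.prems(2) 2 by auto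
          have kG: "k \<in> carrier G" using k K by (simp add: subgroup.mem_carrier)
          have "k \<otimes> g \<in> K #> g" using k by (auto simp: r_coset_def)
          then obtain K' z where z: "K' \<in> CC" "z \<in> F K'" "k \<otimes> g \<in> K' #> z" using Kg by blast
          then obtain k' where k': "k' \<in> K'" "k \<otimes> g = k' \<otimes> z" by (auto simp: r_coset_def)
          have zG: "z \<in> carrier G" "k' \<in> carrier G"
            using z k' F(1)[OF z(1)] subgroup.mem_carrier[OF insert.prems(1)] by auto
          have "k = k' \<otimes> z \<otimes> inv g" using k' kG g zG
            by (metis inv_solve_right m_closed)
          then have "y = k' \<otimes> (z \<otimes> inv g \<otimes> x)" using k zG g xG by (simp add: m_assoc)
          moreover have "z \<otimes> inv g \<otimes> x \<in> F' K'" using z 2 by (auto simp: F'_def)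
          ultimately show ?thesis using z k' by (auto simp: r_coset_def)
        qed
      qed
    qed (use insert.prems in auto)
    then show ?thesis by blast
  qed
qed

section \<open>Discrete groups of isometries\<close>

text \<open>In the pointwise topology, isolation of the identity involves only a finite set
  \<open>I\<close> of points: elements of \<open>G\<close> with close values on \<open>I\<close> are
  equal. By properness these values lie in finitely many small balls, and the choice of balls
  determines the element.\<close>

lemma discrete_isom_finite_ball:
  fixes x\<^sub>0 :: "'a::metric_space"
  assumes pg: "proper_geodesic_space TYPE('a)" and G: "discrete_isom_subgroup G"
  shows "finite {g\<in>G. dist x\<^sub>0 (g x\<^sub>0) \<le> r}"
proof -
  interpret isom_subgroup G using G isom_subgroup.intro discrete_isom_subgroup_def by blast
  have "(id :: 'a \<Rightarrow> 'a) isolated_in G"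
    using G id_mem by (auto simp: discrete_isom_subgroup_def intro: discreteD)
  then obtain T where T: "open T" "T \<inter> G = {id :: 'a \<Rightarrow> 'a}" by (auto simp: isolated_in_def)
  then have "openin (product_topology (\<lambda>i. euclidean) UNIV) T" "id \<in> T"
    by (auto simp: open_fun_def)
  from product_topology_open_contains_basis[OF this] obtain U where U: "id \<in> (\<Pi>\<^sub>E i\<in>UNIV. U i)" "\<And>i. openin euclidean (U i)" 
      "finite {i. U i \<noteq> topspace euclidean}" "(\<Pi>\<^sub>E i\<in>UNIV. U i) \<subseteq> T"
    by auto
  define I where "I = {i. U i \<noteq> UNIV}"
  have I: "finite I" using U(3) by (simp add: I_def)
  have "\<exists>e>0. ball i e \<subseteq> U i" for i using U(1) U(2)[of i] by (auto simp: open_contains_ball PiE_iff)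
  then obtain e where e: "\<And>i. e i > 0" "\<And>i. ball i (e i) \<subseteq> U i" by metis
  have close_eq: "g = h" if gh: "g \<in> G" "h \<in> G" "\<And>i. i \<in> I \<Longrightarrow> dist (g i) (h i) < e i" for g h
  proof -
    have "finv g \<circ> h \<in> (\<Pi>\<^sub>E i\<in>UNIV. U i)"
    proof (clarsimp simp: PiE_iff)
      fix i show "finv g (h i) \<in> U i"
      proof (cases "i \<in> I")
        case True
        then have "finv g (h i) \<in> ball i (e i)" using gh by (simp add: isom_dist_inv')
        then show ?thesis using e(2) by blast
      qed (simp add: I_def)
    qed
    then have "finv g \<circ> h \<in> T \<inter> G" using U(4) gh by (auto intro: comp_mem inv_mem)
    then have "finv g \<circ> h = id" using T by auto
    then show "g = h" using gh by (metis comp_apply ext id_apply isom isom_inv_apply(2))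
  qed
  have "\<exists>K. finite K \<and> cball x\<^sub>0 (r + dist x\<^sub>0 i) \<subseteq> (\<Union>k\<in>K. ball k (e i / 2))" for i
    using compact_eq_totally_bounded[of "cball x\<^sub>0 (r + dist x\<^sub>0 i)"] pg e(1)[of i]
    by (simp add: proper_geodesic_space_def)
  then obtain K where K: "\<And>i. finite (K i)" "\<And>i. cball x\<^sub>0 (r + dist x\<^sub>0 i) \<subseteq> (\<Union>k\<in>K i. ball k (e i / 2))"
    by metis
  define c where "c g i = (SOME k. k \<in> K i \<and> g i \<in> ball k (e i / 2))" for g and i :: 'a
  have c: "c g i \<in> K i \<and> g i \<in> ball (c g i) (e i / 2)" if g: "g \<in> G" "dist x\<^sub>0 (g x\<^sub>0) \<le> r" for g i
  proof -
    have "dist x\<^sub>0 (g i) \<le> r + dist x\<^sub>0 i"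
      using dist_triangle[of x\<^sub>0 "g i" "g x\<^sub>0"] g by (simp add: isom_dist)
    then have "g i \<in> cball x\<^sub>0 (r + dist x\<^sub>0 i)" by simp
    then have "\<exists>k. k \<in> K i \<and> g i \<in> ball k (e i / 2)" using K(2)[of i] by blast
    then show ?thesis unfolding c_def by (rule someI_ex)
  qed
  have "inj_on (\<lambda>g. restrict (c g) I) {g\<in>G. dist x\<^sub>0 (g x\<^sub>0) \<le> r}"
  proof (rule inj_onI, clarsimp)
    fix g h assume gh: "g \<in> G" "dist x\<^sub>0 (g x\<^sub>0) \<le> r" "h \<in> G" "dist x\<^sub>0 (h x\<^sub>0) \<le> r"
      and eq: "restrict (c g) I = restrict (c h) I"
    have "dist (g i) (h i) < e i" if "i \<in> I" for i
    proof -
      have "c g i = c h i" using eq that by (metis restrict_apply')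
      then show ?thesis using c[OF gh(1,2), of i] c[OF gh(3,4), of i]
        by (metis dist_commute dist_triangle_half_r mem_ball)
    qed
    then show "g = h" using close_eq gh by blast
  qed
  moreover have "(\<lambda>g. restrict (c g) I) ` {g\<in>G. dist x\<^sub>0 (g x\<^sub>0) \<le> r} \<subseteq> (\<Pi>\<^sub>E i\<in>I. K i)"
    using c by auto
  ultimately show ?thesis
    by (rule inj_on_finite) (intro finite_PiE I K)
qed

section \<open>Independent translates of the axis\<close>

locale contracting_action = contracting_orbit x\<^sub>0 f C + isom_subgroup \<Gamma>
  for x\<^sub>0 :: "'a::metric_space" and f C \<Gamma> +
  assumes f_mem: "f \<in> \<Gamma>"
    and finite_ball: "finite {g\<in>\<Gamma>. dist x\<^sub>0 (g x\<^sub>0) \<le> r}"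
    and nonelementary: "\<not> elementary (isom_group\<lparr>carrier := \<Gamma>\<rparr>)"
begin

lemma fp_mem [simp]: "fp n \<in> \<Gamma>"
  using group.subgroup_int_pow_closed[OF group_isom_group subgroup f_mem] by simp

lemma fp_inj: "inj fp"
proof (rule injI)
  fix m n assume eq: "fp m = fp n"
  define d where "d = m - n"
  have d: "fp d x\<^sub>0 = x\<^sub>0" 
    using fp_add[of "-n" m x\<^sub>0] eq by (simp add: d_def)
  have mult: "fp (int j * d) x\<^sub>0 = x\<^sub>0" for j
  proof (induction j)
    case (Suc j)
    then show ?case using fp_add[of d "int j * d" x\<^sub>0] d by (simp add: algebra_simps)
  qed (simp add: fp_0)
  obtain N where N: "N \<ge> 1" "\<And>m n. \<bar>m - n\<bar> \<ge> N \<Longrightarrow> dist (fp m x\<^sub>0) (fp n x\<^sub>0) > 0"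
    using fp_unbounded by metis
  show "m = n"
  proof (rule ccontr)
    assume "m \<noteq> n"
    then have "1 \<le> \<bar>d\<bar>" by (simp add: d_def)
    then have "N * 1 \<le> N * \<bar>d\<bar>" using N by (intro mult_left_mono) auto
    then have "N \<le> \<bar>int (nat N) * d - 0\<bar>" using N(1) by (simp add: abs_mult)
    from N(2)[OF this] show False using mult[of "nat N"] by (simp add: fp_0)
  qed
qed

lemma fp_comp: "fp m \<circ> fp n = fp (m + n)"
  by (simp add: fun_eq_iff fp_add)

text \<open>The powers of f form an infinite cyclic group, so finitely many of its cosets covering
  \<Gamma> would make \<Gamma> virtually cyclic.\<close>

lemma not_finitely_covered:
  assumes F: "finite F" "F \<subseteq> \<Gamma>"
  shows "\<exists>k\<in>\<Gamma>. \<forall>n. \<forall>x\<in>F. k \<noteq> fp n \<circ> x"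
proof (rule ccontr)
  assume "\<not> ?thesis"
  then have cov: "\<And>k. k \<in> \<Gamma> \<Longrightarrow> \<exists>n. \<exists>x\<in>F. k = fp n \<circ> x" by auto
  define G where "G = isom_group\<lparr>carrier := \<Gamma>\<rparr>"
  define K where "K = range fp"
  have G: "group G" unfolding G_def by (rule subgroup.subgroup_is_group[OF subgroup group_isom_group])
  have mG: "x \<otimes>\<^bsub>G\<^esub> y = x \<circ> y" for x y by (simp add: G_def isom_mult)
  interpret G: group G by (rule G)
  have hom: "fp \<in> hom integer_group (isom_group\<lparr>carrier := K\<rparr>)"
    by (auto simp: hom_def K_def isom_mult fp_comp)
  then have "fp \<in> iso integer_group (isom_group\<lparr>carrier := K\<rparr>)"
    using fp_inj by (simp add: iso_def bij_betw_def K_def)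
  then have "integer_group \<cong> isom_group\<lparr>carrier := K\<rparr>" by (rule is_isoI)
  then have 1: "G\<lparr>carrier := K\<rparr> \<cong> integer_group"
    using group.iso_sym[OF group_integer_group] by (simp add: G_def)
  have 2: "subgroup K G"
  proof (rule G.subgroupI)
    show "K \<subseteq> carrier G" "K \<noteq> {}" by (auto simp: K_def G_def)
    show "a \<otimes>\<^bsub>G\<^esub> b \<in> K" if "a \<in> K" "b \<in> K" for a b
      using that by (auto simp: K_def mG fp_comp)
    fix a assume "a \<in> K"
    then obtain n where n: "a = fp n" by (auto simp: K_def)
    have "inv\<^bsub>G\<^esub> a = fp (-n)"
    proof (rule G.inv_equality)
      show "fp (-n) \<otimes>\<^bsub>G\<^esub> a = \<one>\<^bsub>G\<^esub>"
        by (simp add: n mG fp_comp) (simp add: G_def)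
    qed (auto simp: n G_def)
    then show "inv\<^bsub>G\<^esub> a \<in> K" by (auto simp: K_def)
  qed
  have "rcosets\<^bsub>G\<^esub> K \<subseteq> (\<lambda>x. K #>\<^bsub>G\<^esub> x) ` F"
  proof (clarsimp simp: RCOSETS_def)
    fix a assume "a \<in> carrier G"
    then obtain n x where nx: "x \<in> F" "a = fp n \<circ> x" using cov[of a] unfolding G_def by auto
    have "a \<in> K #>\<^bsub>G\<^esub> x" using nx by (auto simp: r_coset_def K_def mG)
    then have "K #>\<^bsub>G\<^esub> a = K #>\<^bsub>G\<^esub> x"
      using G.repr_independence[OF _ _ 2, of a x] nx F by (auto simp: G_def)
    then show "K #>\<^bsub>G\<^esub> a \<in> (#>\<^bsub>G\<^esub>) K ` F" using nx by blast
  qed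
  then have "finite (rcosets\<^bsub>G\<^esub> K)" using F finite_surj by blast
  then have "virtually_infinite_cyclic G"
    unfolding virtually_infinite_cyclic_def using 1 2 by blast
  then show False using nonelementary by (simp add: elementary_def G_def)
qed

text \<open>The constant is \<open>10 C + 14 C\<close>, from \<open>geodesic_hits\<close> and \<open>geodesic_quasiconvex\<close>.\<close>

definition "commensurators = {\<phi>\<in>\<Gamma>. dist x\<^sub>0 (\<phi> x\<^sub>0) \<le> 24 * C \<and> (\<exists>a b. a \<noteq> 0 \<and> b \<noteq> 0 \<and> \<phi> \<circ> fp a = fp b \<circ> \<phi>)}"

lemma finite_commensurators: "finite commensurators"
  by (rule finite_subset[OF _ finite_ball[of "24 * C"]]) (auto simp: commensurators_def)

lemma commensurators_inv:
  assumes "\<phi> \<in> commensurators" shows "finv \<phi> \<in> commensurators"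
proof -
  from assms obtain a b where *: "\<phi> \<in> \<Gamma>" "dist x\<^sub>0 (\<phi> x\<^sub>0) \<le> 24 * C" "a \<noteq> 0" "b \<noteq> 0" "\<phi> \<circ> fp a = fp b \<circ> \<phi>"
    by (auto simp: commensurators_def)
  have "finv \<phi> \<circ> fp b = fp a \<circ> finv \<phi>"
  proof
    fix x
    have "\<phi> (fp a (finv \<phi> x)) = fp b (\<phi> (finv \<phi> x))" using *(5) by (metis comp_apply)
    then show "(finv \<phi> \<circ> fp b) x = (fp a \<circ> finv \<phi>) x" using *(1) by (metis comp_apply isom isom_inv_apply)
  qed
  moreover have "dist x\<^sub>0 (finv \<phi> x\<^sub>0) \<le> 24 * C" using * by (simp add: isom_dist_inv' dist_commute)
  ultimately show ?thesis using * by (auto simp: commensurators_def inv_mem)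
qed

text \<open>A geodesic between points of the translated axis stays near the translate and, if their
  projections to the axis are far apart, also passes near distant points of the axis. Thus
  infinitely many \<open>fp i x\<^sub>0\<close> lie within \<open>24 * C\<close> of points
  \<open>k (fp j x\<^sub>0)\<close>. The elements \<open>\<phi> i\<close> that compare them take
  finitely many values, and a repetition is a commensuration relation.\<close>

lemma unbounded_projection_commensurates:
  assumes k: "k \<in> \<Gamma>" and unb: "\<And>B. \<exists>n. \<not> near (k (fp n x\<^sub>0)) B"
  shows "\<exists>\<phi>\<in>commensurators. \<exists>i j. k = fp i \<circ> \<phi> \<circ> fp j"
proof -
  define I where "I = {i. \<exists>j. dist (fp i x\<^sub>0) (k (fp j x\<^sub>0)) \<le> 24 * C}"
  have ki: "k \<in> carrier isom_group" using k by simp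
  have I_unb: "\<exists>i\<in>I. dist (fp i x\<^sub>0) x\<^sub>0 > B" for B
  proof -
    obtain a where a: "a \<in> pr (k x\<^sub>0)" using pr_ex by blast
    obtain n where "\<not> near (k (fp n x\<^sub>0)) (max B (8 * C + dist a x\<^sub>0))" using unb by blast
    then obtain z where z: "z \<in> pr (k (fp n x\<^sub>0))" "dist z x\<^sub>0 > B" "dist z x\<^sub>0 > 8 * C + dist a x\<^sub>0"
      by (auto simp: near_def not_le)
    then have "dist a z > 8 * C" using dist_triangle3[of z x\<^sub>0 a] by simp
    obtain \<gamma> where g: "geodesic_path \<gamma> (k x\<^sub>0) (k (fp n x\<^sub>0))"
      using proper_geodesic_space_path[OF proper_geodesic] by blast
    obtain t where t: "0 \<le> t" "t \<le> dist (k x\<^sub>0) (k (fp n x\<^sub>0))" "dist (\<gamma> t) z \<le> 10 * C"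
      using geodesic_hits[OF g a z(1) \<open>dist a z > 8 * C\<close>] by blast
    have g': "geodesic_path (\<lambda>t. finv k (\<gamma> t)) x\<^sub>0 (fp n x\<^sub>0)"
      using geodesic_path_isometry[OF g isom_dist[OF isom_inv[OF ki]]] ki by simp
    have "infdist (finv k (\<gamma> t)) (range (\<lambda>n. fp n x\<^sub>0)) \<le> 14 * C"
      by (rule geodesic_quasiconvex[OF g' x0_axis]) (use t isom_dist[OF ki] in auto)
    moreover obtain b where b: "b \<in> pr (finv k (\<gamma> t))" using pr_ex by blast
    ultimately have "dist (\<gamma> t) (k b) \<le> 14 * C" using pr_dist[OF b] ki by (simp add: isom_dist_inv)
    then have "dist z (k b) \<le> 24 * C" using t dist_triangle3[of z "k b" "\<gamma> t"] by simp
    moreover obtain i j where "z = fp i x\<^sub>0" "b = fp j x\<^sub>0" using pr_in[OF z(1)] pr_in[OF b] by auto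
    ultimately show ?thesis using z unfolding I_def by auto
  qed
  have "infinite I"
  proof
    assume "finite I"
    then have "dist (fp i x\<^sub>0) x\<^sub>0 \<le> Max ((\<lambda>i. dist (fp i x\<^sub>0) x\<^sub>0) ` I)" if "i \<in> I" for i using that by simp
    then show False using I_unb[of "Max ((\<lambda>i. dist (fp i x\<^sub>0) x\<^sub>0) ` I)"] by force
  qed
  obtain j where j: "\<And>i. i \<in> I \<Longrightarrow> dist (fp i x\<^sub>0) (k (fp (j i) x\<^sub>0)) \<le> 24 * C"
    using bchoice[of I "\<lambda>i j. dist (fp i x\<^sub>0) (k (fp j x\<^sub>0)) \<le> 24 * C"] unfolding I_def by blast
  define \<phi> where "\<phi> i = fp (-i) \<circ> k \<circ> fp (j i)" for i
  have \<phi>\<Gamma>: "\<phi> i \<in> \<Gamma>" for i by (simp add: \<phi>_def comp_mem k)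
  have \<phi>d: "dist x\<^sub>0 (\<phi> i x\<^sub>0) \<le> 24 * C" if "i \<in> I" for i
    using j[OF that] isom_dist[OF fp_isom, of "-i" "fp i x\<^sub>0"] by (simp add: \<phi>_def)
  have "finite (\<phi> ` I)"
    by (rule finite_subset[OF _ finite_ball[of "24 * C"]]) (use \<phi>\<Gamma> \<phi>d in auto)
  from pigeonhole_infinite[OF \<open>infinite I\<close> this] obtain i where i: "i \<in> I" "infinite {i'\<in>I. \<phi> i' = \<phi> i}" by blast
  have "\<not> {i'\<in>I. \<phi> i' = \<phi> i} \<subseteq> {i}" using i(2) finite_subset by blast
  then obtain i' where i': "i' \<in> I" "\<phi> i' = \<phi> i" "i' \<noteq> i" by auto
  have keq: "k = fp l \<circ> \<phi> l \<circ> fp (- j l)" for l by (simp add: \<phi>_def fun_eq_iff)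
  have comm: "\<phi> i \<circ> fp (j i' - j i) = fp (i' - i) \<circ> \<phi> i"
  proof
    fix x
    have "\<phi> i (fp (j i' - j i) x) = fp (-i) (k (fp (j i) (fp (- j i) (fp (j i') x))))"
      using fp_add[of "- j i" "j i'" x] by (simp add: \<phi>_def)
    also have "\<dots> = fp (-i) (fp i' (\<phi> i' x))" by (simp add: \<phi>_def)
    also have "\<dots> = fp (i' - i) (\<phi> i x)" using fp_add[of "-i" "i'"] i'(2) by simp
    finally show "(\<phi> i \<circ> fp (j i' - j i)) x = (fp (i' - i) \<circ> \<phi> i) x" by simp
  qed
  have "j i' - j i \<noteq> 0"
  proof
    assume "j i' - j i = 0"
    then have "\<phi> i = fp (i' - i) \<circ> \<phi> i" using comm by (simp add: fun_eq_iff fp_0)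
    then have "fp (i' - i) x = x" for x
      by (metis comp_apply \<phi>\<Gamma> isom isom_inv_apply(2))
    then have "fp (i' - i) = fp 0" by (simp add: fun_eq_iff fp_0)
    then show False using injD[OF fp_inj, of "i' - i" 0] i'(3) by simp
  qed
  then have "\<exists>a b. a \<noteq> 0 \<and> b \<noteq> 0 \<and> \<phi> i \<circ> fp a = fp b \<circ> \<phi> i"
    using comm i'(3) by (meson eq_iff_diff_eq_0)
  then have "\<phi> i \<in> commensurators"
    unfolding commensurators_def using \<phi>\<Gamma> \<phi>d[OF i(1)] by simp
  then show ?thesis using keq[of i] by blast
qed

lemma commensurator_translate:
  assumes "\<phi> \<circ> fp a = fp b \<circ> \<phi>" shows "\<phi> (fp (m * a) x) = fp (m * b) (\<phi> x)"
proof (induction m arbitrary: x rule: int_induct[where k = 0])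
  case (step1 i)
  have "\<phi> (fp ((i + 1) * a) x) = \<phi> (fp a (fp (i * a) x))" 
    using fp_add[of a "i * a" x] by (simp add: algebra_simps)
  also have "\<dots> = fp b (\<phi> (fp (i * a) x))" using assms by (metis comp_apply)
  also have "\<dots> = fp ((i + 1) * b) (\<phi> x)" using step1 fp_add[of b "i * b"] by (simp add: algebra_simps)
  finally show ?case .
next
  case (step2 i)
  have "fp b (\<phi> (fp ((i - 1) * a) x)) = \<phi> (fp a (fp ((i - 1) * a) x))" using assms by (metis comp_apply)
  also have "\<dots> = \<phi> (fp (i * a) x)" using fp_add[of a "(i - 1) * a" x] by (simp add: algebra_simps)
  also have "\<dots> = fp (i * b) (\<phi> x)" by (rule step2)
  finally have "fp (-b) (fp b (\<phi> (fp ((i - 1) * a) x))) = fp (-b) (fp (i * b) (\<phi> x))" by simp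
  then show ?case using fp_add[of "-b" "i * b" "\<phi> x"] by (simp add: algebra_simps)
qed (simp add: fp_0)

text \<open>Otherwise every k is \<open>fp i \<circ> \<phi> \<circ> fp j\<close> with \<phi> from
  the finite set \<open>commensurators\<close>. Multiples of \<open>\<alpha> \<phi>\<close> can be
  moved from the right power through \<phi> to the left one, which leaves only the cosets of
  \<open>\<phi> \<circ> fp r\<close> with r in \<open>{0..<\<alpha> \<phi>}\<close>: finitely many,
  against \<open>not_finitely_covered\<close>.\<close>

lemma exists_independent_translate:
  "\<exists>k\<in>\<Gamma>. \<exists>B. \<forall>n. near (k (fp n x\<^sub>0)) B \<and> near (finv k (fp n x\<^sub>0)) B"
proof (rule ccontr)
  assume neg: "\<not> ?thesis"
  have factor: "\<exists>\<phi>\<in>commensurators. \<exists>i j. k = fp i \<circ> \<phi> \<circ> fp j" if k: "k \<in> \<Gamma>" for k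
  proof -
    have ki: "k \<in> carrier isom_group" using k by simp
    have "(\<forall>B. \<exists>n. \<not> near (k (fp n x\<^sub>0)) B) \<or> (\<forall>B. \<exists>n. \<not> near (finv k (fp n x\<^sub>0)) B)"
    proof (rule ccontr)
      assume "\<not> ?thesis"
      then obtain B B' where "\<And>n. near (k (fp n x\<^sub>0)) B" "\<And>n. near (finv k (fp n x\<^sub>0)) B'"
        by metis
      then have "near (k (fp n x\<^sub>0)) (max B B') \<and> near (finv k (fp n x\<^sub>0)) (max B B')" for n
        by (meson max.cobounded1 max.cobounded2 near_mono)
      then show False using neg k by blast
    qed
    then show ?thesis
    proof
      assume "\<forall>B. \<exists>n. \<not> near (k (fp n x\<^sub>0)) B"
      then show ?thesis using unbounded_projection_commensurates[OF k] by blast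
    next
      assume "\<forall>B. \<exists>n. \<not> near (finv k (fp n x\<^sub>0)) B"
      with unbounded_projection_commensurates[OF inv_mem[OF k]]
      obtain \<phi> i j where \<phi>: "\<phi> \<in> commensurators" "finv k = fp i \<circ> \<phi> \<circ> fp j" by blast
      have \<phi>i: "\<phi> \<in> carrier isom_group" using \<phi>(1) by (simp add: commensurators_def)
      have "k = finv (fp i \<circ> \<phi> \<circ> fp j)" using isom_inv_inv[OF ki] \<phi>(2) by simp
      also have "\<dots> = fp (-j) \<circ> finv \<phi> \<circ> fp (-i)"
        using \<phi>i by (simp add: isom_inv_comp isom_comp fp_inv o_assoc)
      finally show ?thesis using commensurators_inv[OF \<phi>(1)] by blast
    qed
  qed
  have "\<exists>a b. a > 0 \<and> \<phi> \<circ> fp a = fp b \<circ> \<phi>" if "\<phi> \<in> commensurators" for \<phi>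
  proof -
    obtain a b where ab: "a \<noteq> 0" "\<phi> \<circ> fp a = fp b \<circ> \<phi>" using \<open>\<phi> \<in> commensurators\<close> by (auto simp: commensurators_def)
    have "\<phi> \<circ> fp (-a) = fp (-b) \<circ> \<phi>" 
      using commensurator_translate[OF ab(2), of "-1"] by (simp add: fun_eq_iff)
    then show ?thesis using ab by (meson linorder_neqE neg_0_less_iff_less)
  qed
  then obtain \<alpha> \<beta> where \<alpha>: "\<And>\<phi>. \<phi> \<in> commensurators \<Longrightarrow> \<alpha> \<phi> > 0"
     "\<And>\<phi>. \<phi> \<in> commensurators \<Longrightarrow> \<phi> \<circ> fp (\<alpha> \<phi>) = fp (\<beta> \<phi>) \<circ> \<phi>" by metis
  define F where "F = (\<Union>\<phi>\<in>commensurators. (\<lambda>r. \<phi> \<circ> fp r) ` {0..<\<alpha> \<phi>})"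
  have "finite F" unfolding F_def using finite_commensurators by simp
  moreover have "F \<subseteq> \<Gamma>" by (auto simp: F_def commensurators_def intro: comp_mem)
  ultimately obtain k where k: "k \<in> \<Gamma>" "\<And>n x. x \<in> F \<Longrightarrow> k \<noteq> fp n \<circ> x"
    using not_finitely_covered by meson
  have "\<exists>n. \<exists>x\<in>F. k = fp n \<circ> x" if k: "k \<in> \<Gamma>" for k
  proof -
    obtain \<phi> i j where \<phi>: "\<phi> \<in> commensurators" "k = fp i \<circ> \<phi> \<circ> fp j" using factor[OF k] by blast
    define q r where "q = j div \<alpha> \<phi>" and "r = j mod \<alpha> \<phi>"
    have j: "j = q * \<alpha> \<phi> + r" by (simp add: q_def r_def)
    have "k = fp (i + q * \<beta> \<phi>) \<circ> (\<phi> \<circ> fp r)"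
    proof
      fix x
      have "k x = fp i (\<phi> (fp (q * \<alpha> \<phi>) (fp r x)))" using \<phi>(2) j by (simp add: fp_add)
      also have "\<dots> = fp i (fp (q * \<beta> \<phi>) (\<phi> (fp r x)))"
        using commensurator_translate[OF \<alpha>(2)[OF \<phi>(1)]] by simp
      finally show "k x = (fp (i + q * \<beta> \<phi>) \<circ> (\<phi> \<circ> fp r)) x" by (simp add: fp_add)
    qed
    moreover have "\<phi> \<circ> fp r \<in> F" using \<phi>(1) \<alpha>(1)[OF \<phi>(1)] unfolding F_def r_def
      by (intro UN_I[OF \<phi>(1)] imageI) simp
    ultimately show ?thesis by blast
  qed
  from this[OF k(1)] k(2) show False by blast
qed

text \<open>The translates of the axis by the elements \<open>c i\<close> project to the axis near
  widely spaced points. By \<open>behrstock\<close>, a point projecting away from the i-th of these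
  is \<open>near\<close> after applying \<open>finv (c i)\<close>. So each point excludes at most
  one i, and one of \<open>m + 1\<close> indices serves m points.\<close>

lemma selection:
  obtains J \<theta> where "finite J" "J \<subseteq> \<Gamma>" "\<theta> \<ge> 0"
    "\<And>Q. finite Q \<Longrightarrow> card Q \<le> m \<Longrightarrow> \<exists>b\<in>J. \<forall>x\<in>Q. near (b x) \<theta>"
proof -
  obtain k B where k: "k \<in> \<Gamma>" "\<And>n. near (k (fp n x\<^sub>0)) B" "\<And>n. near (finv k (fp n x\<^sub>0)) B"
    using exists_independent_translate by blast
  have ki: "k \<in> carrier isom_group" using k by simp
  \<comment> \<open>With this spacing no projection is within \<open>8 * C + B\<close> of two of the
    points.\<close>
  obtain N where N: "N \<ge> 1" "\<And>m n. \<bar>m - n\<bar> \<ge> N \<Longrightarrow> dist (fp m x\<^sub>0) (fp n x\<^sub>0) > 2 * (8 * C + B)"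
    using fp_unbounded by metis
  define c where "c i = fp (int i * N) \<circ> k" for i
  define \<theta> where "\<theta> = 41 * C + B"
  have B0: "0 \<le> B" using k(2)[of 0] pr_ex by (auto simp: near_def) (meson zero_le_dist order_trans)
  have c\<Gamma>: "c i \<in> \<Gamma>" for i using k by (auto simp: c_def intro: comp_mem)
  have cinv: "finv (c i) x = finv k (fp (- (int i * N)) x)" for i x
    using ki by (simp add: c_def isom_inv_comp fp_inv)
  have step: "near (finv (c i) x) \<theta>" 
    if \<alpha>: "\<alpha> \<in> pr x" and d: "dist \<alpha> (fp (int i * N) x\<^sub>0) > 8 * C + B" for i x \<alpha>
    unfolding near_def
  proof
    fix a assume a: "a \<in> pr (finv (c i) x)"
    obtain y where y: "y \<in> pr (c i a)" using pr_ex by blast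
    obtain w where w: "w \<in> pr (finv (c i) \<alpha>)" using pr_ex by blast
    obtain n where n: "a = fp n x\<^sub>0" using pr_in[OF a] by auto
    have "fp (- (int i * N)) y \<in> pr (k a)" using pr_fp'[of y "int i * N"] y by (simp add: c_def)
    then have "dist (fp (- (int i * N)) y) x\<^sub>0 \<le> B" using k(2)[of n] n by (simp add: near_def)
    then have "dist y (fp (int i * N) x\<^sub>0) \<le> B"
      using isom_dist[OF fp_isom, of "int i * N" "fp (- (int i * N)) y" x\<^sub>0] by simp
    then have "dist \<alpha> y > 8 * C" using d dist_triangle[of \<alpha> "fp (int i * N) x\<^sub>0" y] by simp
    from behrstock[OF isom[OF c\<Gamma>] \<alpha> a y this w] have "dist a w \<le> 41 * C" .
    moreover have "dist w x\<^sub>0 \<le> B"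
    proof -
      obtain l where "\<alpha> = fp l x\<^sub>0" using pr_in[OF \<alpha>] by auto
      then have "finv (c i) \<alpha> = finv k (fp (- (int i * N) + l) x\<^sub>0)" by (simp only: cinv fp_add)
      then show ?thesis using w k(3) by (simp add: near_def)
    qed
    ultimately show "dist a x\<^sub>0 \<le> \<theta>" using dist_triangle[of a x\<^sub>0 w] by (simp add: \<theta>_def)
  qed
  have one: "near (finv (c i) x) \<theta> \<or> near (finv (c j) x) \<theta>" if "i \<noteq> j" for i j x
  proof -
    obtain \<alpha> where \<alpha>: "\<alpha> \<in> pr x" using pr_ex by blast
    have "1 \<le> \<bar>int i - int j\<bar>" using that by simp
    then have "N * 1 \<le> N * \<bar>int i - int j\<bar>" using N by (intro mult_left_mono) auto
    then have "N \<le> \<bar>int i * N - int j * N\<bar>" using N(1)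
      by (simp add: abs_mult mult.commute flip: right_diff_distrib left_diff_distrib)
    from N(2)[OF this] have "dist \<alpha> (fp (int i * N) x\<^sub>0) > 8 * C + B \<or> dist \<alpha> (fp (int j * N) x\<^sub>0) > 8 * C + B"
      using dist_triangle3[of "fp (int i * N) x\<^sub>0" "fp (int j * N) x\<^sub>0" \<alpha>] by argo
    then show ?thesis using step[OF \<alpha>] by blast
  qed
  show thesis
  proof (rule that[of "(\<lambda>i. finv (c i)) ` {..m}" \<theta>])
    show "(\<lambda>i. finv (c i)) ` {..m} \<subseteq> \<Gamma>" using c\<Gamma> by (auto intro: inv_mem)
    show "0 \<le> \<theta>" using B0 C_ge_1 by (simp add: \<theta>_def)
    fix Q :: "'a set" assume Q: "finite Q" "card Q \<le> m"
    define bad where "bad x = {i\<in>{..m}. \<not> near (finv (c i) x) \<theta>}" for x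
    have "card (bad x) \<le> 1" for x
    proof -
      have "finite (bad x)" by (simp add: bad_def)
      moreover have "i = j" if "i \<in> bad x" "j \<in> bad x" for i j
        using that one[of i j x] by (auto simp: bad_def)
      ultimately show ?thesis by (simp add: card_le_Suc0_iff_eq)
    qed
    then have "card (\<Union>x\<in>Q. bad x) \<le> (\<Sum>x\<in>Q. 1)"
      using card_UN_le[OF Q(1), of bad] by (meson order_trans sum_mono)
    then have "card (\<Union>x\<in>Q. bad x) < card {..m}" using Q by simp
    moreover have "finite (\<Union>x\<in>Q. bad x)" using Q by (simp add: bad_def)
    ultimately have "\<not> {..m} \<subseteq> (\<Union>x\<in>Q. bad x)" using card_mono by (meson not_le)
    then show "\<exists>b\<in>(\<lambda>i. finv (c i)) ` {..m}. \<forall>x\<in>Q. near (b x) \<theta>"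
      by (auto simp: bad_def)
  qed simp
qed

text \<open>Otherwise cosets of the centralizers \<open>Z p\<close> cover \<Gamma>, and by Neumann's
  lemma finitely many cosets of a single \<open>Z p\<close> do. The displacement of
  \<open>u x\<^sub>0\<close> under p depends only on the coset of u, because elements of
  \<open>Z p\<close> commute with p and are isometries; so it would be bounded.\<close>

lemma new_coset:
  assumes P: "finite P" "P \<subseteq> carrier isom_group" and V: "finite V" "V \<subseteq> \<Gamma>"
    and unb: "\<And>p B. p \<in> P \<Longrightarrow> \<exists>u\<in>\<Gamma>. dist (p (u x\<^sub>0)) (u x\<^sub>0) > B"
  shows "\<exists>v\<in>\<Gamma>. \<forall>p\<in>P. \<forall>w\<in>V. p \<circ> (v \<circ> finv w) \<noteq> (v \<circ> finv w) \<circ> p"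
proof (rule ccontr)
  assume "\<not> ?thesis"
  then have neg: "\<exists>p\<in>P. \<exists>w\<in>V. p \<circ> (v \<circ> finv w) = (v \<circ> finv w) \<circ> p" if "v \<in> \<Gamma>" for v
    using that by blast
  define G where "G = isom_group\<lparr>carrier := \<Gamma>\<rparr>"
  have G: "group G" unfolding G_def by (rule subgroup.subgroup_is_group[OF subgroup group_isom_group])
  interpret G: group G by (rule G)
  have mG: "x \<otimes>\<^bsub>G\<^esub> y = x \<circ> y" for x y by (simp add: G_def isom_mult)
  have invG: "inv\<^bsub>G\<^esub> x = finv x" if "x \<in> \<Gamma>" for x
    using that by (intro G.inv_equality) (auto simp: G_def isom_mult isom_one inv_mem fun_eq_iff)
  define Z where "Z p = {g\<in>\<Gamma>. p \<circ> g = g \<circ> p}" for p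
  have Z: "subgroup (Z p) G" for p
  proof (rule G.subgroupI)
    show "Z p \<subseteq> carrier G" by (auto simp: Z_def G_def)
    show "Z p \<noteq> {}" using id_mem by (auto simp: Z_def)
    show "inv\<^bsub>G\<^esub> a \<in> Z p" if "a \<in> Z p" for a
    proof -
      have a: "a \<in> \<Gamma>" "p \<circ> a = a \<circ> p" using that by (auto simp: Z_def)
      have "p (finv a x) = finv a (p x)" for x
      proof -
        have "a (p (finv a x)) = p x" using a(1) fun_cong[OF a(2), of "finv a x"] by simp
        then show ?thesis using a(1) by (metis isom isom_inv_apply(1))
      qed
      then show ?thesis using a by (simp add: invG) (simp add: Z_def inv_mem fun_eq_iff)
    qed
    show "a \<otimes>\<^bsub>G\<^esub> b \<in> Z p" if "a \<in> Z p" "b \<in> Z p" for a b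
      using that by (auto simp: Z_def mG comp_mem fun_eq_iff)
  qed
  have "\<exists>K\<in>Z ` P. \<exists>Y. finite Y \<and> Y \<subseteq> carrier G \<and> carrier G \<subseteq> (\<Union>x\<in>Y. K #>\<^bsub>G\<^esub> x)"
  proof (rule G.neumann_cosets[of _ "\<lambda>_. V"])
    show "carrier G \<subseteq> (\<Union>K\<in>Z ` P. \<Union>x\<in>V. K #>\<^bsub>G\<^esub> x)"
    proof
      fix v assume v: "v \<in> carrier G"
      then obtain p w where pw: "p \<in> P" "w \<in> V" "p \<circ> (v \<circ> finv w) = (v \<circ> finv w) \<circ> p"
        using neg[of v] unfolding G_def by auto
      have w\<Gamma>: "w \<in> \<Gamma>" using pw V by auto
      have "v \<circ> finv w \<in> Z p" using pw v w\<Gamma> by (simp add: Z_def G_def comp_mem inv_mem)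
      moreover have "v = (v \<circ> finv w) \<otimes>\<^bsub>G\<^esub> w" using w\<Gamma> by (simp add: mG fun_eq_iff)
      ultimately have "v \<in> Z p #>\<^bsub>G\<^esub> w" unfolding r_coset_def by blast
      then show "v \<in> (\<Union>K\<in>Z ` P. \<Union>x\<in>V. K #>\<^bsub>G\<^esub> x)" using pw by blast
    qed
  qed (use P V Z in \<open>auto simp: G_def\<close>)
  then obtain p Y where pY: "p \<in> P" "finite Y" "Y \<subseteq> \<Gamma>" "\<Gamma> \<subseteq> (\<Union>x\<in>Y. Z p #>\<^bsub>G\<^esub> x)"
    by (auto simp: G_def)
  define B where "B = Max ((\<lambda>y. dist (p (y x\<^sub>0)) (y x\<^sub>0)) ` Y)"
  obtain u where u: "u \<in> \<Gamma>" "dist (p (u x\<^sub>0)) (u x\<^sub>0) > B" using unb pY by blast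
  then obtain y z where yz: "y \<in> Y" "z \<in> Z p" "u = z \<circ> y"
    using pY(4) by (auto simp: r_coset_def mG)
  have "p (z (y x\<^sub>0)) = z (p (y x\<^sub>0))" using yz(2) by (auto simp: Z_def fun_eq_iff)
  then have "dist (p (u x\<^sub>0)) (u x\<^sub>0) = dist (p (y x\<^sub>0)) (y x\<^sub>0)"
    using yz by (simp add: Z_def isom_dist)
  also have "\<dots> \<le> B" unfolding B_def using yz pY by simp
  finally show False using u by simp
qed

lemma separated_elements:
  assumes P: "finite P" "P \<subseteq> carrier isom_group"
    and unb: "\<And>p B. p \<in> P \<Longrightarrow> \<exists>u\<in>\<Gamma>. dist (p (u x\<^sub>0)) (u x\<^sub>0) > B"
  shows "\<exists>v :: nat \<Rightarrow> _. (\<forall>i<M. v i \<in> \<Gamma>) \<and>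
    (\<forall>i<M. \<forall>j<i. \<forall>p\<in>P. p \<circ> (v i \<circ> finv (v j)) \<noteq> (v i \<circ> finv (v j)) \<circ> p)"
proof (induction M)
  case (Suc M)
  then obtain v where v: "\<forall>i<M. v i \<in> \<Gamma>" "\<forall>i<M. \<forall>j<i. \<forall>p\<in>P. p \<circ> (v i \<circ> finv (v j)) \<noteq> (v i \<circ> finv (v j)) \<circ> p"
    by blast
  have "finite (v ` {..<M})" "v ` {..<M} \<subseteq> \<Gamma>" using v by auto
  from new_coset[OF P this unb] obtain x where x: "x \<in> \<Gamma>"
     "\<forall>p\<in>P. \<forall>w\<in>v ` {..<M}. p \<circ> (x \<circ> finv w) \<noteq> (x \<circ> finv w) \<circ> p"
    by blast
  define v' where "v' = v(M := x)"
  have v': "v' M = x" "\<And>i. i < M \<Longrightarrow> v' i = v i" by (auto simp: v'_def)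
  have "p \<circ> (v' i \<circ> finv (v' j)) \<noteq> (v' i \<circ> finv (v' j)) \<circ> p" if "i < Suc M" "j < i" "p \<in> P" for i j p
    using that v(2) x(2) v' by (cases "i = M") (simp_all del: comp_apply)
  moreover have "v' i \<in> \<Gamma>" if "i < Suc M" for i
    using that v(1) x(1) v' by (cases "i = M") simp_all
  ultimately show ?case by blast
qed auto

end

section \<open>Barriers for confined subgroups\<close>

text \<open>In the application \<open>P\<close> is the confining set without the identity. The
  number 4 in \<open>select\<close> comes from \<open>conjugate_barrier\<close>, which adds one
  point to a given set of three.\<close>

locale confined_action = contracting_action x\<^sub>0 f C \<Gamma>
  for x\<^sub>0 :: "'a::metric_space" and f C \<Gamma> +
  fixes H P J :: "('a \<Rightarrow> 'a) set" and \<theta> \<beta> :: real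
  assumes H_subgroup: "subgroup H isom_group"
    and finite_ball_H: "finite {h\<in>H. dist x\<^sub>0 (h x\<^sub>0) \<le> r}"
    and P_finite: "finite P" and P_isom: "P \<subseteq> carrier isom_group"
    and P_unbounded: "p \<in> P \<Longrightarrow> \<exists>u\<in>\<Gamma>. dist (p (u x\<^sub>0)) (u x\<^sub>0) > B"
    and confined: "u \<in> \<Gamma> \<Longrightarrow> \<exists>p\<in>P. finv u \<circ> p \<circ> u \<in> H"
    and J: "finite J" "J \<subseteq> \<Gamma>" and \<theta>_nonneg: "\<theta> \<ge> 0"
    and select: "finite Q \<Longrightarrow> card Q \<le> 4 \<Longrightarrow> \<exists>b\<in>J. \<forall>x\<in>Q. near (b x) \<theta>"
    and \<beta>: "b \<in> J \<Longrightarrow> dist x\<^sub>0 (b x\<^sub>0) \<le> \<beta>"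
begin

sublocale H: isom_subgroup H
  by (rule isom_subgroup.intro[OF H_subgroup])

text \<open>\<open>D\<^sub>0\<close> leaves room for \<open>barrier_shadow\<close> followed by \<open>barrier_hit\<close>.  A displacement of \<open>u x\<^sub>0\<close>
  above \<open>c\<^sub>0\<close> excludes that the geodesics from a point \<open>p y\<close> to \<open>u x\<^sub>0\<close> and to \<open>p (u x\<^sub>0)\<close> each pass near the other
  endpoint.\<close>

definition "r\<^sub>0 = \<theta> + 8 * C"
definition "D\<^sub>0 = r\<^sub>0 + 17 * C"
definition "c\<^sub>0 = 2 * (10 * C + \<theta> + \<beta>)"

text \<open>Both directions along the translated axis count, so this is a pair of opposite
  half-spaces.\<close>

definition beyond :: "('a \<Rightarrow> 'a) \<Rightarrow> real \<Rightarrow> 'a set" where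
  "beyond w K = {x. far (finv w x) K}"

text \<open>The same barrier w serves all of \<open>W\<close>: by \<open>barrier_hit\<close>,
  geodesics from any point of \<open>W\<close> to the image under p of any point of \<open>W\<close>
  pass near \<open>w x\<^sub>0\<close>.\<close>

definition moves :: "('a \<Rightarrow> 'a) \<Rightarrow> 'a set \<Rightarrow> bool" where
  "moves p W \<longleftrightarrow> (\<exists>w\<in>\<Gamma>. \<forall>x\<in>W. far (finv w x) D\<^sub>0 \<and> near (finv w (p x)) r\<^sub>0)"

definition fixes_coarsely :: "('a \<Rightarrow> 'a) \<Rightarrow> 'a set \<Rightarrow> bool" where
  "fixes_coarsely p W \<longleftrightarrow> (\<forall>u\<in>\<Gamma>. u x\<^sub>0 \<in> W \<longrightarrow> dist (p (u x\<^sub>0)) (u x\<^sub>0) \<le> c\<^sub>0)"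

lemma beyond_mono: "K \<le> K' \<Longrightarrow> beyond w K' \<subseteq> beyond w K"
  by (auto simp: beyond_def intro: far_mono)

lemma moves_mono: "moves p W \<Longrightarrow> W' \<subseteq> W \<Longrightarrow> moves p W'"
  unfolding moves_def by blast

lemma fixes_coarsely_mono: "fixes_coarsely p W \<Longrightarrow> W' \<subseteq> W \<Longrightarrow> fixes_coarsely p W'"
  by (auto simp: fixes_coarsely_def)

lemma \<beta>_inv: "b \<in> J \<Longrightarrow> dist x\<^sub>0 (finv b x\<^sub>0) \<le> \<beta>"
  using \<beta>[of b] J by (simp add: isom_dist_inv' dist_commute subset_iff)

lemma constants: "0 \<le> r\<^sub>0" "0 \<le> D\<^sub>0" "D\<^sub>0 \<ge> r\<^sub>0 + 8 * C"
  using \<theta>_nonneg C_ge_1 by (auto simp: r\<^sub>0_def D\<^sub>0_def)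

text \<open>The new barrier passes near \<open>u x\<^sub>0\<close> and is turned by
  \<open>select\<close> so that \<open>w x\<^sub>0\<close> and the images of
  \<open>u x\<^sub>0\<close> under p and its inverse project close to \<open>w' x\<^sub>0\<close>.
  If \<open>p y\<close> did not, for some y beyond it, then \<open>u x\<^sub>0\<close> would almost
  lie on the geodesic from \<open>p y\<close> to \<open>p (u x\<^sub>0)\<close>, and
  \<open>p (u x\<^sub>0)\<close> on that from \<open>p y\<close> to \<open>u x\<^sub>0\<close>,
  against the large displacement.\<close>

lemma displaced_direction:
  assumes p: "p \<in> carrier isom_group" and w: "w \<in> \<Gamma>" and u: "u \<in> \<Gamma>" and K: "K \<ge> 0"
    and u_far: "u x\<^sub>0 \<in> beyond w (17 * K + 4 * (\<theta> + 11 * C + \<beta>) + C)"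
    and disp: "dist (p (u x\<^sub>0)) (u x\<^sub>0) > c\<^sub>0"
  obtains w' K' where "w' \<in> \<Gamma>" "K' \<ge> 0" "beyond w' K' \<subseteq> beyond w K" "moves p (beyond w' K')"
proof -
  have wi: "w \<in> carrier isom_group" and ui: "u \<in> carrier isom_group" using w u by auto
  define Q where "Q = {finv u (w x\<^sub>0), finv u (p (u x\<^sub>0)), finv u (finv p (u x\<^sub>0))}"
  have "finite Q" "card Q \<le> 4" by (auto simp: Q_def card_insert_if)
  from select[OF this] obtain b where b: "b \<in> J" and near: "\<And>x. x \<in> Q \<Longrightarrow> near (b x) \<theta>" by blast
  have b\<Gamma>: "b \<in> \<Gamma>" using b J by auto
  have bi: "b \<in> carrier isom_group" using b\<Gamma> by simp
  define w' where "w' = u \<circ> finv b"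
  have w'\<Gamma>: "w' \<in> \<Gamma>" using u b\<Gamma> by (simp add: w'_def comp_mem inv_mem)
  have w'i: "w' \<in> carrier isom_group" using w'\<Gamma> by simp
  have fw'i: "finv w' \<in> carrier isom_group" by (rule isom_inv[OF w'i])
  have fw': "finv w' x = b (finv u x)" for x
    using ui bi by (simp add: w'_def isom_inv_comp isom_inv isom_inv_inv)
  have w'u: "dist (w' x\<^sub>0) (u x\<^sub>0) \<le> \<beta>"
    using \<beta>_inv[OF b] ui by (simp add: w'_def isom_dist dist_commute)
  have n1: "near (finv w' (w x\<^sub>0)) \<theta>" and n2: "near (finv w' (p (u x\<^sub>0))) \<theta>"
    and n3: "near (finv w' (finv p (u x\<^sub>0))) \<theta>"
    using near by (auto simp: fw' Q_def)
  define K' where "K' = max D\<^sub>0 (\<theta> + 4 * K + 9 * C)"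
  have K'0: "K' \<ge> 0" using constants by (simp add: K'_def)
  \<comment> \<open>If x projected within \<open>K\<close> of \<open>w x\<^sub>0\<close>, the
    geodesic to this projection would pass near \<open>u x\<^sub>0\<close>, whose own projection
    would then be close by. The assumed depth of \<open>u x\<^sub>0\<close> is \<open>K\<close> plus
    the resulting Lipschitz bound: \<open>17 * K = K + 4 * (4 * K)\<close>.\<close>
  have nested: "beyond w' K' \<subseteq> beyond w K"
  proof
    fix x assume x: "x \<in> beyond w' K'"
    then have fx: "far (finv w' x) K'" by (simp add: beyond_def)
    have "K < dist a x\<^sub>0" if a: "a \<in> pr (finv w x)" for a
    proof (rule ccontr)
      assume "\<not> ?thesis"
      then have aK: "dist x\<^sub>0 a \<le> K" by (simp add: dist_commute)
      have "dist (finv w' (w x\<^sub>0)) (finv w' (w a)) = dist x\<^sub>0 a"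
        by (simp add: isom_dist[OF fw'i] isom_dist[OF wi])
      then have "near (finv w' (w a)) (\<theta> + 4 * K + C)"
        using near_mono[OF near_move[OF n1, of "finv w' (w a)"]] aK by simp
      moreover obtain \<gamma> where g: "geodesic_path \<gamma> x (w a)"
        using proper_geodesic_space_path[OF proper_geodesic] by blast
      moreover have "K' \<ge> (\<theta> + 4 * K + C) + 8 * C" by (simp add: K'_def)
      ultimately obtain t where t: "0 \<le> t" "t \<le> dist x (w a)" "dist (finv w' (\<gamma> t)) x\<^sub>0 \<le> \<theta> + 4 * K + C + 10 * C"
        using barrier_hit[OF fw'i _ fx] by metis
      have tu: "dist (\<gamma> t) (u x\<^sub>0) \<le> \<theta> + 4 * K + 11 * C + \<beta>"
        using t(3) w'u dist_triangle[of "\<gamma> t" "u x\<^sub>0" "w' x\<^sub>0"] by (simp add: isom_dist_inv[OF w'i])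
      have "dist (finv w x) (finv w (\<gamma> t)) + dist (finv w (\<gamma> t)) a = dist (finv w x) a"
        using geodesic_path_dist_start[OF g, of t] geodesic_path_dist_end[OF g, of t] t
        by (simp add: isom_dist[OF isom_inv[OF wi]] isom_dist_inv[OF wi] wi)
      then have a': "a \<in> pr (finv w (\<gamma> t))" using pr_between[OF a] by blast
      obtain e where e: "e \<in> pr (finv w (u x\<^sub>0))" using pr_ex by blast
      have "dist a e \<le> 4 * (\<theta> + 4 * K + 11 * C + \<beta>) + C"
        using pr_lipschitz[OF a' e] tu by (simp add: isom_dist[OF isom_inv[OF wi]])
      moreover have "dist e x\<^sub>0 > 17 * K + 4 * (\<theta> + 11 * C + \<beta>) + C" 
        using u_far e by (simp add: beyond_def far_def)
      ultimately show False using aK dist_triangle3[of e x\<^sub>0 a] dist_commute[of x\<^sub>0 a] by argo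
    qed
    then show "x \<in> beyond w K" by (simp add: beyond_def far_def)
  qed
  have "far (finv w' y) D\<^sub>0 \<and> near (finv w' (p y)) r\<^sub>0" if y: "y \<in> beyond w' K'" for y
  proof
    have fy: "far (finv w' y) K'" using y by (simp add: beyond_def)
    then show "far (finv w' y) D\<^sub>0" by (rule far_mono) (simp add: K'_def)
    define M where "M = 10 * C + \<theta> + \<beta>"
    show "near (finv w' (p y)) r\<^sub>0"
      unfolding near_def
    proof (rule ballI, rule ccontr)
      fix a assume a: "a \<in> pr (finv w' (p y))" and "\<not> dist a x\<^sub>0 \<le> r\<^sub>0"
      then have ar: "dist a x\<^sub>0 > \<theta> + 8 * C" by (simp add: r\<^sub>0_def)
      obtain z where z: "z \<in> pr (finv w' (p (u x\<^sub>0)))" using pr_ex by blast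
      then have zx: "dist z x\<^sub>0 \<le> \<theta>" using n2 by (simp add: near_def)
      then have az: "dist a z > 8 * C" using ar dist_triangle[of a x\<^sub>0 z] by simp
      obtain \<gamma> where g: "geodesic_path \<gamma> (p y) (p (u x\<^sub>0))"
        using proper_geodesic_space_path[OF proper_geodesic] by blast
      obtain t where t: "0 \<le> t" "t \<le> dist (p y) (p (u x\<^sub>0))" "dist (finv w' (\<gamma> t)) z \<le> 10 * C"
        using geodesic_hits[OF geodesic_path_isometry[OF g isom_dist[OF fw'i]] a z az]
        unfolding isom_dist[OF fw'i] by metis
      have "dist (finv w' (\<gamma> t)) x\<^sub>0 \<le> 10 * C + \<theta>"
        using t(3) zx dist_triangle[of "finv w' (\<gamma> t)" x\<^sub>0 z] by simp
      then have 1: "dist (\<gamma> t) (u x\<^sub>0) \<le> M"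
        using w'u dist_triangle[of "\<gamma> t" "u x\<^sub>0" "w' x\<^sub>0"] by (simp add: isom_dist_inv[OF w'i] M_def)
      have "dist (p y) (p (u x\<^sub>0)) = dist (p y) (\<gamma> t) + dist (\<gamma> t) (p (u x\<^sub>0))"
        using geodesic_path_dist_start[OF g, of t] geodesic_path_dist_end[OF g, of t] t by simp
      then have A: "dist (p y) (p (u x\<^sub>0)) \<ge> dist (p y) (u x\<^sub>0) + dist (p (u x\<^sub>0)) (u x\<^sub>0) - 2 * M"
        using 1 dist_triangle[of "p y" "u x\<^sub>0" "\<gamma> t"] dist_triangle3[of "p (u x\<^sub>0)" "u x\<^sub>0" "\<gamma> t"] by linarith
      obtain \<delta> where d: "geodesic_path \<delta> (p y) (u x\<^sub>0)"
        using proper_geodesic_space_path[OF proper_geodesic] by blast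
      have \<xi>: "finv w' \<circ> finv p \<in> carrier isom_group" by (intro isom_comp fw'i isom_inv p)
      obtain s where s: "0 \<le> s" "s \<le> dist (p y) (u x\<^sub>0)" "dist ((finv w' \<circ> finv p) (\<delta> s)) x\<^sub>0 \<le> \<theta> + 10 * C"
      proof (rule barrier_hit[OF \<xi> _ _ _ d])
        show "near ((finv w' \<circ> finv p) (u x\<^sub>0)) \<theta>" using n3 by simp
        show "far ((finv w' \<circ> finv p) (p y)) K'" using fy p by simp
        show "\<theta> + 8 * C \<le> K'" using K C_ge_1 by (simp add: K'_def)
      qed (use that in auto)
      have "dist (\<delta> s) (p (w' x\<^sub>0)) \<le> \<theta> + 10 * C"
        using s(3) by (simp add: isom_dist_inv[OF w'i] isom_dist_inv[OF p])
      then have 2: "dist (\<delta> s) (p (u x\<^sub>0)) \<le> M"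
        using w'u dist_triangle[of "\<delta> s" "p (u x\<^sub>0)" "p (w' x\<^sub>0)"] by (simp add: isom_dist[OF p] M_def)
      have "dist (p y) (u x\<^sub>0) = dist (p y) (\<delta> s) + dist (\<delta> s) (u x\<^sub>0)"
        using geodesic_path_dist_start[OF d, of s] geodesic_path_dist_end[OF d, of s] s by simp
      then have B: "dist (p y) (u x\<^sub>0) \<ge> dist (p y) (p (u x\<^sub>0)) + dist (p (u x\<^sub>0)) (u x\<^sub>0) - 2 * M"
        using 2 dist_triangle[of "p y" "p (u x\<^sub>0)" "\<delta> s"] dist_triangle3[of "p (u x\<^sub>0)" "u x\<^sub>0" "\<delta> s"] by linarith
      show False using A B disp by (simp add: c\<^sub>0_def M_def)
    qed
  qed
  then have "moves p (beyond w' K')" using w'\<Gamma> by (auto simp: moves_def)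
  then show thesis using that w'\<Gamma> K'0 nested by blast
qed

text \<open>Both properties pass to subsets, so the elements can be treated one at a time while the
  half-space shrinks. An element that does not coarsely fix a deeper half-space displaces an orbit
  point in it, to which \<open>displaced_direction\<close> applies.\<close>

lemma move_or_fix:
  assumes "finite P'" "P' \<subseteq> carrier isom_group"
  shows "\<exists>w\<in>\<Gamma>. \<exists>K\<ge>0. \<forall>p\<in>P'. moves p (beyond w K) \<or> fixes_coarsely p (beyond w K)"
  using assms
proof (induction P' rule: finite_induct)
  case empty
  then show ?case using id_mem by auto
next
  case (insert p P')
  then obtain w K where w: "w \<in> \<Gamma>" "K \<ge> 0" 
    and IH: "\<And>p. p \<in> P' \<Longrightarrow> moves p (beyond w K) \<or> fixes_coarsely p (beyond w K)" by auto
  have p: "p \<in> carrier isom_group" using insert.prems by simp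
  define K2 where "K2 = 17 * K + 4 * (\<theta> + 11 * C + \<beta>) + C"
  \<comment> \<open>Selecting for the empty set of points shows that \<open>J\<close> is
    nonempty.\<close>
  have "0 \<le> \<beta>"
    using select[of "{}"] \<beta> by auto (meson order_trans zero_le_dist)
  then have K2: "K \<le> K2" using w \<theta>_nonneg C_ge_1 by (simp add: K2_def)
  show ?case
  proof (cases "fixes_coarsely p (beyond w K2)")
    case True
    then have "\<forall>q\<in>insert p P'. moves q (beyond w K2) \<or> fixes_coarsely q (beyond w K2)"
      using IH moves_mono fixes_coarsely_mono beyond_mono[OF K2] by blast
    moreover have "0 \<le> K2" using w K2 by simp
    ultimately show ?thesis using w by blast
  next
    case False
    then obtain u where u: "u \<in> \<Gamma>" "u x\<^sub>0 \<in> beyond w K2" "dist (p (u x\<^sub>0)) (u x\<^sub>0) > c\<^sub>0"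
      by (auto simp: fixes_coarsely_def)
    obtain w' K' where w': "w' \<in> \<Gamma>" "K' \<ge> 0" "beyond w' K' \<subseteq> beyond w K" "moves p (beyond w' K')"
      using displaced_direction[OF p w(1) u(1) w(2) u(2)[unfolded K2_def] u(3)] by blast
    then have "\<forall>q\<in>insert p P'. moves q (beyond w' K') \<or> fixes_coarsely q (beyond w' K')"
      using IH moves_mono fixes_coarsely_mono by blast
    then show ?thesis using w' by blast
  qed
qed

lemma near_beyond:
  assumes "near x \<theta>" "dist (fp N x\<^sub>0) x\<^sub>0 > K + \<theta>"
  shows "far (fp N x) K"
  unfolding far_def
proof
  fix a assume "a \<in> pr (fp N x)"
  from pr_fp'[OF this] have "dist (fp (-N) a) x\<^sub>0 \<le> \<theta>" using assms(1) by (simp add: near_def)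
  then have "dist a (fp N x\<^sub>0) \<le> \<theta>" using isom_dist[OF fp_isom, of N "fp (-N) a" x\<^sub>0] by simp
  then show "K < dist a x\<^sub>0" using assms(2) dist_triangle3[of "fp N x\<^sub>0" x\<^sub>0 a] by simp
qed

lemma fp_escapes:
  obtains N where "dist (fp N x\<^sub>0) x\<^sub>0 > B"
proof -
  obtain N where "N \<ge> 1" "\<And>m n. \<bar>m - n\<bar> \<ge> N \<Longrightarrow> dist (fp m x\<^sub>0) (fp n x\<^sub>0) > B" 
    using fp_unbounded by metis
  from this(2)[of N 0] this(1) show thesis using that[of N] by simp
qed

text \<open>An element of \<open>P\<close> that only moves points of a half-space by a bounded amount cannot occur for all
  of the translating elements \<open>v\<^sub>i\<close>: this would give more elements of \<open>H\<close> near the identity than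
  discreteness permits.\<close>

lemma conjugate_barrier:
  obtains S R where "finite S" "S \<subseteq> carrier isom_group"
    "\<And>g Q. g \<in> \<Gamma> \<Longrightarrow> finite Q \<Longrightarrow> card Q \<le> 3 \<Longrightarrow> \<exists>s\<in>S. \<exists>\<zeta>\<in>carrier isom_group.
       g \<circ> s \<circ> finv g \<in> H \<and> dist (\<zeta> x\<^sub>0) x\<^sub>0 \<le> R \<and> (\<forall>x\<in>Q. far (finv \<zeta> x) D\<^sub>0 \<and> near (finv \<zeta> (s x)) r\<^sub>0)"
proof -
  obtain w K where w: "w \<in> \<Gamma>" "K \<ge> 0" 
    and mf: "\<And>p. p \<in> P \<Longrightarrow> moves p (beyond w K) \<or> fixes_coarsely p (beyond w K)"
    using move_or_fix[OF P_finite P_isom] by blast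
  have wi: "w \<in> carrier isom_group" using w by simp
  obtain N where N: "dist (fp N x\<^sub>0) x\<^sub>0 > K + \<theta>" by (rule fp_escapes)
  \<comment> \<open>When b makes the points project near the base point, \<open>fp N\<close> pushes
    them along the axis and w carries them into \<open>beyond w K\<close>.\<close>
  define wb where "wb b = w \<circ> fp N \<circ> b" for b :: "'a \<Rightarrow> 'a"
  have wb: "wb b \<in> \<Gamma>" if "b \<in> J" for b using w J that by (auto simp: wb_def intro!: comp_mem)
  \<comment> \<open>A coincidence below will say that p commutes with the conjugate of
    \<open>v i \<circ> finv (v j)\<close> by \<open>wb b\<close>; hence the \<open>v i\<close> are
    separated with respect to these conjugates of \<open>P\<close>.\<close>
  define P' where "P' = (\<lambda>(b, p). finv (wb b) \<circ> p \<circ> wb b) ` (J \<times> P)"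
  have P': "finite P'" "P' \<subseteq> carrier isom_group"
    using J P_finite P_isom wb by (auto simp: P'_def intro!: isom_comp isom_inv)
  have unb: "\<exists>u\<in>\<Gamma>. dist (q (u x\<^sub>0)) (u x\<^sub>0) > B" if "q \<in> P'" for q B
  proof -
    obtain b p where bp: "b \<in> J" "p \<in> P" "q = finv (wb b) \<circ> p \<circ> wb b" using \<open>q \<in> P'\<close> by (auto simp: P'_def)
    have wbi: "wb b \<in> carrier isom_group" using wb bp by simp
    obtain u where u: "u \<in> \<Gamma>" "dist (p (u x\<^sub>0)) (u x\<^sub>0) > B" using P_unbounded bp by blast
    have "dist (q ((finv (wb b) \<circ> u) x\<^sub>0)) ((finv (wb b) \<circ> u) x\<^sub>0) = dist (p (u x\<^sub>0)) (u x\<^sub>0)"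
      using wbi by (simp add: bp(3) isom_dist[OF isom_inv[OF wbi]])
    moreover have "finv (wb b) \<circ> u \<in> \<Gamma>" using wb bp u by (intro comp_mem inv_mem)
    ultimately show ?thesis using u by metis
  qed
  define F where "F = {h\<in>H. dist x\<^sub>0 (h x\<^sub>0) \<le> c\<^sub>0}"
  have fin: "finite (J \<times> P \<times> F)" using J P_finite finite_ball_H by (simp add: F_def)
  \<comment> \<open>One more than the number of triples \<open>(b, p, h)\<close> with h a short
    element of \<open>H\<close>, for the pigeonhole principle.\<close>
  define M where "M = card (J \<times> P \<times> F) + 1"
  obtain v :: "nat \<Rightarrow> 'a \<Rightarrow> 'a" where v: "\<And>i. i < M \<Longrightarrow> v i \<in> \<Gamma>"
    and v_sep: "\<And>i j p. \<lbrakk>i < M; j < i; p \<in> P'\<rbrakk> \<Longrightarrow> p \<circ> (v i \<circ> finv (v j)) \<noteq> (v i \<circ> finv (v j)) \<circ> p"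
    using separated_elements[OF P' unb, of M] by blast
  define T where "T = (\<lambda>(b, i). wb b \<circ> v i) ` (J \<times> {..<M})"
  have T: "finite T" "T \<subseteq> \<Gamma>" using J wb v by (auto simp: T_def intro!: comp_mem)
  define S where "S = (\<lambda>(t, p). finv t \<circ> p \<circ> t) ` (T \<times> P)"
  have S: "finite S" "S \<subseteq> carrier isom_group"
    using T P_finite P_isom by (auto simp: S_def intro!: isom_comp isom_inv)
  have "\<forall>p\<in>{p. moves p (beyond w K)}. \<exists>z. z \<in> \<Gamma> \<and> (\<forall>x\<in>beyond w K. far (finv z x) D\<^sub>0 \<and> near (finv z (p x)) r\<^sub>0)"
    by (auto simp: moves_def)
  from bchoice[OF this] obtain w' where w': "\<And>p. moves p (beyond w K) \<Longrightarrow> w' p \<in> \<Gamma>"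
     "\<And>p x. moves p (beyond w K) \<Longrightarrow> x \<in> beyond w K \<Longrightarrow> far (finv (w' p) x) D\<^sub>0 \<and> near (finv (w' p) (p x)) r\<^sub>0"
    by blast
  define R where "R = Max ((\<lambda>(t, p). dist (finv t (w' p x\<^sub>0)) x\<^sub>0) ` (T \<times> P))"
  have "\<exists>s\<in>S. \<exists>\<zeta>\<in>carrier isom_group. g \<circ> s \<circ> finv g \<in> H \<and> dist (\<zeta> x\<^sub>0) x\<^sub>0 \<le> R \<and>
      (\<forall>x\<in>Q. far (finv \<zeta> x) D\<^sub>0 \<and> near (finv \<zeta> (s x)) r\<^sub>0)"
    if g: "g \<in> \<Gamma>" and Q: "finite Q" "card Q \<le> 3" for g Q
  proof -
    have gi: "g \<in> carrier isom_group" using g by simp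
    \<comment> \<open>The added point puts \<open>u i x\<^sub>0\<close> into
      \<open>beyond w K\<close>, as \<open>fixes_coarsely\<close> requires.\<close>
    define Q' where "Q' = insert (finv g x\<^sub>0) Q"
    have Q': "finite Q'" "card Q' \<le> 4" using Q by (auto simp: Q'_def card_insert_if)
    have "\<exists>b\<in>J. \<forall>x\<in>Q'. near (b (v i x)) \<theta>" for i
      using select[of "v i ` Q'"] Q' card_image_le[OF Q'(1), of "v i"] by auto
    then obtain b where b: "\<And>i. b i \<in> J" "\<And>i x. x \<in> Q' \<Longrightarrow> near (b i (v i x)) \<theta>" by metis
    define t where "t i = wb (b i) \<circ> v i" for i
    have t: "t i \<in> T" "t i \<in> \<Gamma>" if "i < M" for i using that b(1) T by (auto simp: t_def T_def)
    have t_beyond: "t i x \<in> beyond w K" if "x \<in> Q'" for i x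
      using near_beyond[OF b(2)[OF that] N] wi by (simp add: beyond_def t_def wb_def)
    define u where "u i = t i \<circ> finv g" for i
    have u: "u i \<in> \<Gamma>" if "i < M" for i using t that g by (simp add: u_def comp_mem inv_mem)
    have "\<exists>p. i < M \<longrightarrow> p \<in> P \<and> finv (u i) \<circ> p \<circ> u i \<in> H" for i
      using confined[OF u] by blast
    then obtain p where p: "\<And>i. i < M \<Longrightarrow> p i \<in> P" "\<And>i. i < M \<Longrightarrow> finv (u i) \<circ> p i \<circ> u i \<in> H" by metis
    show ?thesis
    proof (cases "\<exists>i<M. moves (p i) (beyond w K)")
      case True
      then obtain i where i: "i < M" and m: "moves (p i) (beyond w K)" by blast
      have ti: "t i \<in> carrier isom_group" using t i by simp
      have w'i: "w' (p i) \<in> carrier isom_group" using w'(1)[OF m] by simp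
      have pi: "p i \<in> carrier isom_group" using p(1)[OF i] P_isom by blast
      define s where "s = finv (t i) \<circ> p i \<circ> t i"
      define \<zeta> where "\<zeta> = finv (t i) \<circ> w' (p i)"
      have sS: "s \<in> S" using t(1)[OF i] p(1)[OF i] by (auto simp: s_def S_def)
      have \<zeta>: "\<zeta> \<in> carrier isom_group" unfolding \<zeta>_def by (intro isom_comp isom_inv ti w'i)
      have fu: "finv (u i) = g \<circ> finv (t i)"
        unfolding u_def by (simp add: isom_inv_comp isom_inv isom_inv_inv ti gi)
      have "g \<circ> s \<circ> finv g = finv (u i) \<circ> p i \<circ> u i"
        by (simp only: s_def fu) (simp add: u_def o_assoc)
      then have "g \<circ> s \<circ> finv g \<in> H" using p(2)[OF i] by simp
      moreover have "dist (\<zeta> x\<^sub>0) x\<^sub>0 \<le> R"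
        unfolding R_def using T P_finite t(1)[OF i] p(1)[OF i] by (intro Max_ge) (auto simp: \<zeta>_def)
      moreover have "far (finv \<zeta> x) D\<^sub>0 \<and> near (finv \<zeta> (s x)) r\<^sub>0" if "x \<in> Q" for x
      proof -
        have fz: "finv \<zeta> = finv (w' (p i)) \<circ> t i"
          by (simp add: \<zeta>_def isom_inv_comp isom_inv isom_inv_inv ti w'i)
        have "t i x \<in> beyond w K" using t_beyond that by (simp add: Q'_def)
        from w'(2)[OF m this] show ?thesis using ti by (simp add: fz s_def)
      qed
      ultimately show ?thesis using sS \<zeta> by blast
    next
      case False
      define h where "h i = finv (u i) \<circ> p i \<circ> u i" for i
      have hF: "h i \<in> F" if i: "i < M" for i
      proof -
        have "fixes_coarsely (p i) (beyond w K)" using mf p(1) False i by blast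
        moreover have "u i x\<^sub>0 \<in> beyond w K" using t_beyond by (simp add: u_def Q'_def)
        ultimately have "dist (p i (u i x\<^sub>0)) (u i x\<^sub>0) \<le> c\<^sub>0" using u[OF i] by (simp add: fixes_coarsely_def)
        then have "dist x\<^sub>0 (h i x\<^sub>0) \<le> c\<^sub>0" 
          using u[OF i] by (simp add: h_def isom_dist_inv' dist_commute)
        then show ?thesis using p(2)[OF i] by (simp add: F_def h_def)
      qed
      have "(\<lambda>i. (b i, p i, h i)) ` {..<M} \<subseteq> J \<times> P \<times> F" using b p hF by auto
      then have "card ((\<lambda>i. (b i, p i, h i)) ` {..<M}) < card {..<M}"
        using card_mono[OF fin] by (simp add: M_def le_imp_less_Suc)
      \<comment> \<open>Equal p and h make \<open>u i \<circ> finv (u j)\<close> commute with p;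
        equal b translates this to \<open>v i \<circ> finv (v j)\<close> and a conjugate of
        p.\<close>
      from pigeonhole[OF this] obtain i j where ij: "i < M" "j < i" "b i = b j" "p i = p j" "h i = h j"
        unfolding inj_on_def by (metis (no_types, lifting) lessThan_iff linorder_neqE_nat prod.inject)
      have jM: "j < M" using ij by simp
      have ui: "u i \<in> carrier isom_group" "u j \<in> carrier isom_group" using u ij jM by auto
      have wbi: "wb (b j) \<in> carrier isom_group" using wb b(1) by simp
      have vj: "v j \<in> carrier isom_group" using v jM by simp
      have fuj: "finv (u j) = g \<circ> finv (v j) \<circ> finv (wb (b j))"
        unfolding u_def t_def by (simp add: isom_inv_comp isom_comp isom_inv isom_inv_inv vj wbi gi o_assoc)
      define q where "q = finv (wb (b j)) \<circ> p j \<circ> wb (b j)"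
      have "q \<in> P'" using b(1) p(1)[OF jM] by (auto simp: q_def P'_def)
      have uu: "u i (finv (u j) x) = wb (b j) (v i (finv (v j) (finv (wb (b j)) x)))" for x
        using gi ij(3) by (simp add: fuj) (simp add: u_def t_def)
      have comm: "p j (u i (finv (u j) x)) = u i (finv (u j) (p j x))" for x
      proof -
        have "finv (u i) (p j (u i (finv (u j) x))) = finv (u j) (p j (u j (finv (u j) x)))"
          using fun_cong[OF ij(5), of "finv (u j) x"] ij(4) by (simp add: h_def)
        then have "u i (finv (u i) (p j (u i (finv (u j) x)))) = u i (finv (u j) (p j x))" using ui by simp
        then show ?thesis using ui by simp
      qed
      have "q \<circ> (v i \<circ> finv (v j)) = (v i \<circ> finv (v j)) \<circ> q"
      proof
        fix x
        have "p j (wb (b j) (v i (finv (v j) x))) = wb (b j) (v i (finv (v j) (finv (wb (b j)) (p j (wb (b j) x)))))"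
          using comm[of "wb (b j) x"] wbi by (simp add: uu)
        then show "(q \<circ> (v i \<circ> finv (v j))) x = ((v i \<circ> finv (v j)) \<circ> q) x" using wbi by (simp add: q_def)
      qed
      then show ?thesis using v_sep[OF ij(1,2) \<open>q \<in> P'\<close>] by blast
    qed
  qed
  then show thesis using that S by blast
qed

text \<open>The connector is a conjugate by \<open>finv b \<circ> fp N\<close>, so that the geodesic
  from \<open>b x\<close> to \<open>b (\<tau> y)\<close> passes near the distant point
  \<open>fp N x\<^sub>0\<close> of the axis. If both ends projected near \<open>x\<^sub>0\<close>,
  it would also pass near \<open>x\<^sub>0\<close> before and after, which a geodesic cannot
  do.\<close>

lemma H_barrier:
  assumes D: "D \<ge> 0"
  obtains T where "finite T" "T \<subseteq> H" 
    "\<And>x y. \<exists>\<tau>\<in>T. \<exists>b\<in>J. near (b x) \<theta> \<and> far (b (\<tau> y)) D"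
proof -
  obtain S R where S: "finite S" "S \<subseteq> carrier isom_group" and
    SR: "\<And>g Q. g \<in> \<Gamma> \<Longrightarrow> finite Q \<Longrightarrow> card Q \<le> 3 \<Longrightarrow> \<exists>s\<in>S. \<exists>\<zeta>\<in>carrier isom_group.
       g \<circ> s \<circ> finv g \<in> H \<and> dist (\<zeta> x\<^sub>0) x\<^sub>0 \<le> R \<and> (\<forall>x\<in>Q. far (finv \<zeta> x) D\<^sub>0 \<and> near (finv \<zeta> (s x)) r\<^sub>0)"
    by (rule conjugate_barrier) blast
  define \<kappa> where "\<kappa> = r\<^sub>0 + 10 * C + \<bar>R\<bar>"
  have \<kappa>0: "\<kappa> \<ge> 0" using constants C_ge_1 by (simp add: \<kappa>_def)
  obtain N where N: "dist (fp N x\<^sub>0) x\<^sub>0 > 5 * \<kappa> + 40 * C + 2 * \<theta> + D" by (rule fp_escapes)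
  define T where "T = (\<lambda>(b, s). finv b \<circ> fp N \<circ> s \<circ> finv (finv b \<circ> fp N)) ` (J \<times> S) \<inter> H"
  have "\<exists>\<tau>\<in>T. \<exists>b\<in>J. near (b x) \<theta> \<and> far (b (\<tau> y)) D" for x y
  proof -
    have "finite {x, y}" "card {x, y} \<le> 4" by (auto simp: card_insert_if)
    from select[OF this] obtain b where b: "b \<in> J" "near (b x) \<theta>" "near (b y) \<theta>" by blast
    have b\<Gamma>: "b \<in> \<Gamma>" using b J by auto
    have bi: "b \<in> carrier isom_group" using b\<Gamma> by simp
    define g where "g = finv b \<circ> fp N"
    have g\<Gamma>: "g \<in> \<Gamma>" using b\<Gamma> by (simp add: g_def comp_mem inv_mem)
    have fg: "finv g z = fp (-N) (b z)" for z
      using bi by (simp add: g_def isom_inv_comp isom_inv isom_inv_inv fp_inv)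
    define x' y' where "x' = fp (-N) (b x)" and "y' = fp (-N) (b y)"
    have "finite {x', y'}" "card {x', y'} \<le> 3" by (auto simp: card_insert_if)
    from SR[OF g\<Gamma> this] obtain s \<zeta> where s: "s \<in> S" "g \<circ> s \<circ> finv g \<in> H" 
      and \<zeta>: "\<zeta> \<in> carrier isom_group" "dist (\<zeta> x\<^sub>0) x\<^sub>0 \<le> R" "far (finv \<zeta> x') D\<^sub>0" "near (finv \<zeta> (s y')) r\<^sub>0"
      by blast
    define \<tau> where "\<tau> = g \<circ> s \<circ> finv g"
    have \<tau>: "\<tau> \<in> T" using s b unfolding T_def \<tau>_def g_def
      by (intro IntI image_eqI[of _ _ "(b, s)"]) auto
    have b\<tau>: "b (\<tau> y) = fp N (s y')" using bi by (simp add: \<tau>_def fg y'_def) (simp add: g_def)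
    obtain \<gamma> where \<gamma>: "geodesic_path \<gamma> x' (s y')"
      using proper_geodesic_space_path[OF proper_geodesic] by blast
    obtain t where t: "0 \<le> t" "t \<le> dist x' (s y')" "dist (finv \<zeta> (\<gamma> t)) x\<^sub>0 \<le> r\<^sub>0 + 10 * C"
      using barrier_hit[OF isom_inv[OF \<zeta>(1)] \<zeta>(4,3) constants(3) \<gamma>] .
    define q where "q = \<gamma> t"
    have q: "dist q x\<^sub>0 \<le> \<kappa>"
      using t(3) \<zeta>(2) dist_triangle[of q x\<^sub>0 "\<zeta> x\<^sub>0"] by (simp add: isom_dist_inv[OF \<zeta>(1)] q_def \<kappa>_def)
    define e where "e = fp (-N) x\<^sub>0"
    have ex: "dist x\<^sub>0 e > 5 * \<kappa> + 40 * C + 2 * \<theta> + D"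
      using N isom_dist[OF fp_isom, of N x\<^sub>0 e] by (simp add: e_def)
    have "far (b (\<tau> y)) D"
      unfolding far_def
    proof (rule ballI, rule ccontr)
      fix a assume a: "a \<in> pr (b (\<tau> y))" and n: "\<not> D < dist a x\<^sub>0"
      define a1 where "a1 = fp (-N) a"
      have a1: "a1 \<in> pr (s y')" using pr_fp'[of a N] a by (simp add: b\<tau> a1_def)
      have a1e: "dist a1 e \<le> D" using n by (simp add: a1_def e_def isom_dist)
      obtain ax where ax: "ax \<in> pr x'" using pr_ex by blast
      have axe: "dist ax e \<le> \<theta>"
      proof -
        have "fp N ax \<in> pr (b x)" using pr_fp[OF ax, of N] by (simp add: x'_def)
        then have "dist (fp N ax) x\<^sub>0 \<le> \<theta>" using b(2) by (simp add: near_def)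
        then show ?thesis using isom_dist[OF fp_isom, of N ax e] by (simp add: e_def)
      qed
      obtain aq where aq: "aq \<in> pr q" using pr_ex by blast
      have aqx: "dist aq x\<^sub>0 \<le> 4 * \<kappa> + C"
      proof -
        have "near q (0 + 4 * dist x\<^sub>0 q + C)" by (rule near_move[OF near_x0])
        then show ?thesis using aq q by (force simp: near_def dist_commute)
      qed
      have \<gamma>0: "\<gamma> 0 = x'" "\<gamma> (dist x' (s y')) = s y'" using \<gamma> by (auto simp: geodesic_path_def)
      have sub1: "geodesic_path (\<lambda>u. \<gamma> (0 + u)) x' q"
        using geodesic_path_sub[OF \<gamma>, of 0 t] t by (simp add: q_def \<gamma>0)
      have sub2: "geodesic_path (\<lambda>u. \<gamma> (t + u)) q (s y')"
        using geodesic_path_sub[OF \<gamma>, of t "dist x' (s y')"] t by (simp add: q_def \<gamma>0)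
      have d1: "dist x' q = t" using geodesic_path_dist_start[OF \<gamma> t(1,2)] by (simp add: q_def)
      have d2: "dist q (s y') = dist x' (s y') - t" using geodesic_path_dist_end[OF \<gamma> t(1,2)] by (simp add: q_def)
      have "dist x\<^sub>0 e \<le> dist ax e + dist ax aq + dist aq x\<^sub>0" by metric
      then have "dist ax aq > 8 * C" using ex axe aqx \<kappa>0 D \<theta>_nonneg C_ge_1 by argo
      from geodesic_hits_start[OF sub1 ax aq this] obtain t1 
        where t1: "0 \<le> t1" "t1 \<le> t" "dist (\<gamma> t1) ax \<le> 10 * C" using d1 by auto
      have "dist x\<^sub>0 e \<le> dist a1 e + dist aq a1 + dist aq x\<^sub>0" by metric
      then have "dist aq a1 > 8 * C" using ex a1e aqx \<kappa>0 D \<theta>_nonneg C_ge_1 by argo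
      from geodesic_hits[OF sub2 aq a1 this] obtain t2
        where t2: "0 \<le> t2" "t2 \<le> dist x' (s y') - t" "dist (\<gamma> (t + t2)) a1 \<le> 10 * C" using d2 by auto
      have "dist (\<gamma> t1) (\<gamma> (t + t2)) = t + t2 - t1" "dist (\<gamma> t1) q = t - t1"
        using geodesic_path_dist[OF \<gamma>, of t1 "t + t2"] geodesic_path_dist[OF \<gamma>, of t1 t] t t1 t2 by (auto simp: q_def)
      then have "dist (\<gamma> t1) q \<le> dist (\<gamma> t1) (\<gamma> (t + t2))" using t2 by simp
      moreover have "dist (\<gamma> t1) (\<gamma> (t + t2)) \<le> dist (\<gamma> t1) ax + dist ax e + dist a1 e + dist (\<gamma> (t + t2)) a1" by metric
      moreover have "dist x\<^sub>0 e \<le> dist q x\<^sub>0 + dist (\<gamma> t1) q + dist (\<gamma> t1) ax + dist ax e" by metric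
      ultimately show False using ex axe a1e t1(3) t2(3) q \<kappa>0 D \<theta>_nonneg C_ge_1 by argo
    qed
    then show ?thesis using \<tau> b by blast
  qed
  moreover have "finite T" "T \<subseteq> H" using J S by (auto simp: T_def)
  ultimately show thesis using that by blast
qed

text \<open>The path to the new endpoint passes near \<open>g x\<^sub>0\<close> and near
  \<open>g s g\<^sup>-\<^sup>1 x\<^sub>0\<close>. The former is recorded as a barrier \<zeta>,
  because a barrier, unlike mere closeness, can be transferred to other endpoints by
  \<open>barrier_before_endpoint\<close>.\<close>

lemma combination:
  obtains S T \<kappa> where "finite S" "S \<subseteq> carrier isom_group" "finite T" "T \<subseteq> H" "\<kappa> > 0"
    "\<And>g \<eta>. g \<in> \<Gamma> \<Longrightarrow> \<kappa> \<le> dist x\<^sub>0 (g x\<^sub>0) \<Longrightarrow> \<eta> \<in> H \<Longrightarrow> \<exists>s\<in>S. \<exists>\<tau>\<in>T. g \<circ> s \<circ> finv g \<in> H \<and>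
       2 * dist x\<^sub>0 (g x\<^sub>0) - \<kappa> \<le> dist x\<^sub>0 (g (s (finv g x\<^sub>0))) \<and>
       (\<exists>\<zeta>\<in>carrier isom_group. dist (\<zeta> x\<^sub>0) (g x\<^sub>0) \<le> \<kappa> \<and> far (finv \<zeta> x\<^sub>0) D\<^sub>0 \<and>
          near (finv \<zeta> (g (s (finv g (\<tau> (\<eta> x\<^sub>0)))))) r\<^sub>0) \<and>
       (\<forall>\<gamma>. geodesic_path \<gamma> x\<^sub>0 (g (s (finv g (\<tau> (\<eta> x\<^sub>0))))) \<longrightarrow>
          (\<exists>t\<in>{0..dist x\<^sub>0 (g (s (finv g (\<tau> (\<eta> x\<^sub>0)))))}. dist (\<gamma> t) (g (s (finv g x\<^sub>0))) \<le> \<kappa>))"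
proof -
  obtain S R where S: "finite S" "S \<subseteq> carrier isom_group" and
    SR: "\<And>g Q. g \<in> \<Gamma> \<Longrightarrow> finite Q \<Longrightarrow> card Q \<le> 3 \<Longrightarrow> \<exists>s\<in>S. \<exists>\<zeta>\<in>carrier isom_group.
       g \<circ> s \<circ> finv g \<in> H \<and> dist (\<zeta> x\<^sub>0) x\<^sub>0 \<le> R \<and> (\<forall>x\<in>Q. far (finv \<zeta> x) D\<^sub>0 \<and> near (finv \<zeta> (s x)) r\<^sub>0)"
    by (rule conjugate_barrier) blast
  have \<beta>0: "0 \<le> \<beta>"
    using select[of "{}"] \<beta> by auto (meson order_trans zero_le_dist)
  define \<kappa>1 where "\<kappa>1 = r\<^sub>0 + 10 * C + \<bar>R\<bar>"
  define \<sigma> where "\<sigma> = (\<Sum>s\<in>S. dist x\<^sub>0 (s x\<^sub>0))"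
  have \<sigma>: "dist x\<^sub>0 (s x\<^sub>0) \<le> \<sigma>" if "s \<in> S" for s
    unfolding \<sigma>_def using S that by (intro member_le_sum) auto
  have \<sigma>0: "0 \<le> \<sigma>" unfolding \<sigma>_def by (intro sum_nonneg) auto
  have \<kappa>10: "\<kappa>1 \<ge> 0" using constants C_ge_1 by (simp add: \<kappa>1_def)
  define \<kappa>2 where "\<kappa>2 = \<kappa>1 + \<sigma>"
  define \<theta>3 where "\<theta>3 = \<theta> + 4 * \<kappa>2 + 9 * C"
  have \<theta>30: "\<theta>3 \<ge> 0" using \<theta>_nonneg \<kappa>10 \<sigma>0 C_ge_1 by (simp add: \<theta>3_def \<kappa>2_def)
  have "\<theta>3 + 8 * C \<ge> 0" using \<theta>30 C_ge_1 by simp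
  from H_barrier[OF this] obtain T where T: "finite T" "T \<subseteq> H" and
    TD: "\<And>x y. \<exists>\<tau>\<in>T. \<exists>b\<in>J. near (b x) \<theta> \<and> far (b (\<tau> y)) (\<theta>3 + 8 * C)" by metis
  define \<kappa> where "\<kappa> = 2 * \<kappa>1 + \<sigma> + \<bar>R\<bar> + (\<theta>3 + 10 * C + \<beta>) + (\<kappa>2 + \<theta> + 4 * \<kappa>2 + 11 * C + \<beta>) + 1"
  have \<kappa>pos: "\<kappa> > 0" using \<theta>_nonneg \<kappa>10 \<sigma>0 C_ge_1 \<theta>30 \<beta>0 by (simp add: \<kappa>_def \<kappa>2_def)
  have \<kappa>R: "R \<le> \<kappa>" and \<kappa>3: "\<theta>3 + 10 * C + \<beta> \<le> \<kappa>" and \<kappa>4: "\<kappa>2 + \<theta> + 4 * \<kappa>2 + 11 * C + \<beta> < \<kappa>"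
    and \<kappa>5: "2 * \<kappa>1 + \<sigma> \<le> \<kappa>"
    using \<theta>_nonneg \<kappa>10 \<sigma>0 C_ge_1 \<theta>30 \<beta>0 by (simp_all add: \<kappa>_def \<kappa>2_def)
  have main: "\<exists>s\<in>S. \<exists>\<tau>\<in>T. g \<circ> s \<circ> finv g \<in> H \<and>
       2 * dist x\<^sub>0 (g x\<^sub>0) - \<kappa> \<le> dist x\<^sub>0 (g (s (finv g x\<^sub>0))) \<and>
       (\<exists>\<zeta>\<in>carrier isom_group. dist (\<zeta> x\<^sub>0) (g x\<^sub>0) \<le> \<kappa> \<and> far (finv \<zeta> x\<^sub>0) D\<^sub>0 \<and>
          near (finv \<zeta> (g (s (finv g (\<tau> (\<eta> x\<^sub>0)))))) r\<^sub>0) \<and>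
       (\<forall>\<gamma>. geodesic_path \<gamma> x\<^sub>0 (g (s (finv g (\<tau> (\<eta> x\<^sub>0))))) \<longrightarrow>
          (\<exists>t\<in>{0..dist x\<^sub>0 (g (s (finv g (\<tau> (\<eta> x\<^sub>0)))))}. dist (\<gamma> t) (g (s (finv g x\<^sub>0))) \<le> \<kappa>))"
    if g: "g \<in> \<Gamma>" and long: "\<kappa> \<le> dist x\<^sub>0 (g x\<^sub>0)" for g \<eta>
  proof -
    have gi: "g \<in> carrier isom_group" using g by simp
    \<comment> \<open>\<tau> must be chosen before s, which depends on y. So it is adapted to
      \<open>g x\<^sub>0\<close>, and the projection of \<open>y2\<close>, which involves s, is
      controlled afterwards by \<open>near_y2\<close>.\<close>
    obtain \<tau> b where \<tau>: "\<tau> \<in> T" "b \<in> J" "near (b (g x\<^sub>0)) \<theta>" "far (b (\<tau> (\<eta> x\<^sub>0))) (\<theta>3 + 8 * C)"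
      using TD by blast
    have bi: "b \<in> carrier isom_group" using \<tau> J by auto
    define y where "y = \<tau> (\<eta> x\<^sub>0)"
    have "finite {finv g x\<^sub>0, finv g y}" "card {finv g x\<^sub>0, finv g y} \<le> 3" by (auto simp: card_insert_if)
    from SR[OF g this] obtain s \<zeta> where s: "s \<in> S" "g \<circ> s \<circ> finv g \<in> H" and
      \<zeta>: "\<zeta> \<in> carrier isom_group" "dist (\<zeta> x\<^sub>0) x\<^sub>0 \<le> R"
        "far (finv \<zeta> (finv g x\<^sub>0)) D\<^sub>0" "near (finv \<zeta> (s (finv g x\<^sub>0))) r\<^sub>0" "near (finv \<zeta> (s (finv g y))) r\<^sub>0"
      by auto
    have si: "s \<in> carrier isom_group" using s S by auto
    have f\<zeta>: "finv \<zeta> \<in> carrier isom_group" by (rule isom_inv[OF \<zeta>(1)])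
    have close: "dist p x\<^sub>0 \<le> \<kappa>1" if "dist (finv \<zeta> p) x\<^sub>0 \<le> r\<^sub>0 + 10 * C" for p
      using that \<zeta>(2) dist_triangle[of p x\<^sub>0 "\<zeta> x\<^sub>0"] by (simp add: isom_dist_inv[OF \<zeta>(1)] \<kappa>1_def)
    have len_inv: "dist x\<^sub>0 (finv g x\<^sub>0) = dist x\<^sub>0 (g x\<^sub>0)" by (simp add: isom_dist_inv'[OF gi] dist_commute)
    have c1: "2 * dist x\<^sub>0 (g x\<^sub>0) - \<kappa> \<le> dist x\<^sub>0 (g (s (finv g x\<^sub>0)))"
    proof -
      define p where "p = finv g x\<^sub>0"
      obtain \<gamma> where \<gamma>: "geodesic_path \<gamma> p (s p)"
        using proper_geodesic_space_path[OF proper_geodesic] by blast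
      obtain t where t: "0 \<le> t" "t \<le> dist p (s p)" "dist (finv \<zeta> (\<gamma> t)) x\<^sub>0 \<le> r\<^sub>0 + 10 * C"
        using barrier_hit[OF f\<zeta> \<zeta>(4)[folded p_def] \<zeta>(3)[folded p_def] constants(3) \<gamma>] .
      have "dist p (s p) = dist p (\<gamma> t) + dist (\<gamma> t) (s p)"
        using geodesic_path_dist_start[OF \<gamma> t(1,2)] geodesic_path_dist_end[OF \<gamma> t(1,2)] by simp
      moreover have "dist (s x\<^sub>0) (s p) = dist x\<^sub>0 p" by (rule isom_dist[OF si])
      moreover have "dist (s x\<^sub>0) (s p) \<le> dist x\<^sub>0 (s x\<^sub>0) + dist (\<gamma> t) x\<^sub>0 + dist (\<gamma> t) (s p)" by metric
      moreover have "dist x\<^sub>0 p \<le> dist p (\<gamma> t) + dist (\<gamma> t) x\<^sub>0" by metric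
      ultimately have "2 * dist x\<^sub>0 p - (2 * \<kappa>1 + \<sigma>) \<le> dist p (s p)"
        using close[OF t(3)] \<sigma>[OF s(1)] by argo
      moreover have "dist p (s p) = dist x\<^sub>0 (g (s p))" by (simp add: p_def isom_dist_inv[OF gi])
      ultimately show ?thesis using \<kappa>5 len_inv by (simp add: p_def)
    qed
    have c2: "\<exists>\<zeta>\<in>carrier isom_group. dist (\<zeta> x\<^sub>0) (g x\<^sub>0) \<le> \<kappa> \<and> far (finv \<zeta> x\<^sub>0) D\<^sub>0 \<and> near (finv \<zeta> (g (s (finv g y)))) r\<^sub>0"
    proof (intro bexI[of _ "g \<circ> \<zeta>"] conjI)
      have "finv (g \<circ> \<zeta>) z = finv \<zeta> (finv g z)" for z by (simp add: isom_inv_comp[OF gi \<zeta>(1)])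
      then show "far (finv (g \<circ> \<zeta>) x\<^sub>0) D\<^sub>0" "near (finv (g \<circ> \<zeta>) (g (s (finv g y)))) r\<^sub>0"
        using \<zeta> gi by simp_all
      show "dist ((g \<circ> \<zeta>) x\<^sub>0) (g x\<^sub>0) \<le> \<kappa>" using \<zeta>(2) \<kappa>R by (simp add: isom_dist[OF gi])
      show "g \<circ> \<zeta> \<in> carrier isom_group" by (rule isom_comp[OF gi \<zeta>(1)])
    qed
    define y2 where "y2 = g (finv s (finv g x\<^sub>0))"
    \<comment> \<open>The geodesic from \<open>x\<^sub>0\<close> to \<open>y2\<close> passes near
      \<open>g x\<^sub>0\<close>, whose projection is under control. A large projection of
      \<open>y2\<close> would force the remaining part back towards \<open>x\<^sub>0\<close>, which
      is impossible since g is long.\<close>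
    have near_y2: "near (b y2) \<theta>3"
      unfolding near_def
    proof (rule ballI, rule ccontr)
      fix a assume a: "a \<in> pr (b y2)" and "\<not> dist a x\<^sub>0 \<le> \<theta>3"
      then have a_far: "dist a x\<^sub>0 > \<theta> + 4 * \<kappa>2 + 9 * C" by (simp add: \<theta>3_def)
      obtain \<gamma> where \<gamma>: "geodesic_path \<gamma> x\<^sub>0 y2"
        using proper_geodesic_space_path[OF proper_geodesic] by blast
      define h where "h = s \<circ> finv g"
      have hi: "h \<in> carrier isom_group" unfolding h_def by (intro isom_comp isom_inv si gi)
      have hy2: "h y2 = finv g x\<^sub>0" using gi si by (simp add: h_def y2_def)
      have \<gamma>h: "geodesic_path (\<lambda>t. h (\<gamma> t)) (h x\<^sub>0) (finv g x\<^sub>0)"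
        using geodesic_path_isometry[OF \<gamma> isom_dist[OF hi]] hy2 by simp
      obtain t where t: "0 \<le> t" "t \<le> dist x\<^sub>0 y2" "dist (finv \<zeta> (h (\<gamma> t))) x\<^sub>0 \<le> r\<^sub>0 + 10 * C"
      proof (rule barrier_hit'[OF f\<zeta> _ \<zeta>(3) constants(3) \<gamma>h])
        show "near (finv \<zeta> (h x\<^sub>0)) r\<^sub>0" using \<zeta>(4) by (simp add: h_def)
      qed (use that hy2 isom_dist[OF hi, of x\<^sub>0 y2] in auto)
      define q where "q = \<gamma> t"
      have "dist (h q) (s x\<^sub>0) \<le> \<kappa>2"
        using close[OF t(3)] \<sigma>[OF s(1)] dist_triangle[of "h q" "s x\<^sub>0" x\<^sub>0] by (simp add: q_def \<kappa>2_def)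
      then have q: "dist q (g x\<^sub>0) \<le> \<kappa>2" by (simp add: h_def isom_dist[OF si] isom_dist_inv[OF gi])
      obtain e where e: "e \<in> pr (b q)" using pr_ex by blast
      have "near (b q) (\<theta> + 4 * dist (b (g x\<^sub>0)) (b q) + C)" by (rule near_move[OF \<tau>(3)])
      then have ex: "dist e x\<^sub>0 \<le> \<theta> + 4 * \<kappa>2 + C"
        using e q by (force simp: near_def isom_dist[OF bi] dist_commute)
      have "dist e a > 8 * C" using ex a_far dist_triangle3[of a x\<^sub>0 e] by argo
      have \<gamma>0: "\<gamma> (dist x\<^sub>0 y2) = y2" using \<gamma> by (simp add: geodesic_path_def)
      have sub: "geodesic_path (\<lambda>u. b (\<gamma> (t + u))) (b q) (b y2)"
        using geodesic_path_isometry[OF geodesic_path_sub[OF \<gamma>, of t "dist x\<^sub>0 y2"] isom_dist[OF bi]] t \<gamma>0 by (simp add: q_def)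
      have dq: "dist (b q) (b y2) = dist x\<^sub>0 y2 - t"
        using geodesic_path_dist_end[OF \<gamma> t(1,2)] by (simp add: q_def isom_dist[OF bi])
      from geodesic_hits_start[OF sub e a \<open>dist e a > 8 * C\<close>] obtain u
        where u: "0 \<le> u" "u \<le> dist x\<^sub>0 y2 - t" "dist (b (\<gamma> (t + u))) e \<le> 10 * C" using dq by metis
      have "dist (b (\<gamma> (t + u))) x\<^sub>0 \<le> \<theta> + 4 * \<kappa>2 + 11 * C"
        using u(3) ex dist_triangle[of "b (\<gamma> (t + u))" x\<^sub>0 e] by argo
      then have "dist (\<gamma> (t + u)) (finv b x\<^sub>0) \<le> \<theta> + 4 * \<kappa>2 + 11 * C" by (simp add: isom_dist_inv'[OF bi])
      moreover have "dist x\<^sub>0 (\<gamma> (t + u)) = t + u" using geodesic_path_dist_start[OF \<gamma>, of "t + u"] u t by simp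
      moreover have "dist x\<^sub>0 q = t" using geodesic_path_dist_start[OF \<gamma> t(1,2)] by (simp add: q_def)
      moreover have "dist x\<^sub>0 (\<gamma> (t + u)) \<le> dist x\<^sub>0 (finv b x\<^sub>0) + dist (\<gamma> (t + u)) (finv b x\<^sub>0)" by metric
      moreover have "dist x\<^sub>0 (g x\<^sub>0) \<le> dist x\<^sub>0 q + dist q (g x\<^sub>0)" by metric
      ultimately show False using long q u(1) \<beta>_inv[OF \<tau>(2)] \<kappa>4 by argo
    qed
    have c3: "\<exists>t\<in>{0..dist x\<^sub>0 (g (s (finv g y)))}. dist (\<gamma> t) (g (s (finv g x\<^sub>0))) \<le> \<kappa>"
      if \<gamma>: "geodesic_path \<gamma> x\<^sub>0 (g (s (finv g y)))" for \<gamma>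
    proof -
      \<comment> \<open>h takes \<open>g s g\<^sup>-\<^sup>1 x\<^sub>0\<close> to
        \<open>x\<^sub>0\<close> and the path to one from \<open>y2\<close> to y; these are
        separated by the barrier that b provides near \<open>x\<^sub>0\<close>.\<close>
      define h where "h = g \<circ> finv s \<circ> finv g"
      have hi: "h \<in> carrier isom_group" unfolding h_def by (intro isom_comp isom_inv si gi)
      have hy: "h (g (s (finv g y))) = y" "h x\<^sub>0 = y2" using gi si by (simp_all add: h_def y2_def)
      have \<gamma>h: "geodesic_path (\<lambda>t. h (\<gamma> t)) y2 y"
        using geodesic_path_isometry[OF \<gamma> isom_dist[OF hi]] hy by simp
      have dh: "dist y2 y = dist x\<^sub>0 (g (s (finv g y)))" using isom_dist[OF hi, of x\<^sub>0 "g (s (finv g y))"] hy by simp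
      obtain t where t: "0 \<le> t" "t \<le> dist y2 y" "dist (b (h (\<gamma> t))) x\<^sub>0 \<le> \<theta>3 + 10 * C"
        using barrier_hit'[OF bi near_y2 \<tau>(4)[folded y_def] _ \<gamma>h] by auto
      have "dist (h (\<gamma> t)) (finv b x\<^sub>0) \<le> \<theta>3 + 10 * C" using t(3) by (simp add: isom_dist_inv'[OF bi])
      then have "dist (h (\<gamma> t)) x\<^sub>0 \<le> \<kappa>"
        using \<beta>_inv[OF \<tau>(2)] dist_triangle2[of "h (\<gamma> t)" x\<^sub>0 "finv b x\<^sub>0"] \<kappa>3 by argo
      moreover have "dist (h (\<gamma> t)) x\<^sub>0 = dist (\<gamma> t) (g (s (finv g x\<^sub>0)))"
        using isom_dist[OF hi, of "\<gamma> t" "g (s (finv g x\<^sub>0))"] gi si by (simp add: h_def)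
      ultimately show ?thesis using t dh by auto
    qed
    show ?thesis using s \<tau>(1) c1 c2 c3 unfolding y_def by blast
  qed
  show thesis using that[OF S T \<kappa>pos] main by blast
qed

text \<open>The path \<gamma> crosses the barrier at z well before it comes near p. By
  \<open>barrier_shadow\<close> p lies behind the same barrier, with constants worse by
  \<open>9 * C\<close>, so a geodesic to p has to cross it as well.\<close>

lemma barrier_before_endpoint:
  assumes \<zeta>: "\<zeta> \<in> carrier isom_group" "dist (\<zeta> x\<^sub>0) z \<le> \<kappa>" "far (finv \<zeta> x\<^sub>0) D\<^sub>0" "near (finv \<zeta> y) r\<^sub>0"
    and \<gamma>: "geodesic_path \<gamma> x\<^sub>0 y" and t: "0 \<le> t" "t \<le> dist x\<^sub>0 y" "dist (\<gamma> t) p \<le> \<kappa>" and \<kappa>: "\<kappa> > 0"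
    and late: "dist x\<^sub>0 z + 3 * \<kappa> + r\<^sub>0 + 10 * C \<le> dist x\<^sub>0 p" and \<delta>: "geodesic_path \<delta> x\<^sub>0 p"
  shows "\<exists>u\<in>{0..dist x\<^sub>0 p}. dist (\<delta> u) z \<le> \<kappa> + r\<^sub>0 + 19 * C"
proof -
  have f\<zeta>: "finv \<zeta> \<in> carrier isom_group" by (rule isom_inv[OF \<zeta>(1)])
  have "dist (finv \<zeta> x\<^sub>0) x\<^sub>0 \<le> dist x\<^sub>0 z + \<kappa>"
    using \<zeta>(2) dist_triangle2[of x\<^sub>0 "\<zeta> x\<^sub>0" z] by (simp add: isom_dist_inv[OF \<zeta>(1)])
  moreover have "t \<ge> dist x\<^sub>0 p - \<kappa>"
    using geodesic_path_dist_start[OF \<gamma> t(1,2)] t(3) dist_triangle[of x\<^sub>0 p "\<gamma> t"] by simp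
  ultimately have "t \<ge> dist (finv \<zeta> x\<^sub>0) x\<^sub>0 + r\<^sub>0 + 10 * C + \<kappa>" using late by argo
  from barrier_shadow[OF f\<zeta> \<zeta>(4) \<gamma> t(2,3) \<kappa> this] have "near (finv \<zeta> p) (r\<^sub>0 + 9 * C)" .
  moreover have "D\<^sub>0 \<ge> (r\<^sub>0 + 9 * C) + 8 * C" by (simp add: D\<^sub>0_def)
  ultimately obtain u where u: "0 \<le> u" "u \<le> dist x\<^sub>0 p" "dist (finv \<zeta> (\<delta> u)) x\<^sub>0 \<le> (r\<^sub>0 + 9 * C) + 10 * C"
    using barrier_hit[OF f\<zeta> _ \<zeta>(3) _ \<delta>] by metis
  then have "dist (\<delta> u) z \<le> \<kappa> + r\<^sub>0 + 19 * C"
    using \<zeta>(2) dist_triangle[of "\<delta> u" z "\<zeta> x\<^sub>0"] by (simp add: isom_dist_inv[OF \<zeta>(1)])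
  then show ?thesis using u by auto
qed

end

section \<open>Growth\<close>

text \<open>The exponent exceeds \<open>w / 2\<close> by \<open>ln 2 / m\<close>. Going back by at
  most m then loses at most a factor 2, which \<open>c * real q \<ge> 2\<close> compensates. The
  constant \<open>A\<close> makes the claim trivial for \<open>n < m\<close>, where only
  \<open>a n \<ge> 1\<close> is available.\<close>

lemma renewal_growth:
  fixes a :: "nat \<Rightarrow> real" and d :: "nat \<Rightarrow> nat"
  assumes a: "\<And>n. a n \<ge> 1" and w: "w > 0" and c: "c > 0" "c * real q \<ge> 2" and d: "\<And>l. l < q \<Longrightarrow> 1 \<le> d l \<and> d l \<le> m"
    and rec: "\<And>n. n \<ge> m \<Longrightarrow> a n \<ge> c * (\<Sum>l<q. exp (w * real (d l) / 2) * a (n - d l))"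
  obtains v A where "v > w / 2" "A > 0" "\<And>n. a n \<ge> A * exp (v * real n)"
proof -
  have q: "q > 0" using c by (cases q) auto
  then have m: "m > 0" using d[of 0] by auto
  define \<delta> where "\<delta> = ln 2 / real m"
  have \<delta>: "\<delta> > 0" using m by (simp add: \<delta>_def)
  define v where "v = w / 2 + \<delta>"
  have v: "v > 0" using w \<delta> by (simp add: v_def)
  define A where "A = exp (- v * real m)"
  have "a n \<ge> A * exp (v * real n)" for n
  proof (induction n rule: less_induct)
    case (less n)
    show ?case
    proof (cases "n < m")
      case True
      then have "- v * real m + v * real n \<le> 0" using v by (simp add: algebra_simps)
      then have "A * exp (v * real n) \<le> 1" by (simp add: A_def flip: exp_add)
      then show ?thesis using a[of n] by simp
    next
      case False
      have "A * exp (v * real n) / 2 \<le> exp (w * real (d l) / 2) * a (n - d l)" if l: "l < q" for l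
      proof -
        have "\<delta> * real (d l) \<le> \<delta> * real m" using d[OF l] \<delta> by simp
        then have "\<delta> * real (d l) \<le> ln 2" using m by (simp add: \<delta>_def)
        then have "exp (- ln 2) \<le> exp (- \<delta> * real (d l))" by simp
        then have half: "1 / 2 \<le> exp (- \<delta> * real (d l))" by (simp add: exp_minus)
        have "exp (v * real n) / 2 = exp (v * real n) * (1 / 2)" by simp
        also have "\<dots> \<le> exp (v * real n) * exp (- \<delta> * real (d l))" by (intro mult_left_mono half) simp
        also have "\<dots> = exp (w * real (d l) / 2) * exp (v * real (n - d l))"
          using d[OF l] False by (simp add: v_def of_nat_diff algebra_simps add_divide_distrib flip: exp_add)
        finally have "A * exp (v * real n) / 2 \<le> exp (w * real (d l) / 2) * (A * exp (v * real (n - d l)))"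
          by (simp add: A_def algebra_simps)
        also have "\<dots> \<le> exp (w * real (d l) / 2) * a (n - d l)"
          using d[OF l] False by (intro mult_left_mono less.IH) auto
        finally show ?thesis .
      qed
      then have "(\<Sum>l<q. A * exp (v * real n) / 2) \<le> (\<Sum>l<q. exp (w * real (d l) / 2) * a (n - d l))"
        by (intro sum_mono) simp
      then have "c * (real q * (A * exp (v * real n) / 2)) \<le> c * (\<Sum>l<q. exp (w * real (d l) / 2) * a (n - d l))"
        using c by (intro mult_left_mono) auto
      also have "\<dots> \<le> a n" using rec[of n] False by simp
      finally have "c * (real q * (A * exp (v * real n) / 2)) \<le> a n" .
      moreover have "2 * (A * exp (v * real n) / 2) \<le> (c * real q) * (A * exp (v * real n) / 2)"
        by (intro mult_right_mono c) (simp add: A_def)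
      ultimately show ?thesis by (simp add: mult.assoc)
    qed
  qed
  then show thesis using that[of v A] \<delta> by (simp add: v_def A_def)
qed

lemma growth_rate_ge:
  assumes "A > 0" "\<And>n. real (card (orbit_ball H x n)) \<ge> A * exp (v * real n)"
  shows "growth_rate H x \<ge> ereal v"
proof -
  have "(\<lambda>n. ln A / real n + v) \<longlonglongrightarrow> 0 + v"
    by (intro tendsto_add tendsto_const lim_const_over_n)
  then have "(\<lambda>n. ereal (ln A / real n + v)) \<longlonglongrightarrow> ereal v" by simp
  from lim_imp_Limsup[OF _ this] have "ereal v = limsup (\<lambda>n. ereal (ln A / real n + v))" by simp
  also have "\<dots> \<le> growth_rate H x"
    unfolding growth_rate_def
  proof (rule Limsup_mono, rule eventually_mono[OF eventually_gt_at_top[of 0]])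
    fix n :: nat assume n: "0 < n"
    have "0 < A * exp (v * real n)" using assms by simp
    then have "ln (A * exp (v * real n)) \<le> ln (real (card (orbit_ball H x n)))"
      using assms(2)[of n] by (intro ln_mono) auto
    then have "ln A + v * real n \<le> ln (real (card (orbit_ball H x n)))" using assms(1) by (simp add: ln_mult)
    then show "ereal (ln A / real n + v) \<le> ereal (ln (real (card (orbit_ball H x n))) / real n)"
      using n divide_right_mono[of _ _ "real n"] by (fastforce simp: add_divide_distrib)
  qed
  finally show ?thesis .
qed

lemma card_le_fibres:
  assumes "finite B" "f ` A \<subseteq> B" "\<And>b. b \<in> B \<Longrightarrow> finite {a\<in>A. f a = b} \<and> card {a\<in>A. f a = b} \<le> m"
  shows "card A \<le> m * card B"
proof -
  have "A = (\<Union>b\<in>B. {a\<in>A. f a = b})" using assms(2) by auto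
  then have "card A \<le> (\<Sum>b\<in>B. card {a\<in>A. f a = b})" using card_UN_le[OF assms(1)] by metis
  also have "\<dots> \<le> (\<Sum>b\<in>B. m)" using assms(3) by (intro sum_mono) auto
  finally show ?thesis by (simp add: mult.commute)
qed

lemma card_UN_bounded:
  assumes "finite A" "\<And>x. x \<in> A \<Longrightarrow> card (B x) \<le> m"
  shows "card (\<Union>x\<in>A. B x) \<le> card A * m"
proof -
  have "card (\<Union>x\<in>A. B x) \<le> (\<Sum>x\<in>A. card (B x))" by (rule card_UN_le[OF assms(1)])
  also have "\<dots> \<le> card A * m" using sum_bounded_above[of A "\<lambda>x. card (B x)" m] assms(2) by simp
  finally show ?thesis .
qed

context confined_action
begin

lemma finite_orbit_ball: "finite (orbit_ball \<Gamma> x\<^sub>0 n)" "finite (orbit_ball H x\<^sub>0 n)"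
proof -
  have "orbit_ball G x\<^sub>0 n = (\<lambda>g. g x\<^sub>0) ` {g\<in>G. dist x\<^sub>0 (g x\<^sub>0) \<le> real n}" for G :: "('a \<Rightarrow> 'a) set"
    by (auto simp: orbit_ball_def)
  then show "finite (orbit_ball \<Gamma> x\<^sub>0 n)" "finite (orbit_ball H x\<^sub>0 n)"
    using finite_ball finite_ball_H by simp_all
qed

text \<open>The distance from \<open>x\<^sub>0\<close> determines the position along \<gamma> up to
  \<open>\<Delta> + 2 * \<kappa>\<close>, so two such points are at most
  \<open>\<Delta> + 4 * \<kappa>\<close> apart. Translating one of them to \<open>x\<^sub>0\<close>
  gives a bound independent of i.\<close>

lemma card_along_geodesic:
  fixes \<Delta> \<kappa> i :: real
  assumes \<gamma>: "geodesic_path \<gamma> x\<^sub>0 y" and N: "\<Delta> + 4 * \<kappa> \<le> real N"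
    and A: "A \<subseteq> {x. (\<exists>g\<in>\<Gamma>. x = g x\<^sub>0) \<and> i - \<Delta> \<le> dist x\<^sub>0 x \<and> dist x\<^sub>0 x \<le> i \<and> (\<exists>t\<in>{0..dist x\<^sub>0 y}. dist (\<gamma> t) x \<le> \<kappa>)}"
  shows "finite A \<and> card A \<le> card (orbit_ball \<Gamma> x\<^sub>0 N)"
proof (cases "A = {}")
  case False
  then obtain x where x: "x \<in> A" by blast
  then obtain g t where g: "g \<in> \<Gamma>" "x = g x\<^sub>0" and t: "t \<in> {0..dist x\<^sub>0 y}" "dist (\<gamma> t) x \<le> \<kappa>" 
    and xi: "i - \<Delta> \<le> dist x\<^sub>0 x" "dist x\<^sub>0 x \<le> i" using A by blast
  have gi: "g \<in> carrier isom_group" using g by simp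
  have "A \<subseteq> g ` orbit_ball \<Gamma> x\<^sub>0 N"
  proof
    fix x' assume "x' \<in> A"
    then obtain g' t' where g': "g' \<in> \<Gamma>" "x' = g' x\<^sub>0" and t': "t' \<in> {0..dist x\<^sub>0 y}" "dist (\<gamma> t') x' \<le> \<kappa>" 
      and xi': "i - \<Delta> \<le> dist x\<^sub>0 x'" "dist x\<^sub>0 x' \<le> i" using A by blast
    have "dist x\<^sub>0 (\<gamma> t) = t" "dist x\<^sub>0 (\<gamma> t') = t'"
      using geodesic_path_dist_start[OF \<gamma>] t t' by auto
    moreover have "dist (\<gamma> t) (\<gamma> t') = \<bar>t - t'\<bar>" using geodesic_path_dist[OF \<gamma>] t t' by auto
    moreover have "\<bar>dist x\<^sub>0 (\<gamma> t) - dist x\<^sub>0 x\<bar> \<le> dist (\<gamma> t) x" "\<bar>dist x\<^sub>0 (\<gamma> t') - dist x\<^sub>0 x'\<bar> \<le> dist (\<gamma> t') x'"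
      by metric+
    moreover have "dist x x' \<le> dist (\<gamma> t) x + dist (\<gamma> t) (\<gamma> t') + dist (\<gamma> t') x'" by metric
    ultimately have "dist x x' \<le> real N" using t(2) t'(2) xi xi' N by linarith
    then have "dist x\<^sub>0 ((finv g \<circ> g') x\<^sub>0) \<le> real N" using g g' by (simp add: isom_dist_inv'[OF gi])
    moreover have "finv g \<circ> g' \<in> \<Gamma>" using g g' by (simp add: comp_mem inv_mem)
    ultimately have "(finv g \<circ> g') x\<^sub>0 \<in> orbit_ball \<Gamma> x\<^sub>0 N" unfolding orbit_ball_def by blast
    moreover have "x' = g ((finv g \<circ> g') x\<^sub>0)" using g' gi by simp
    ultimately show "x' \<in> g ` orbit_ball \<Gamma> x\<^sub>0 N" by blast
  qed
  then show ?thesis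
    by (meson card_image_le card_mono finite_imageI finite_orbit_ball(1) finite_subset order_trans)
qed simp

text \<open>The powers of f give infinitely many orbit points, whereas \<open>w \<le> 0\<close>
  would bound the size of all balls.\<close>

lemma positive_growth:
  assumes ub: "\<And>n. real (card (orbit_ball \<Gamma> x\<^sub>0 n)) \<le> c * exp (real n * w)"
  shows "w > 0"
proof (rule ccontr)
  assume w: "\<not> w > 0"
  obtain N where N: "N \<ge> 1" "\<And>m n. \<bar>m - n\<bar> \<ge> N \<Longrightarrow> dist (fp m x\<^sub>0) (fp n x\<^sub>0) > 0" 
    using fp_unbounded by metis
  define m where "m = nat \<lceil>\<bar>c\<bar>\<rceil>"
  define p where "p i = fp (int i * N) x\<^sub>0" for i :: nat
  have inj: "inj p"
  proof (rule injI, rule ccontr)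
    fix i j assume eq: "p i = p j" and "i \<noteq> j"
    then have "1 \<le> \<bar>int i - int j\<bar>" by simp
    then have "N * 1 \<le> N * \<bar>int i - int j\<bar>" using N by (intro mult_left_mono) auto
    then have "N \<le> \<bar>int i * N - int j * N\<bar>" using N(1)
      by (simp add: abs_mult mult.commute flip: right_diff_distrib left_diff_distrib)
    from N(2)[OF this] eq show False by (simp add: p_def)
  qed
  define n where "n = nat \<lceil>\<Sum>i\<le>m. dist x\<^sub>0 (p i)\<rceil>"
  have "p ` {..m} \<subseteq> orbit_ball \<Gamma> x\<^sub>0 n"
  proof
    fix x assume "x \<in> p ` {..m}"
    then obtain i where i: "i \<le> m" "x = p i" by auto
    have "dist x\<^sub>0 (p i) \<le> (\<Sum>i\<le>m. dist x\<^sub>0 (p i))" using i by (intro member_le_sum) auto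
    also have "\<dots> \<le> real n" unfolding n_def by linarith
    finally show "x \<in> orbit_ball \<Gamma> x\<^sub>0 n" unfolding orbit_ball_def i(2) p_def
      by (intro CollectI exI[of _ "fp (int i * N)"]) simp
  qed
  from card_mono[OF finite_orbit_ball(1) this] have "m + 1 \<le> card (orbit_ball \<Gamma> x\<^sub>0 n)"
    using card_image[OF inj_on_subset[OF inj], of "{..m}"] by simp
  moreover have "c * exp (real n * w) \<le> \<bar>c\<bar>"
  proof -
    have "exp (real n * w) \<le> 1" using w by (simp add: mult_nonneg_nonpos)
    then have "\<bar>c\<bar> * exp (real n * w) \<le> \<bar>c\<bar> * 1" by (intro mult_left_mono) auto
    moreover have "c * exp (real n * w) \<le> \<bar>c\<bar> * exp (real n * w)" by (intro mult_right_mono) auto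
    ultimately show ?thesis by argo
  qed
  moreover have "\<bar>c\<bar> \<le> real m" unfolding m_def by linarith
  ultimately show False using ub[of n] by linarith
qed

text \<open>The elements \<open>g s g\<^sup>-\<^sup>1 \<tau> \<eta>\<close> with \<open>g\<close> at distance about \<open>i l\<close> and \<open>\<eta>\<close> in a ball of \<open>H\<close> are counted
  simultaneously for finitely many levels \<open>l\<close>.  Discarding the few \<open>g\<close> that lie close to the path
  of such an element of lower level, the endpoint determines the level, and then \<open>g\<close> and \<open>\<eta>\<close> up to
  a number of choices that does not depend on the levels.\<close>

lemma exponential_growth_H:
  assumes c: "c \<ge> 1"
    and lb: "\<And>n. exp (real n * w) / c \<le> real (card (orbit_ball \<Gamma> x\<^sub>0 n))"
    and ub: "\<And>n. real (card (orbit_ball \<Gamma> x\<^sub>0 n)) \<le> c * exp (real n * w)"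
  obtains v A where "v > w / 2" "A > 0" "\<And>n. real (card (orbit_ball H x\<^sub>0 n)) \<ge> A * exp (v * real n)"
proof -
  have w: "w > 0" by (rule positive_growth[OF ub])

  \<comment> \<open>Choice of connecting elements and of representatives for orbit points\<close>
  define K where "K g s \<tau> \<eta> = g (s (finv g (\<tau> (\<eta> x\<^sub>0))))" for g s \<tau> \<eta> :: "'a \<Rightarrow> 'a"
  define path where "path p = (SOME \<gamma>. geodesic_path \<gamma> x\<^sub>0 p)" for p
  have path: "geodesic_path (path p) x\<^sub>0 p" for p
    unfolding path_def using proper_geodesic_space_path[OF proper_geodesic] by (rule someI_ex)
  obtain S T \<kappa> where S: "finite S" "S \<subseteq> carrier isom_group" and T: "finite T" "T \<subseteq> H" and \<kappa>: "\<kappa> > 0"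
    and comb: "\<And>g \<eta>. g \<in> \<Gamma> \<Longrightarrow> \<kappa> \<le> dist x\<^sub>0 (g x\<^sub>0) \<Longrightarrow> \<eta> \<in> H \<Longrightarrow> \<exists>s\<in>S. \<exists>\<tau>\<in>T. g \<circ> s \<circ> finv g \<in> H \<and>
       2 * dist x\<^sub>0 (g x\<^sub>0) - \<kappa> \<le> dist x\<^sub>0 (g (s (finv g x\<^sub>0))) \<and>
       (\<exists>\<zeta>\<in>carrier isom_group. dist (\<zeta> x\<^sub>0) (g x\<^sub>0) \<le> \<kappa> \<and> far (finv \<zeta> x\<^sub>0) D\<^sub>0 \<and> near (finv \<zeta> (K g s \<tau> \<eta>)) r\<^sub>0) \<and>
       (\<forall>\<gamma>. geodesic_path \<gamma> x\<^sub>0 (K g s \<tau> \<eta>) \<longrightarrow>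
          (\<exists>t\<in>{0..dist x\<^sub>0 (K g s \<tau> \<eta>)}. dist (\<gamma> t) (g (s (finv g x\<^sub>0))) \<le> \<kappa>))"
    unfolding K_def by (rule combination) blast
  define \<Phi> where "\<Phi> g \<eta> s \<tau> \<longleftrightarrow> s \<in> S \<and> \<tau> \<in> T \<and> g \<circ> s \<circ> finv g \<in> H \<and>
       2 * dist x\<^sub>0 (g x\<^sub>0) - \<kappa> \<le> dist x\<^sub>0 (g (s (finv g x\<^sub>0))) \<and>
       (\<exists>\<zeta>\<in>carrier isom_group. dist (\<zeta> x\<^sub>0) (g x\<^sub>0) \<le> \<kappa> \<and> far (finv \<zeta> x\<^sub>0) D\<^sub>0 \<and> near (finv \<zeta> (K g s \<tau> \<eta>)) r\<^sub>0) \<and>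
       (\<exists>t\<in>{0..dist x\<^sub>0 (K g s \<tau> \<eta>)}. dist (path (K g s \<tau> \<eta>) t) (g (s (finv g x\<^sub>0))) \<le> \<kappa>)" for g \<eta> s \<tau>
  have "\<exists>s \<tau>. \<Phi> g \<eta> s \<tau>" if "g \<in> \<Gamma>" "\<kappa> \<le> dist x\<^sub>0 (g x\<^sub>0)" "\<eta> \<in> H" for g \<eta>
    using comb[OF that] path unfolding \<Phi>_def by blast
  then obtain sf \<tau>f where \<Phi>: "\<And>g \<eta>. g \<in> \<Gamma> \<Longrightarrow> \<kappa> \<le> dist x\<^sub>0 (g x\<^sub>0) \<Longrightarrow> \<eta> \<in> H \<Longrightarrow> \<Phi> g \<eta> (sf g \<eta>) (\<tau>f g \<eta>)"
    by metis
  define gx where "gx x = (SOME g. g \<in> \<Gamma> \<and> g x\<^sub>0 = x)" for x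
  have gx: "gx x \<in> \<Gamma> \<and> gx x x\<^sub>0 = x" if "x \<in> orbit_ball \<Gamma> x\<^sub>0 n" for x n
  proof -
    have "\<exists>g. g \<in> \<Gamma> \<and> g x\<^sub>0 = x" using that by (auto simp: orbit_ball_def)
    from someI_ex[OF this] show ?thesis unfolding gx_def .
  qed
  define hy where "hy y = (SOME h. h \<in> H \<and> h x\<^sub>0 = y)" for y
  have hy: "hy y \<in> H \<and> hy y x\<^sub>0 = y" if "y \<in> orbit_ball H x\<^sub>0 n" for y n
  proof -
    have "\<exists>h. h \<in> H \<and> h x\<^sub>0 = y" using that by (auto simp: orbit_ball_def)
    from someI_ex[OF this] show ?thesis unfolding hy_def .
  qed

  \<comment> \<open>Constants\<close>
  define \<kappa>' where "\<kappa>' = \<kappa> + r\<^sub>0 + 19 * C"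
  have \<kappa>': "\<kappa> + r\<^sub>0 + 10 * C \<le> \<kappa>'" using C_ge_1 by (simp add: \<kappa>'_def)
  \<comment> \<open>With this width, the inner ball that is removed has at most half of the size
    guaranteed for the outer ball.\<close>
  obtain \<Delta> :: nat where "ln (2 * c * c) / w \<le> real \<Delta>" using real_arch_simple by blast
  then have "ln (2 * c * c) \<le> real \<Delta> * w" using w by (simp add: field_simps)
  then have "exp (ln (2 * c * c)) \<le> exp (real \<Delta> * w)" by simp
  then have "2 * c * c \<le> exp (real \<Delta> * w)" using c by simp
  then have \<Delta>: "c * exp (- (real \<Delta> * w)) \<le> 1 / (2 * c)" using c by (simp add: exp_minus field_simps)
  define n3 where "n3 = nat \<lceil>real \<Delta> + 4 * \<kappa>'\<rceil>"
  have n3: "real \<Delta> + 4 * \<kappa>' \<le> real n3" unfolding n3_def by linarith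
  define m3 where "m3 = card (orbit_ball \<Gamma> x\<^sub>0 n3)"
  define \<sigma> where "\<sigma> = (\<Sum>s\<in>S. dist x\<^sub>0 (s x\<^sub>0)) + (\<Sum>s\<in>T. dist x\<^sub>0 (s x\<^sub>0))"
  have \<sigma>: "dist x\<^sub>0 (s x\<^sub>0) + dist x\<^sub>0 (\<tau> x\<^sub>0) \<le> \<sigma>" if "s \<in> S" "\<tau> \<in> T" for s \<tau>
    unfolding \<sigma>_def using S T that by (intro add_mono member_le_sum) auto
  define e0 where "e0 = nat \<lceil>\<sigma>\<rceil>"
  have e0: "\<sigma> \<le> real e0" unfolding e0_def by linarith
  \<comment> \<open>The bound for the fibres of the counting map. It involves neither the number nor
    the spacing of the levels, so q can be chosen after \<open>c3\<close>. The summand 1 keeps it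
    positive.\<close>
  define m0 where "m0 = m3 * (card S * card T) + 1"
  define c3 where "c3 = exp (- (w * real e0 / 2)) / (4 * c * real m0)"
  have "real m0 > 0" by (simp only: of_nat_0_less_iff) (simp add: m0_def)
  then have c3: "c3 > 0" unfolding c3_def using c by (intro divide_pos_pos mult_pos_pos) auto
  obtain q :: nat where "2 / c3 \<le> real q" using real_arch_simple by blast
  then have q: "c3 * real q \<ge> 2" using c3 by (simp add: field_simps)
  define b where "b = real q * c * real (card S) * real m3"
  have b: "b \<ge> 0" using c by (simp add: b_def)
  \<comment> \<open>Spacing by \<open>L\<close> makes the points discarded from an annulus at most
    half of its guaranteed size.\<close>
  obtain L :: nat where "ln (4 * c * b + 1) / w + 1 \<le> real L" using real_arch_simple by blast
  moreover have "0 \<le> ln (4 * c * b + 1)" using b c by simp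
  ultimately have "L \<ge> 1" and "ln (4 * c * b + 1) / w \<le> real L" 
    using w divide_nonneg_pos[of "ln (4 * c * b + 1)" w] by linarith+
  then have "ln (4 * c * b + 1) \<le> real L * w" using w by (simp add: field_simps)
  then have "exp (ln (4 * c * b + 1)) \<le> exp (real L * w)" by simp
  moreover have "0 < 4 * c * b + 1" using b c by (intro add_nonneg_pos) auto
  ultimately have "4 * c * b + 1 \<le> exp (real L * w)" by simp
  then have "4 * c * b \<le> exp (real L * w)" by simp
  then have L: "b * exp (- (real L * w)) \<le> 1 / (4 * c)" using c by (simp add: exp_minus field_simps)
  \<comment> \<open>The lowest radius exceeds the spread \<open>q * L\<close> of all radii. So the
    target of a lower level, at about twice its radius, is further away than all points of higher
    levels.\<close>
  obtain I :: nat where I: "2 * real \<Delta> + real q * real L + 5 * \<kappa> + r\<^sub>0 + 10 * C \<le> real I" using real_arch_simple by blast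
  have I1: "real \<Delta> + \<kappa> \<le> real I"
    using I \<kappa> constants C_ge_1 of_nat_0_le_iff[of \<Delta>] mult_nonneg_nonneg[of "real q" "real L"] by linarith

  \<comment> \<open>Annuli and discarded points\<close>
  define i where "i l = I + l * L" for l
  have i_mono: "i l' + L \<le> i l" if "l' < l" for l l'
  proof -
    have "(l' + 1) * L \<le> l * L" using that by (intro mult_right_mono) auto
    then show ?thesis by (simp add: i_def)
  qed
  have i_le: "real (i l) \<le> real I + real q * real L" if "l < q" for l
  proof -
    have "l * L \<le> q * L" using that by simp
    then have "real (l * L) \<le> real (q * L)" by (rule of_nat_mono)
    then show ?thesis by (simp add: i_def)
  qed
  define Ann where "Ann l = {x\<in>orbit_ball \<Gamma> x\<^sub>0 (i l). real (i l) - real \<Delta> \<le> dist x\<^sub>0 x}" for l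
  have Ann_fin: "finite (Ann l)" for l unfolding Ann_def using finite_orbit_ball by simp
  have Ann_ball: "x \<in> orbit_ball \<Gamma> x\<^sub>0 (i l)" if "x \<in> Ann l" for x l
    using that by (simp add: Ann_def)
  have Ann1: "gx x \<in> \<Gamma>" if "x \<in> Ann l" for x l using gx[OF Ann_ball[OF that]] by (rule conjunct1)
  have Ann2: "gx x x\<^sub>0 = x" if "x \<in> Ann l" for x l using gx[OF Ann_ball[OF that]] by (rule conjunct2)
  have Ann3: "real (i l) - real \<Delta> \<le> dist x\<^sub>0 x" if "x \<in> Ann l" for x l using that by (simp add: Ann_def)
  have Ann4: "dist x\<^sub>0 x \<le> real (i l)" if "x \<in> Ann l" for x l
    using Ann_ball[OF that] by (auto simp: orbit_ball_def)
  note Ann = Ann1 Ann2 Ann3 Ann4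
  have Ann_card: "real (card (Ann l)) \<ge> exp (real (i l) * w) / (2 * c)" for l
  proof -
    have "\<Delta> \<le> i l" using I1 \<kappa> by (simp add: i_def)
    then have il: "real (i l - \<Delta>) = real (i l) - real \<Delta>" by simp
    have "orbit_ball \<Gamma> x\<^sub>0 (i l) \<subseteq> Ann l \<union> orbit_ball \<Gamma> x\<^sub>0 (i l - \<Delta>)"
      unfolding Ann_def orbit_ball_def il by auto
    then have "card (orbit_ball \<Gamma> x\<^sub>0 (i l)) \<le> card (Ann l) + card (orbit_ball \<Gamma> x\<^sub>0 (i l - \<Delta>))"
      using Ann_fin finite_orbit_ball by (meson card_Un_le card_mono finite_UnI order_trans)
    then have "exp (real (i l) * w) / c \<le> real (card (Ann l)) + c * exp (real (i l - \<Delta>) * w)"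
      using lb[of "i l"] ub[of "i l - \<Delta>"] by linarith
    also have "c * exp (real (i l - \<Delta>) * w) = (c * exp (- (real \<Delta> * w))) * exp (real (i l) * w)"
      unfolding il by (simp add: algebra_simps flip: exp_add)
    also have "\<dots> \<le> 1 / (2 * c) * exp (real (i l) * w)" by (intro mult_right_mono \<Delta>) simp
    finally show ?thesis using c by (simp add: field_simps)
  qed
  define target where "target x s = gx x (s (finv (gx x) x\<^sub>0))" for x and s :: "'a \<Rightarrow> 'a"
  define track where "track l p = {x\<in>Ann l. \<exists>t\<in>{0..dist x\<^sub>0 p}. dist (path p t) x \<le> \<kappa>'}" for l p
  have track: "finite (track l p) \<and> card (track l p) \<le> m3" for l p
    unfolding m3_def
  proof (rule card_along_geodesic[OF path n3, of _ "real (i l)" p], rule subsetI, rule CollectI)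
    fix x assume "x \<in> track l p"
    then have x: "x \<in> Ann l" and t: "\<exists>t\<in>{0..dist x\<^sub>0 p}. dist (path p t) x \<le> \<kappa>'"
      by (simp_all add: track_def)
    have "\<exists>g\<in>\<Gamma>. x = g x\<^sub>0" using Ann(1,2)[OF x] by metis
    then show "(\<exists>g\<in>\<Gamma>. x = g x\<^sub>0) \<and> real (i l) - real \<Delta> \<le> dist x\<^sub>0 x \<and> dist x\<^sub>0 x \<le> real (i l) \<and>
        (\<exists>t\<in>{0..dist x\<^sub>0 p}. dist (path p t) x \<le> \<kappa>')"
      using Ann(3,4)[OF x] t by blast
  qed
  \<comment> \<open>The target depends on x and s but not on \<eta>; otherwise the number of
    discarded points would grow with the ball of \<open>H\<close>.\<close>
  define bad where "bad l = (\<Union>l'<l. \<Union>x\<in>Ann l'. \<Union>s\<in>S. track l (target x s))" for l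
  have bad_card: "real (card (bad l)) \<le> exp (real (i l) * w) / (4 * c)" if l: "l < q" for l
  proof -
    have "card (\<Union>s\<in>S. track l (target x s)) \<le> card S * m3" for x
      using track by (intro card_UN_bounded S) blast
    then have step: "card (\<Union>x\<in>Ann l'. \<Union>s\<in>S. track l (target x s)) \<le> card (Ann l') * (card S * m3)" for l'
      by (rule card_UN_bounded[OF Ann_fin])
    have "card (bad l) \<le> (\<Sum>l'<l. card (\<Union>x\<in>Ann l'. \<Union>s\<in>S. track l (target x s)))"
      unfolding bad_def by (rule card_UN_le) simp
    also have "\<dots> \<le> (\<Sum>l'<l. card (Ann l') * (card S * m3))" by (rule sum_mono) (rule step)
    finally have "real (card (bad l)) \<le> real (\<Sum>l'<l. card (Ann l') * (card S * m3))" by (rule of_nat_mono)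
    also have "\<dots> = (\<Sum>l'<l. real (card (Ann l')) * (real (card S) * real m3))"
      by (simp only: of_nat_sum of_nat_mult)
    also have "\<dots> \<le> (\<Sum>l'<l. (c * exp (real (i l) * w - real L * w)) * (real (card S) * real m3))"
    proof (intro sum_mono mult_right_mono)
      fix l' assume "l' \<in> {..<l}"
      then have "i l' + L \<le> i l" using i_mono by simp
      then have "real (i l') \<le> real (i l) - real L" by linarith
      then have "real (i l') * w \<le> real (i l) * w - real L * w"
        using w mult_right_mono[of "real (i l')" "real (i l) - real L" w] by (simp add: left_diff_distrib)
      then have "c * exp (real (i l') * w) \<le> c * exp (real (i l) * w - real L * w)" using c by simp
      moreover have "real (card (Ann l')) \<le> real (card (orbit_ball \<Gamma> x\<^sub>0 (i l')))"
        using card_mono[OF finite_orbit_ball(1), of "Ann l'" "i l'"] by (auto simp: Ann_def)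
      ultimately show "real (card (Ann l')) \<le> c * exp (real (i l) * w - real L * w)" using ub[of "i l'"] by linarith
    qed simp
    also have "\<dots> = real l * ((c * exp (real (i l) * w - real L * w)) * (real (card S) * real m3))" by simp
    also have "\<dots> \<le> real q * ((c * exp (real (i l) * w - real L * w)) * (real (card S) * real m3))"
      using l c by (intro mult_right_mono) auto
    also have "\<dots> = (b * exp (- (real L * w))) * exp (real (i l) * w)"
      by (simp add: b_def exp_diff exp_minus field_simps)
    also have "\<dots> \<le> 1 / (4 * c) * exp (real (i l) * w)" by (intro mult_right_mono L) simp
    finally show ?thesis by simp
  qed
  define kept where "kept l = Ann l - bad l" for l
  have kept_card: "real (card (kept l)) \<ge> exp (real (i l) * w) / (4 * c)" if l: "l < q" for l
  proof -
    have "bad l \<subseteq> Ann l" by (auto simp: bad_def track_def)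
    then have "card (kept l) = card (Ann l) - card (bad l)" "card (bad l) \<le> card (Ann l)"
      unfolding kept_def using Ann_fin[of l] by (auto intro: card_Diff_subset card_mono finite_subset)
    then have "real (card (kept l)) = real (card (Ann l)) - real (card (bad l))" by simp
    then show ?thesis using Ann_card[of l] bad_card[OF l] by (simp add: field_simps)
  qed

  \<comment> \<open>The counting map, its fibres and the renewal inequality\<close>
  define d where "d l = 2 * i l + e0" for l
  define F where "F = (\<lambda>(l :: nat, x, y). K (gx x) (sf (gx x) (hy y)) (\<tau>f (gx x) (hy y)) (hy y))"
  have rec: "real (card (orbit_ball H x\<^sub>0 n)) \<ge> c3 * (\<Sum>l<q. exp (w * real (d l) / 2) * real (card (orbit_ball H x\<^sub>0 (n - d l))))"
    if n: "n \<ge> d q" for n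
  proof -
    define \<Omega> where "\<Omega> = (SIGMA l:{..<q}. kept l \<times> orbit_ball H x\<^sub>0 (n - d l))"
    have \<Omega>: "\<Phi> (gx x) (hy y) (sf (gx x) (hy y)) (\<tau>f (gx x) (hy y))" "x \<in> Ann l" "l < q" "hy y \<in> H" "hy y x\<^sub>0 = y"
      "dist x\<^sub>0 y \<le> real (n - d l)"
      if "(l, x, y) \<in> \<Omega>" for l x y
    proof -
      have *: "l < q" "x \<in> kept l" "y \<in> orbit_ball H x\<^sub>0 (n - d l)" using that by (auto simp: \<Omega>_def)
      then show x: "x \<in> Ann l" "l < q" by (auto simp: kept_def)
      show y: "hy y \<in> H" "hy y x\<^sub>0 = y" using hy[OF *(3)] by auto
      show "dist x\<^sub>0 y \<le> real (n - d l)" using *(3) by (auto simp: orbit_ball_def)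
      have "real I \<le> real (i l)" by (simp add: i_def)
      then have "\<kappa> \<le> dist x\<^sub>0 (gx x x\<^sub>0)" using Ann(2,3)[OF x(1)] I1 by simp
      then show "\<Phi> (gx x) (hy y) (sf (gx x) (hy y)) (\<tau>f (gx x) (hy y))" using \<Phi> Ann(1)[OF x(1)] y by blast
    qed
    have F_ball: "F ` \<Omega> \<subseteq> orbit_ball H x\<^sub>0 n"
    proof (rule image_subsetI)
      fix z assume z: "z \<in> \<Omega>"
      obtain l x y where lxy: "z = (l, x, y)" by (cases z) auto
      note W = \<Omega>[OF z[unfolded lxy]]
      define g s \<tau> \<eta> where "g = gx x" and "s = sf (gx x) (hy y)" and "\<tau> = \<tau>f (gx x) (hy y)" and "\<eta> = hy y"
      have f: "\<Phi> g \<eta> s \<tau>" using W(1) by (simp add: g_def s_def \<tau>_def \<eta>_def)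
      have gi: "g \<in> carrier isom_group" using Ann(1)[OF W(2)] by (simp add: g_def)
      have si: "s \<in> carrier isom_group" using f S by (auto simp: \<Phi>_def)
      have \<tau>H: "\<tau> \<in> H" using f T by (auto simp: \<Phi>_def)
      have \<tau>i: "\<tau> \<in> carrier isom_group" using H.isom[OF \<tau>H] .
      have Fz: "F z = ((g \<circ> s \<circ> finv g) \<circ> (\<tau> \<circ> \<eta>)) x\<^sub>0"
        by (simp add: lxy F_def K_def g_def s_def \<tau>_def \<eta>_def)
      have mem: "(g \<circ> s \<circ> finv g) \<circ> (\<tau> \<circ> \<eta>) \<in> H"
      proof (rule H.comp_mem)
        show "g \<circ> s \<circ> finv g \<in> H" using f by (simp only: \<Phi>_def)
        show "\<tau> \<circ> \<eta> \<in> H" using \<tau>H W(4) by (simp only: \<eta>_def H.comp_mem)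
      qed
      have "dist x\<^sub>0 (g (s (finv g (\<tau> (\<eta> x\<^sub>0))))) \<le> dist x\<^sub>0 (g x\<^sub>0) + dist (g x\<^sub>0) (g (s x\<^sub>0)) +
          dist (g (s x\<^sub>0)) (g (s (finv g x\<^sub>0))) + dist (g (s (finv g x\<^sub>0))) (g (s (finv g (\<tau> x\<^sub>0)))) +
          dist (g (s (finv g (\<tau> x\<^sub>0)))) (g (s (finv g (\<tau> (\<eta> x\<^sub>0)))))"
        using dist_triangle[of x\<^sub>0 "g (s (finv g (\<tau> (\<eta> x\<^sub>0))))" "g (s (finv g (\<tau> x\<^sub>0)))"]
          dist_triangle[of x\<^sub>0 "g (s (finv g (\<tau> x\<^sub>0)))" "g (s (finv g x\<^sub>0))"]
          dist_triangle[of x\<^sub>0 "g (s (finv g x\<^sub>0))" "g (s x\<^sub>0)"]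
          dist_triangle[of x\<^sub>0 "g (s x\<^sub>0)" "g x\<^sub>0"] by argo
      also have "\<dots> = 2 * dist x\<^sub>0 (g x\<^sub>0) + (dist x\<^sub>0 (s x\<^sub>0) + dist x\<^sub>0 (\<tau> x\<^sub>0)) + dist x\<^sub>0 (\<eta> x\<^sub>0)"
        by (simp add: isom_dist[OF gi] isom_dist[OF si] isom_dist[OF isom_inv[OF gi]] isom_dist[OF \<tau>i])
          (simp add: isom_dist_inv'[OF gi] dist_commute)
      also have "\<dots> \<le> 2 * real (i l) + real e0 + real (n - d l)"
        using Ann(2,4)[OF W(2)] W(5,6) \<sigma>[of s \<tau>] f e0 by (simp add: \<Phi>_def g_def \<eta>_def)
      also have "\<dots> = real n"
      proof -
        have "d l \<le> d q" using i_mono[OF W(3)] by (simp add: d_def)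
        then have "real (n - d l) = real n - real (d l)" using n by simp
        then show ?thesis by (simp add: d_def)
      qed
      finally have "dist x\<^sub>0 (((g \<circ> s \<circ> finv g) \<circ> (\<tau> \<circ> \<eta>)) x\<^sub>0) \<le> real n" by simp
      then show "F z \<in> orbit_ball H x\<^sub>0 n" unfolding orbit_ball_def Fz using mem by blast
    qed
    have fibre: "finite {z\<in>\<Omega>. F z = p} \<and> card {z\<in>\<Omega>. F z = p} \<le> m0" for p
    proof (cases "{z\<in>\<Omega>. F z = p} = {}")
      case False
      \<comment> \<open>The geodesic to the common endpoint p crosses the barrier at x before it
        comes near the target of the lower level. So x lies on the track of that target and was
        discarded.\<close>
      have no_lower: False if z: "(l, x, y) \<in> \<Omega>" "F (l, x, y) = p" and z': "(l', x', y') \<in> \<Omega>" "F (l', x', y') = p"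
        and l: "l' < l" for l x y l' x' y'
      proof -
        note W = \<Omega>[OF z(1)] and W' = \<Omega>[OF z'(1)]
        define g' s' where "g' = gx x'" and "s' = sf (gx x') (hy y')"
        define p' where "p' = g' (s' (finv g' x\<^sub>0))"
        have Kp: "K (gx x) (sf (gx x) (hy y)) (\<tau>f (gx x) (hy y)) (hy y) = p"
          "K (gx x') (sf (gx x') (hy y')) (\<tau>f (gx x') (hy y')) (hy y') = p"
          using z(2) z'(2) by (auto simp: F_def)
        from W(1) obtain \<zeta> where \<zeta>: "\<zeta> \<in> carrier isom_group" "dist (\<zeta> x\<^sub>0) x \<le> \<kappa>"
            "far (finv \<zeta> x\<^sub>0) D\<^sub>0" "near (finv \<zeta> p) r\<^sub>0"
          unfolding \<Phi>_def Kp Ann(2)[OF W(2)] by blast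
        from W'(1) obtain t where t: "t \<in> {0..dist x\<^sub>0 p}" "dist (path p t) p' \<le> \<kappa>"
          unfolding \<Phi>_def Kp p'_def g'_def s'_def by blast
        have s'S: "s' \<in> S" using W'(1) by (simp add: \<Phi>_def s'_def)
        have p'_far: "2 * dist x\<^sub>0 x' - \<kappa> \<le> dist x\<^sub>0 p'"
          using W'(1) Ann(2)[OF W'(2)] by (simp add: \<Phi>_def p'_def g'_def s'_def)
        have "dist x\<^sub>0 x + 3 * \<kappa> + r\<^sub>0 + 10 * C \<le> dist x\<^sub>0 p'"
        proof -
          have "real I \<le> real (i l')" by (simp add: i_def)
          then show ?thesis
            using p'_far Ann(3)[OF W'(2)] Ann(4)[OF W(2)] i_le[OF W(3)] I \<kappa> by linarith
        qed
        from barrier_before_endpoint[OF \<zeta> path _ _ t(2) \<kappa> this path] t(1)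
        have "x \<in> track l p'" using W(2) unfolding track_def \<kappa>'_def by auto
        then have "x \<in> bad l" using l W'(2) s'S unfolding bad_def target_def p'_def g'_def by blast
        moreover have "x \<in> kept l" using z(1) by (auto simp: \<Omega>_def)
        ultimately show False by (simp add: kept_def)
      qed
      from False obtain z where z: "z \<in> \<Omega>" "F z = p" by blast
      define l where "l = fst z"
      \<comment> \<open>For a given endpoint and level, y is recovered from x, s and \<tau>, and x
        is confined to the track of p.\<close>
      define decode :: "'a \<times> ('a \<Rightarrow> 'a) \<times> ('a \<Rightarrow> 'a) \<Rightarrow> nat \<times> 'a \<times> 'a" where "decode = (\<lambda>(x, s, \<tau>). (l, x, finv \<tau> (gx x (finv s (finv (gx x) p)))))"
      have "{z\<in>\<Omega>. F z = p} \<subseteq> decode ` (track l p \<times> (S \<times> T))"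
      proof
        fix z' assume "z' \<in> {z\<in>\<Omega>. F z = p}"
        then have z': "z' \<in> \<Omega>" "F z' = p" by auto
        obtain l' x y where lxy: "z' = (l', x, y)" by (cases z') auto
        have l': "l' = l"
          using no_lower[of l' x y "fst z" "fst (snd z)" "snd (snd z)"] no_lower[of "fst z" "fst (snd z)" "snd (snd z)" l' x y]
            z z' by (simp add: lxy l_def) (meson linorder_neqE_nat)
        note W = \<Omega>[OF z'(1)[unfolded lxy]]
        define s \<tau> where "s = sf (gx x) (hy y)" and "\<tau> = \<tau>f (gx x) (hy y)"
        have f: "\<Phi> (gx x) (hy y) s \<tau>" using W(1) by (simp add: s_def \<tau>_def)
        have Kp: "K (gx x) s \<tau> (hy y) = p" using z'(2) by (simp add: lxy F_def s_def \<tau>_def)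
        have gi: "gx x \<in> carrier isom_group" using Ann(1)[OF W(2)] by simp
        have sS: "s \<in> S" "\<tau> \<in> T" using f by (auto simp: \<Phi>_def)
        have si: "s \<in> carrier isom_group" "\<tau> \<in> carrier isom_group" using sS S T H.isom by auto
        have "y = finv \<tau> (gx x (finv s (finv (gx x) p)))"
          using gi si W(5) by (simp add: K_def flip: Kp)
        then have zb: "z' = decode (x, s, \<tau>)" by (simp add: lxy decode_def l')
        from f obtain \<zeta> where \<zeta>: "\<zeta> \<in> carrier isom_group" "dist (\<zeta> x\<^sub>0) x \<le> \<kappa>"
            "far (finv \<zeta> x\<^sub>0) D\<^sub>0" "near (finv \<zeta> p) r\<^sub>0"
          unfolding \<Phi>_def Kp Ann(2)[OF W(2)] by blast
        obtain t where t: "0 \<le> t" "t \<le> dist x\<^sub>0 p" "dist (finv \<zeta> (path p t)) x\<^sub>0 \<le> r\<^sub>0 + 10 * C"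
          using barrier_hit[OF isom_inv[OF \<zeta>(1)] \<zeta>(4,3) constants(3) path] .
        have "dist (path p t) x \<le> \<kappa>'"
          using t(3) \<zeta>(2) \<kappa>' dist_triangle[of "path p t" x "\<zeta> x\<^sub>0"] by (simp add: isom_dist_inv[OF \<zeta>(1)])
        then have "x \<in> track l p" using t W(2) l' by (auto simp: track_def)
        then show "z' \<in> decode ` (track l p \<times> (S \<times> T))" using zb sS by blast
      qed
      moreover have fin: "finite (track l p \<times> (S \<times> T))" using track S T by simp
      ultimately have "finite {z\<in>\<Omega>. F z = p}" "card {z\<in>\<Omega>. F z = p} \<le> card (track l p \<times> (S \<times> T))"
        by (meson finite_imageI finite_subset, meson card_image_le card_mono finite_imageI order_trans)
      moreover have "card (track l p \<times> (S \<times> T)) \<le> m3 * (card S * card T)"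
        using track by (simp add: card_cartesian_product)
      ultimately show ?thesis by (simp add: m0_def)
    next
      case True
      then show ?thesis by (simp only: finite.emptyI card.empty le0 simp_thms)
    qed
    have "card \<Omega> \<le> m0 * card (orbit_ball H x\<^sub>0 n)"
      by (rule card_le_fibres[OF finite_orbit_ball(2) F_ball fibre])
    moreover have "card \<Omega> = (\<Sum>l<q. card (kept l) * card (orbit_ball H x\<^sub>0 (n - d l)))"
      unfolding \<Omega>_def using Ann_fin finite_orbit_ball by (simp add: kept_def card_cartesian_product)
    ultimately have "(\<Sum>l<q. card (kept l) * card (orbit_ball H x\<^sub>0 (n - d l))) \<le> m0 * card (orbit_ball H x\<^sub>0 n)"
      by (simp only:)
    then have "real (\<Sum>l<q. card (kept l) * card (orbit_ball H x\<^sub>0 (n - d l))) \<le> real (m0 * card (orbit_ball H x\<^sub>0 n))"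
      by (rule of_nat_mono)
    then have *: "(\<Sum>l<q. real (card (kept l)) * real (card (orbit_ball H x\<^sub>0 (n - d l)))) \<le> real m0 * real (card (orbit_ball H x\<^sub>0 n))"
      by (simp only: of_nat_sum of_nat_mult)
    have "c3 * (exp (w * real (d l) / 2) * a) * real m0 \<le> real (card (kept l)) * a" if "l < q" "a \<ge> 0" for l and a :: real
    proof -
      \<comment> \<open>Up to \<open>e0\<close>, \<open>d l\<close> is twice the radius of the
        annulus: this is where the exponent is halved.\<close>
      have "w * real (d l) / 2 = real (i l) * w + w * real e0 / 2" by (simp add: d_def field_simps)
      then have "exp (w * real (d l) / 2) * exp (- (w * real e0 / 2)) = exp (real (i l) * w)"
        by (simp only: exp_add exp_minus) simp
      moreover have "c3 * real m0 = exp (- (w * real e0 / 2)) / (4 * c)"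
        unfolding c3_def using \<open>real m0 > 0\<close> by simp
      moreover have "c3 * (exp (w * real (d l) / 2) * a) * real m0 = (c3 * real m0) * (exp (w * real (d l) / 2) * a)"
        by (simp only: ac_simps)
      ultimately have "c3 * (exp (w * real (d l) / 2) * a) * real m0 = exp (real (i l) * w) / (4 * c) * a"
        by (metis (no_types, lifting) mult.assoc mult.commute times_divide_eq_left)
      also have "\<dots> \<le> real (card (kept l)) * a" by (intro mult_right_mono kept_card that)
      finally show ?thesis .
    qed
    then have "(\<Sum>l<q. c3 * (exp (w * real (d l) / 2) * real (card (orbit_ball H x\<^sub>0 (n - d l)))) * real m0)
        \<le> (\<Sum>l<q. real (card (kept l)) * real (card (orbit_ball H x\<^sub>0 (n - d l))))"
      by (intro sum_mono) simp
    also note *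
    finally have "(c3 * (\<Sum>l<q. exp (w * real (d l) / 2) * real (card (orbit_ball H x\<^sub>0 (n - d l))))) * real m0
        \<le> real (card (orbit_ball H x\<^sub>0 n)) * real m0"
      by (simp add: sum_distrib_left sum_distrib_right mult.commute)
    then show ?thesis by (rule mult_right_le_imp_le) (rule \<open>real m0 > 0\<close>)
  qed

  \<comment> \<open>Growth from the renewal inequality\<close>
  have one: "real (card (orbit_ball H x\<^sub>0 n)) \<ge> 1" for n
  proof -
    have "x\<^sub>0 \<in> orbit_ball H x\<^sub>0 n" unfolding orbit_ball_def by (intro CollectI exI[of _ id]) (simp add: H.id_mem)
    then have "card (orbit_ball H x\<^sub>0 n) > 0" using finite_orbit_ball(2) by (auto simp: card_gt_0_iff)
    then show ?thesis by simp
  qed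
  have "1 \<le> d l \<and> d l \<le> d q" if "l < q" for l
  proof -
    have "I \<ge> 1" using I1 \<kappa> by (cases I) auto
    then have "1 \<le> i l" by (simp add: i_def)
    moreover have "i l \<le> i q" using i_mono[OF that] by simp
    ultimately show ?thesis by (simp add: d_def)
  qed
  from renewal_growth[where a = "\<lambda>n. real (card (orbit_ball H x\<^sub>0 n))", OF one w c3 q this rec] show thesis
    using that by blast
qed

end

theorem theorem1p13:
  fixes x\<^sub>0 :: "'a::metric_space"
    and \<iota> :: "'a \<Rightarrow> 'b::metric_space"
    and E :: "('a \<Rightarrow> 'a) \<Rightarrow> 'b \<Rightarrow> 'b"
    and R :: "'b rel"
    and \<Gamma> H P :: "('a \<Rightarrow> 'a) set"
  assumes "proper_geodesic_space TYPE('a)"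
    and "discrete_isom_subgroup \<Gamma>"
    and "\<not> elementary (isom_group\<lparr>carrier := \<Gamma>\<rparr>)"
    and "convergence_boundary x\<^sub>0 \<iota> E R \<Gamma>"
    and "purely_exponential_growth \<Gamma> x\<^sub>0"
    and "\<exists>f\<in>\<Gamma>. non_pinched_contracting x\<^sub>0 \<iota> R f"
    and "discrete_isom_subgroup H"
    and "confining_subset \<Gamma> H P"
    and "P \<inter> elliptic_radical x\<^sub>0 \<iota> E R \<Gamma> \<subseteq> {\<one>\<^bsub>isom_group\<^esub>}"
  shows "growth_rate H x\<^sub>0 > growth_rate \<Gamma> x\<^sub>0 / 2"
proof -
  obtain f C' where f: "f \<in> \<Gamma>" "f \<in> carrier isom_group"
      "quasi_isometric_embedding_on UNIV (\<lambda>m n::int. real_of_int \<bar>m - n\<bar>) (\<lambda>n::int. (f [^]\<^bsub>isom_group\<^esub> n) x\<^sub>0)"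
      "contracting_set C' (range (\<lambda>n::int. (f [^]\<^bsub>isom_group\<^esub> n) x\<^sub>0))"
    using assms(6) by (auto simp: non_pinched_contracting_def contracting_isometry_def)
  define C where "C = max C' 1"
  have "contracting_set C (range (\<lambda>n::int. (f [^]\<^bsub>isom_group\<^esub> n) x\<^sub>0))"
    using f(4) unfolding contracting_set_def C_def by (meson max.coboundedI1)
  then interpret contracting_action x\<^sub>0 f C \<Gamma>
    using assms(1-3) f discrete_isom_finite_ball[OF assms(1,2)]
    by (intro contracting_action.intro contracting_orbit.intro isom_subgroup.intro contracting_action_axioms.intro)
      (auto simp: C_def discrete_isom_subgroup_def)
  obtain J \<theta> where J: "finite J" "J \<subseteq> \<Gamma>" "\<theta> \<ge> 0"
    "\<And>Q. finite Q \<Longrightarrow> card Q \<le> 4 \<Longrightarrow> \<exists>b\<in>J. \<forall>x\<in>Q. near (b x) \<theta>"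
    using selection[of 4] by metis
  define \<beta> where "\<beta> = (\<Sum>b\<in>J. dist x\<^sub>0 (b x\<^sub>0))"
  define P' where "P' = P - {id}"
  have P: "finite P" "P \<subseteq> carrier isom_group" using assms(8) by (auto simp: confining_subset_def)
  have unb: "\<exists>u\<in>\<Gamma>. dist (p (u x\<^sub>0)) (u x\<^sub>0) > B" if p: "p \<in> P'" for p B
  proof (rule ccontr)
    assume "\<not> ?thesis"
    then have "p \<in> elliptic_radical x\<^sub>0 \<iota> E R \<Gamma>"
      using p P by (intro bounded_displacement_in_radical[OF assms(1,4), of _ B]) (auto simp: P'_def not_less)
    then show False using p assms(9) by (auto simp: P'_def isom_one)
  qed
  have conf: "\<exists>p\<in>P'. finv u \<circ> p \<circ> u \<in> H" if u: "u \<in> \<Gamma>" for u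
  proof -
    have ui: "u \<in> carrier isom_group" using u by simp
    have "finv u \<in> \<Gamma>" by (rule inv_mem[OF u])
    \<comment> \<open>Confinement is applied to the inverse of u, so that the conjugate it provides
      has the form \<open>u h u\<^sup>-\<^sup>1\<close>.\<close>
    then obtain h where h: "h \<in> H" "u \<circ> h \<circ> finv u \<in> P'"
      using assms(8) ui isom_m_inv[OF isom_inv[OF ui]]
      by (fastforce simp: confining_subset_def isom_mult isom_one P'_def isom_inv_inv)
    moreover have "finv u \<circ> (u \<circ> h \<circ> finv u) \<circ> u = h" using ui by (simp add: fun_eq_iff)
    ultimately show ?thesis by metis
  qed
  interpret confined_action x\<^sub>0 f C \<Gamma> H P' J \<theta> \<beta>
  proof (intro confined_action.intro confined_action_axioms.intro)
    show "contracting_action x\<^sub>0 f C \<Gamma>" by (rule contracting_action_axioms)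
    show "subgroup H isom_group" using assms(7) by (simp add: discrete_isom_subgroup_def)
    show "finite {h\<in>H. dist x\<^sub>0 (h x\<^sub>0) \<le> r}" for r by (rule discrete_isom_finite_ball[OF assms(1,7)])
    show "dist x\<^sub>0 (b x\<^sub>0) \<le> \<beta>" if "b \<in> J" for b
      unfolding \<beta>_def using that J by (intro member_le_sum) auto
  qed (use P J unb conf in \<open>auto simp: P'_def\<close>)
  obtain w c where w: "growth_rate \<Gamma> x\<^sub>0 = ereal w" and c: "c \<ge> 1"
    and b: "\<And>n. exp (real n * w) / c \<le> real (card (orbit_ball \<Gamma> x\<^sub>0 n))"
      "\<And>n. real (card (orbit_ball \<Gamma> x\<^sub>0 n)) \<le> c * exp (real n * w)"
    using assms(5) by (auto simp: purely_exponential_growth_def)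
  obtain v A where v: "v > w / 2" "A > 0" "\<And>n. real (card (orbit_ball H x\<^sub>0 n)) \<ge> A * exp (v * real n)"
    using exponential_growth_H[OF c b] by blast
  have "growth_rate \<Gamma> x\<^sub>0 / 2 = ereal (w / 2)" by (simp add: w)
  also have "\<dots> < ereal v" using v(1) by simp
  also have "\<dots> \<le> growth_rate H x\<^sub>0" by (rule growth_rate_ge[OF v(2,3)])
  finally show ?thesis .
qed

end
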